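(* Let $d\ge3$, $n\ge2$ be integers, $U$ a free $\mathbb Z$-module of rank $d$, $x_1\in U$ and $x_1^*\in U^*$ with $x_1^*(x_1)=1$, and let $(\mathbb B,b)$ and the $\mathfrak R$-module homomorphisms $\operatorname{pp}_r:B_r\otimes_{\mathfrak R}B_{d-r}\to B_d$ ($0\le r\le d$) be as defined in the context. The following statements hold. (a) Each homomorphism $\operatorname{pp}_r$, with $0\le r\le d$, is a perfect pairing. (b) For $0\le r\le d$, $\operatorname{pp}_r(\Theta_r\otimes\Theta_{d-r})=(-1)^{r(d-r)}\operatorname{pp}_{d-r}(\Theta_{d-r}\otimes\Theta_r)$ for all $\Theta_r\in B_r$ and $\Theta_{d-r}\in B_{d-r}$. (c) If $0\le r\le d-1$, then $\operatorname{pp}_r(b_{r+1}(\Theta_{r+1})\otimes\Theta_{d-r})+(-1)^{r+1}\operatorname{pp}_{r+1}(\Theta_{r+1}\otimes b_{d-r}(\Theta_{d-r}))=0$ for all $\Theta_{r+1}\in B_{r+1}$ and $\Theta_{d-r}\in B_{d-r}$.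
   Context: Notation. Unadorned $\otimes,\bigwedge,\operatorname{Sym},D$ (divided powers), $(\ )^*$ are over $\mathbb Z$. $\operatorname{Sym}_\bullet U$ acts on $D_\bullet(U^* )$ (the graded dual of $\operatorname{Sym}_\bullet U$) by contraction, $[\mu(\nu)](\mu')=\nu(\mu\mu')$. $U^*$ acts on $\bigwedge^\bullet U$ by $u^*(u_1\wedge\dots\wedge u_r)=\sum_i(-1)^{i+1}u^*(u_i)\,u_1\wedge\dots\widehat{u_i}\dots\wedge u_r$. $\mathfrak R=\operatorname{Sym}_\bullet(U\oplus\operatorname{Sym}_{2n-2}U)$ is bigraded with $\mathfrak R_{(1,0)}=U$ and $\mathfrak R_{(0,1)}=\operatorname{Sym}_{2n-2}U$. $\Phi\in\mathfrak R\otimes D_{2n-2}(U^* )$ is the element corresponding to the inclusion $\operatorname{Sym}_{2n-2}U=\mathfrak R_{(0,1)}\subseteq\mathfrak R$. $p:\operatorname{Sym}_{n-1}U\to\mathfrak R\otimes D_{n-1}(U^* )$ is $p(\mu)=\mu(\Phi)$; $\pmb\delta\in\mathfrak R$ is the determinant of $p$ with respect to a basis of $\operatorname{Sym}_{n-1}U$ and the dual basis of $D_{n-1}(U^* )$; $q:D_{n-1}(U^* )\to\mathfrak R\otimes\operatorname{Sym}_{n-1}U$ is the classical adjoint of $p$, i.e. the unique homomorphism with $[q(\nu)](\Phi)=\pmb\delta\nu$ for all $\nu$. $U_0=\ker(x_1^* )$, so $U=\mathbb Zx_1\oplus U_0$; $U_0^*=\{u^*\in U^*\mid u^*(x_1)=0\}$.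 $\widetilde\Phi\in\mathfrak R\otimes D_{2n-1}(U^* )$ is the unique element with $x_1(\widetilde\Phi)=\Phi$ and $\mu(\widetilde\Phi)=0$ for all $\mu\in\operatorname{Sym}_{2n-1}(U_0)$. Let $x_2,\dots,x_d$ be a basis of $U_0$ and $x_1^*,\dots,x_d^*$ the basis of $U^*$ dual to $x_1,\dots,x_d$ (the constructions do not depend on it). $\binom{x_2,\dots,x_d}{s}$ is the set of monomials of degree $s$ in $x_2,\dots,x_d$; for $m=x_1^{a_1}\cdots x_d^{a_d}$, $m^*={x_1^*}^{(a_1)}\cdots{x_d^*}^{(a_d)}$. Put $\kappa(\theta\otimes\mu)=\sum_{i=1}^d x_i^*(\theta)\otimes x_i\mu$ on $\bigwedge^aU\otimes\operatorname{Sym}_bU$ and $\eta(\theta\otimes\nu)=\sum_{i=1}^d x_i^*(\theta)\otimes x_i(\nu)$ on $\bigwedge^aU\otimes D_b(U^* )$; $L_{a,b}U_0=\ker(\kappa:\bigwedge^aU_0\otimes\operatorname{Sym}_bU_0\to\bigwedge^{a-1}U_0\otimes\operatorname{Sym}_{b+1}U_0)$, $K_{a,b}U_0=\ker(\eta:\bigwedge^aU_0\otimes D_b(U_0^* )\to\bigwedge^{a-1}U_0\otimes D_{b-1}(U_0^* ))$. Maps are extended $\mathfrak R$-linearly; an element of $\operatorname{Sym}_\bullet U$ is viewed in $\mathfrak R$ (via $U=\mathfrak R_{(1,0)}$) when a value in $\mathfrak R$ is required. The complex $(\mathbb B,b)$: $B_0=\mathfrak R$; $B_r=\mathfrak R\otimes(K_{r-1,n-1}U_0\oplus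 L_{r-1,n}U_0)$ for $1\le r\le d-1$; $B_d=\mathfrak R\otimes\bigwedge^{d-1}U_0$. Let $\operatorname{proj}:\operatorname{Sym}_{n-1}U\to\operatorname{Sym}_{n-1}U_0$ be induced by the projection $U\to U_0$ killing $x_1$, and $\mathrm{Kos}(\theta)=\sum_{i=1}^dx_i\otimes x_i^*(\theta)$. $b_1(\nu)=x_1q(\nu)$ for $\nu\in K_{0,n-1}U_0=D_{n-1}(U_0^* )$; $b_1(\mu)=\pmb\delta\mu-x_1q(\mu(\widetilde\Phi))$ for $\mu\in L_{0,n}U_0=\operatorname{Sym}_nU_0$. For $2\le r\le d-1$, $\sum_i\theta_i\otimes\nu_i\in K_{r-1,n-1}U_0$: $b_r(\sum_i\theta_i\otimes\nu_i)$ has component $-x_1\otimes\sum_i\eta(\theta_i\otimes[q(\nu_i)](\widetilde\Phi))+\pmb\delta\sum_i\mathrm{Kos}(\theta_i)\otimes\nu_i$ in $\mathfrak R\otimes K_{r-2,n-1}U_0$ and $-x_1\otimes\sum_i\kappa(\theta_i\otimes\operatorname{proj}(q(\nu_i)))$ in $\mathfrak R\otimes L_{r-2,n}U_0$. For $2\le r\le d-1$, $\sum_i\theta_i\otimes\mu_i\in L_{r-1,n}U_0$: $b_r(\sum_i\theta_i\otimes\mu_i)$ has component $x_1\otimes\sum_i\eta(\theta_i\otimes[q(\mu_i(\widetilde\Phi))](\widetilde\Phi))$ in $\mathfrak R\otimes K_{r-2,n-1}U_0$ and $x_1\otimes\sum_i\kappa(\theta_i\otimes\operatorname{proj}(q(\mu_i(\widetilde\Phi))))+\pmb\delta\sum_i\mathrm{Kos}(\theta_i)\otimes\mu_i$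 in $\mathfrak R\otimes L_{r-2,n}U_0$. For $\omega\in\bigwedge^{d-1}U_0$: $b_d(\omega)$ has component $\sum_{m\in\binom{x_2,\dots,x_d}{n}}[\pmb\delta m-x_1q(m(\widetilde\Phi))]\otimes\eta(\omega\otimes m^* )$ in $\mathfrak R\otimes K_{d-2,n-1}U_0$ and $-\sum_{m\in\binom{x_2,\dots,x_d}{n-1}}x_1q(m^* )\otimes\kappa(\omega\otimes m)$ in $\mathfrak R\otimes L_{d-2,n}U_0$. The pairings: $\operatorname{pp}_0(\alpha\otimes\theta)=\alpha\theta$ and $\operatorname{pp}_d(\theta\otimes\alpha)=\theta\alpha$ for $\alpha\in B_0=\mathfrak R$, $\theta\in B_d$. For $1\le r\le d-1$, $\operatorname{pp}_r$ is the $\mathfrak R$-linear map with $\operatorname{pp}_r\big([\eta(\theta_r\otimes\nu_n)+\kappa(\theta_r'\otimes\mu_{n-1})]\otimes[\eta(\theta_{d-r}\otimes\nu_n')+\kappa(\theta_{d-r}'\otimes\mu_{n-1}')]\big)=[\mu_{n-1}(\nu_n')](\theta_r')\wedge\theta_{d-r}-[\mu_{n-1}'(\nu_n)](\theta_r)\wedge\theta_{d-r}'$ for $\theta_r,\theta_r'\in\bigwedge^rU_0$, $\theta_{d-r},\theta_{d-r}'\in\bigwedge^{d-r}U_0$, $\nu_n,\nu_n'\in D_n(U_0^* )$, $\mu_{n-1},\mu_{n-1}'\in\operatorname{Sym}_{n-1}U_0$; here $\eta(\theta_s\otimes\nu)\in K_{s-1,n-1}U_0\subseteq B_s$, $\kappa(\theta_s\otimes\mu)\in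 L_{s-1,n}U_0\subseteq B_s$ (such elements generate these modules), and $\mu(\nu)\in U_0^*$ acts on $\bigwedge^\bullet U_0$. *)

theory Defs
  imports
    "HOL-Library.Poly_Mapping"
    "HOL-Library.Multiset"
    "HOL-Library.Product_Plus"
    "HOL-Library.FuncSet"
    "Jordan_Normal_Form.Determinant"
begin

section \<open>Modules over a subring and perfect pairings\<close>

text \<open>A commutative ring is given as a subset \<open>R\<close> of a type of class \<open>comm_ring_1\<close>, and modules
  over it as subsets \<open>M\<close>, \<open>N\<close>, \<open>P\<close> of an abelian group with scalar multiplication \<open>sm\<close>. Homomorphisms
  \<open>M \<otimes>\<^sub>R N \<rightarrow> P\<close> are rendered as \<open>R\<close>-bilinear maps on \<open>M \<times> N\<close>.\<close>

definition linear_over :: "'r set \<Rightarrow> ('r \<Rightarrow> 'm \<Rightarrow> 'm) \<Rightarrow> 'm set \<Rightarrow> 'm set \<Rightarrow> ('m::ab_group_add \<Rightarrow> 'm) \<Rightarrow> bool"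
  where "linear_over R sm M P f \<longleftrightarrow>
    (\<forall>a\<in>M. f a \<in> P) \<and>
    (\<forall>a\<in>M. \<forall>b\<in>M. f (a + b) = f a + f b) \<and>
    (\<forall>c\<in>R. \<forall>a\<in>M. f (sm c a) = sm c (f a))"

definition module_Hom :: "'r set \<Rightarrow> ('r \<Rightarrow> 'm \<Rightarrow> 'm) \<Rightarrow> 'm set \<Rightarrow> 'm set \<Rightarrow> ('m::ab_group_add \<Rightarrow> 'm) set"
  where "module_Hom R sm M P = {f \<in> M \<rightarrow>\<^sub>E P. linear_over R sm M P f}"

definition bilinear_over ::
    "'r set \<Rightarrow> ('r \<Rightarrow> 'm \<Rightarrow> 'm) \<Rightarrow> 'm set \<Rightarrow> 'm set \<Rightarrow> 'm set \<Rightarrow> ('m::ab_group_add \<Rightarrow> 'm \<Rightarrow> 'm) \<Rightarrow> bool"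
  where "bilinear_over R sm M N P \<beta> \<longleftrightarrow>
    (\<forall>a\<in>M. linear_over R sm N P (\<beta> a)) \<and> (\<forall>b\<in>N. linear_over R sm M P (\<lambda>a. \<beta> a b))"

definition perfect_pairing ::
    "'r set \<Rightarrow> ('r \<Rightarrow> 'm \<Rightarrow> 'm) \<Rightarrow> 'm set \<Rightarrow> 'm set \<Rightarrow> 'm set \<Rightarrow> ('m::ab_group_add \<Rightarrow> 'm \<Rightarrow> 'm) \<Rightarrow> bool"
  where "perfect_pairing R sm M N P \<beta> \<longleftrightarrow>
    bilinear_over R sm M N P \<beta> \<and>
    bij_betw (\<lambda>a. restrict (\<beta> a) N) M (module_Hom R sm N P) \<and>
    bij_betw (\<lambda>b. restrict (\<lambda>a. \<beta> a b) M) N (module_Hom R sm M P)"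


section \<open>Symmetric, divided power and exterior algebras of a free module with a basis\<close>

text \<open>Let \<open>U\<close> be free with basis \<open>x\<^sub>1, \<dots>, x\<^sub>d\<close>. A monomial in the \<open>x\<^sub>i\<close> is the multiset of its indices.
  With coefficients in \<open>'a\<close>:
  \<^item> \<open>Sym U\<close> is the polynomial ring on the monomials, i.e. the monoid algebra \<open>'a sym\<close> with the
    multiplication of \<^theory>\<open>HOL-Library.Poly_Mapping\<close>;
  \<^item> \<open>D(U\<^sup>*)\<close>, the graded dual, has the basis \<open>m\<^sup>*\<close> dual to the monomials (for
    \<open>m = x\<^sub>1^a\<^sub>1 \<cdots> x\<^sub>d^a\<^sub>d\<close> this is the product of the divided powers of the \<open>x\<^sub>i\<^sup>*\<close>),
    so \<open>\<nu>\<close> is recorded by its values \<open>lookup \<nu> m = \<nu>(m)\<close>;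
  \<^item> \<open>\<And>U\<close> has the basis \<open>x\<^bsub>i\<^sub>1\<^esub> \<and> \<dots> \<and> x\<^bsub>i\<^sub>r\<^esub>\<close> indexed by the sets \<open>{i\<^sub>1 < \<dots> < i\<^sub>r}\<close>;
  \<^item> \<open>\<And>U \<otimes> Sym U\<close> and \<open>\<And>U \<otimes> D(U\<^sup>*)\<close> have the bases of pairs.\<close>

abbreviation "lookup \<equiv> Poly_Mapping.lookup"
abbreviation "keys \<equiv> Poly_Mapping.keys"
abbreviation "single \<equiv> Poly_Mapping.single"

type_synonym mon = "nat multiset"
type_synonym 'a sym = "mon \<Rightarrow>\<^sub>0 'a"
type_synonym 'a dpow = "mon \<Rightarrow>\<^sub>0 'a"
type_synonym 'a ext = "nat set \<Rightarrow>\<^sub>0 'a"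
type_synonym 'a ext_sym = "(nat set \<times> mon) \<Rightarrow>\<^sub>0 'a"
type_synonym 'a ext_dpow = "(nat set \<times> mon) \<Rightarrow>\<^sub>0 'a"

text \<open>Monomials of degree \<open>s\<close> in the variables with index in \<open>V\<close>.\<close>

definition mons :: "nat set \<Rightarrow> nat \<Rightarrow> mon set"
  where "mons V s = {m. set_mset m \<subseteq> V \<and> size m = s}"

definition scl :: "'a::comm_ring_1 \<Rightarrow> ('k \<Rightarrow>\<^sub>0 'a) \<Rightarrow> ('k \<Rightarrow>\<^sub>0 'a)"
  where "scl c f = Poly_Mapping.map ((*) c) f"

text \<open>The evaluation \<open>\<nu>(\<mu>)\<close>.\<close>

definition pair :: "'a::comm_ring_1 dpow \<Rightarrow> 'a sym \<Rightarrow> 'a"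
  where "pair \<nu> \<mu> = (\<Sum>m\<in>keys \<mu>. lookup \<mu> m * lookup \<nu> m)"

text \<open>The contraction \<open>\<mu>(\<nu>)\<close>; on basis elements, \<open>m(k\<^sup>*) = (k/m)\<^sup>*\<close> if \<open>m\<close> divides \<open>k\<close>, and \<open>0\<close> otherwise.
  Lemma \<open>pair_contr\<close> below is the defining property \<open>[\<mu>(\<nu>)](\<mu>') = \<nu>(\<mu>\<mu>')\<close>.\<close>

definition contr :: "'a::comm_ring_1 sym \<Rightarrow> 'a dpow \<Rightarrow> 'a dpow"
  where "contr \<mu> \<nu> = (\<Sum>m\<in>keys \<mu>. \<Sum>k\<in>keys \<nu>.
    if m \<subseteq># k then single (k - m) (lookup \<mu> m * lookup \<nu> k) else 0)"

definition wedge :: "'a::comm_ring_1 ext \<Rightarrow> 'a ext \<Rightarrow> 'a ext"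
  where "wedge \<theta> \<theta>' = (\<Sum>I\<in>keys \<theta>. \<Sum>J\<in>keys \<theta>'.
    if I \<inter> J = {}
    then single (I \<union> J)
      ((- 1) ^ card {(i, j). i \<in> I \<and> j \<in> J \<and> j < i} * lookup \<theta> I * lookup \<theta>' J)
    else 0)"

definition tens :: "'a::comm_ring_1 ext \<Rightarrow> (mon \<Rightarrow>\<^sub>0 'a) \<Rightarrow> ((nat set \<times> mon) \<Rightarrow>\<^sub>0 'a)"
  where "tens \<theta> \<mu> = (\<Sum>I\<in>keys \<theta>. \<Sum>m\<in>keys \<mu>. single (I, m) (lookup \<theta> I * lookup \<mu> m))"

text \<open>The linear map on \<open>\<And>U \<otimes> Sym U\<close> or \<open>\<And>U \<otimes> D(U\<^sup>*)\<close> given by the bilinear formula \<open>\<theta> \<otimes> \<mu> \<mapsto> F \<theta> \<mu>\<close>.\<close>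

definition lin_ext :: "('a::comm_ring_1 ext \<Rightarrow> (mon \<Rightarrow>\<^sub>0 'a) \<Rightarrow> ('k \<Rightarrow>\<^sub>0 'a)) \<Rightarrow>
    ((nat set \<times> mon) \<Rightarrow>\<^sub>0 'a) \<Rightarrow> ('k \<Rightarrow>\<^sub>0 'a)"
  where "lin_ext F T = (\<Sum>(I, m)\<in>keys T.
    scl (lookup T (I, m)) (F (single I 1) (single m 1)))"

text \<open>The identification \<open>\<And>\<^sup>0 U \<otimes> M = M\<close>.\<close>

definition ext0_part :: "((nat set \<times> mon) \<Rightarrow>\<^sub>0 'a::comm_ring_1) \<Rightarrow> (mon \<Rightarrow>\<^sub>0 'a)"
  where "ext0_part T = (\<Sum>(I, m)\<in>keys T. if I = {} then single m (lookup T (I, m)) else 0)"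


text \<open>The polynomial ring on variables \<open>Inl i\<close>, standing for the basis \<open>x\<^sub>i\<close> of \<open>U\<close>, and \<open>Inr m\<close>,
  standing for the basis of monomials \<open>m\<close> of \<open>Sym\<^bsub>2n-2\<^esub> U\<close>. The type has more variables than
  \<open>\<RR> = Sym(U \<oplus> Sym\<^bsub>2n-2\<^esub> U)\<close>; the ring itself is the subset \<open>\<RR>\<close> defined below.\<close>

type_synonym rr = "(nat + mon) multiset \<Rightarrow>\<^sub>0 int"

text \<open>Base change along \<open>\<int> \<rightarrow> \<RR>\<close>.\<close>

definition bc :: "('k \<Rightarrow>\<^sub>0 int) \<Rightarrow> ('k \<Rightarrow>\<^sub>0 rr)"
  where "bc f = Poly_Mapping.map of_int f"

text \<open>All the modules \<open>B\<^sub>r\<close> live in \<open>\<RR> \<times> (\<RR> \<otimes> \<And>U \<otimes> D(U\<^sup>*)) \<times> (\<RR> \<otimes> \<And>U \<otimes> Sym U) \<times> (\<RR> \<otimes> \<And>U)\<close>: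
  \<open>B\<^sub>0\<close> in the first factor, \<open>B\<^sub>r\<close> with \<open>1 \<le> r \<le> d - 1\<close> in the second and third, \<open>B\<^sub>d\<close> in the last.\<close>

type_synonym bmod = "rr \<times> rr ext_dpow \<times> rr ext_sym \<times> rr ext"

fun bscl :: "rr \<Rightarrow> bmod \<Rightarrow> bmod"
  where "bscl c (\<alpha>, k, l, \<omega>) = (c * \<alpha>, scl c k, scl c l, scl c \<omega>)"


section \<open>The complex and the pairings\<close>

text \<open>\<open>U\<close> is the whole type \<open>'u\<close>, \<open>x1s\<close> is the functional \<open>x\<^sub>1\<^sup>*\<close>, and \<open>x 2, \<dots>, x d\<close> is the auxiliary basis
  of \<open>U\<^sub>0 = ker x\<^sub>1\<^sup>*\<close>, so that \<open>x 1 = x\<^sub>1, x 2, \<dots>, x d\<close> is a basis of \<open>U\<close>.\<close>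

locale pointed_free_module =
  fixes d n :: nat
    and scale :: "int \<Rightarrow> 'u::ab_group_add \<Rightarrow> 'u"
    and x1 :: 'u
    and x1s :: "'u \<Rightarrow> int"
    and x :: "nat \<Rightarrow> 'u"
  assumes d_ge_3: "d \<ge> 3"
    and n_ge_2: "n \<ge> 2"
    and module_U: "Modules.module scale"
    and free_U: "\<exists>X. finite X \<and> card X = d \<and> \<not> Modules.module.dependent scale X \<and> Modules.module.span scale X = UNIV"
    and x1s_hom: "Modules.module_hom scale (*) x1s"
    and x1s_x1: "x1s x1 = 1"
    and x_1: "x 1 = x1"
    and inj_x: "inj_on x {2..d}"
    and indep_U0: "\<not> Modules.module.dependent scale (x ` {2..d})"
    and span_U0: "Modules.module.span scale (x ` {2..d}) = {u. x1s u = 0}"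
begin

text \<open>The basis \<open>x\<^sub>1\<^sup>*, \<dots>, x\<^sub>d\<^sup>*\<close> of \<open>U\<^sup>*\<close> dual to \<open>x\<^sub>1, \<dots>, x\<^sub>d\<close>.\<close>

definition xs :: "nat \<Rightarrow> 'u \<Rightarrow> int"
  where "xs i u = Modules.module.representation scale (x ` {1..d}) u (x i)"

text \<open>The inclusions \<open>U = Sym\<^sub>1 U\<close> and \<open>U = \<RR>\<^bsub>(1,0)\<^esub>\<close>.\<close>

definition inSym :: "'u \<Rightarrow> 'a::comm_ring_1 sym"
  where "inSym u = (\<Sum>i=1..d. single {#i#} (of_int (xs i u)))"

definition inR :: "'u \<Rightarrow> rr"
  where "inR u = (\<Sum>i=1..d. single {#Inl i#} (xs i u))"

text \<open>The \<open>\<RR>\<close>-linear extension of \<open>Sym U \<subseteq> \<RR>\<close>.\<close>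

definition toR :: "rr sym \<Rightarrow> rr"
  where "toR f = (\<Sum>m\<in>keys f. lookup f m * (\<Prod>i\<in>#m. inR (x i)))"

text \<open>The action on \<open>\<And>U\<close> of \<open>u\<^sup>* \<in> U\<^sup>*\<close>, and the functional given by \<open>\<nu> \<in> D\<^sub>1(U\<^sup>*) = U\<^sup>*\<close>.\<close>

definition act :: "('u \<Rightarrow> int) \<Rightarrow> 'a::comm_ring_1 ext \<Rightarrow> 'a ext"
  where "act us \<theta> = (\<Sum>I\<in>keys \<theta>. \<Sum>i\<in>I.
    single (I - {i}) ((- 1) ^ card {j\<in>I. j < i} * of_int (us (x i)) * lookup \<theta> I))"

definition functional :: "int dpow \<Rightarrow> 'u \<Rightarrow> int"
  where "functional \<nu> u = pair \<nu> (inSym u)"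

definition kappa :: "'a::comm_ring_1 ext_sym \<Rightarrow> 'a ext_sym"
  where "kappa = lin_ext (\<lambda>\<theta> \<mu>. \<Sum>i=1..d. tens (act (xs i) \<theta>) (inSym (x i) * \<mu>))"

definition eta :: "'a::comm_ring_1 ext_dpow \<Rightarrow> 'a ext_dpow"
  where "eta = lin_ext (\<lambda>\<theta> \<nu>. \<Sum>i=1..d. tens (act (xs i) \<theta>) (contr (inSym (x i)) \<nu>))"

text \<open>The \<open>\<int>\<close>-modules built from \<open>U\<^sub>0\<close>, in terms of its basis \<open>x\<^sub>2, \<dots>, x\<^sub>d\<close>. Here \<open>U\<^sub>0\<^sup>*\<close> has the basis
  \<open>x\<^sub>2\<^sup>*, \<dots>, x\<^sub>d\<^sup>*\<close>.\<close>

definition Ext0 :: "nat \<Rightarrow> int ext set"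
  where "Ext0 a = {\<theta>. \<forall>I\<in>keys \<theta>. I \<subseteq> {2..d} \<and> card I = a}"

definition Sym0 :: "nat \<Rightarrow> int sym set"
  where "Sym0 b = {\<mu>. keys \<mu> \<subseteq> mons {2..d} b}"

definition D0 :: "nat \<Rightarrow> int dpow set"
  where "D0 b = {\<nu>. keys \<nu> \<subseteq> mons {2..d} b}"

definition K0 :: "nat \<Rightarrow> nat \<Rightarrow> int ext_dpow set"
  where "K0 a b = {T. (\<forall>(I, m)\<in>keys T. I \<subseteq> {2..d} \<and> card I = a \<and> m \<in> mons {2..d} b) \<and> eta T = 0}"

definition L0 :: "nat \<Rightarrow> nat \<Rightarrow> int ext_sym set"
  where "L0 a b = {T. (\<forall>(I, m)\<in>keys T. I \<subseteq> {2..d} \<and> card I = a \<and> m \<in> mons {2..d} b) \<and> kappa T = 0}"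

definition RR :: "rr set" (\<open>\<RR>\<close>)
  where "\<RR> = {f. \<forall>k\<in>keys f. set_mset k \<subseteq> Inl ` {1..d} \<union> Inr ` mons {1..d} (2*n - 2)}"

text \<open>\<open>\<RR> \<otimes> M\<close>, as the \<open>\<RR>\<close>-span of \<open>M\<close> in the base change of the ambient free \<open>\<int>\<close>-module; this
  is only used when \<open>M\<close> is a direct summand of that module (a kernel or the span of part of the basis).\<close>

definition tensR :: "('k \<Rightarrow>\<^sub>0 int) set \<Rightarrow> ('k \<Rightarrow>\<^sub>0 rr) set"
  where "tensR M = {(\<Sum>z\<in>Z. scl (c z) (bc z)) | Z c. finite Z \<and> Z \<subseteq> M \<and> c ` Z \<subseteq> \<RR>}"

definition Phi :: "rr dpow"
  where "Phi = (\<Sum>m\<in>mons {1..d} (2*n - 2).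
    single m (single {#Inr m#} 1))"

definition p :: "rr sym \<Rightarrow> rr dpow"
  where "p \<mu> = contr \<mu> Phi"

text \<open>The monomial basis of \<open>Sym\<^bsub>n-1\<^esub> U\<close> in some order, on which \<open>\<delta>\<close> and \<open>q\<close> do not depend. Column \<open>j\<close> of
  the matrix of \<open>p\<close> consists of the coordinates of \<open>p\<close> of the \<open>j\<close>-th basis element in the dual basis.
  The classical adjoint \<open>q\<close> is given by the adjugate matrix; lemma \<open>contr_q_Phi\<close> below shows
  \<open>[q(\<nu>)](\<Phi>) = \<delta>\<nu>\<close>.\<close>

definition basis_list :: "mon list"
  where "basis_list = (SOME ms. distinct ms \<and> set ms = mons {1..d} (n - 1))"

definition p_mat :: "rr mat"
  where "p_mat = mat (length basis_list) (length basis_list)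
    (\<lambda>(i, j). lookup (p (single (basis_list ! j) 1)) (basis_list ! i))"

definition delta :: rr
  where "delta = det p_mat"

definition q :: "rr dpow \<Rightarrow> rr sym"
  where "q \<nu> = (\<Sum>i<length basis_list. \<Sum>j<length basis_list.
    single (basis_list ! i) (adj_mat p_mat $$ (i, j) * lookup \<nu> (basis_list ! j)))"

definition Phi_tilde :: "rr dpow"
  where "Phi_tilde = (THE \<Psi>.
    \<Psi> \<in> tensR {\<nu> :: int dpow. keys \<nu> \<subseteq> mons {1..d} (2*n - 1)} \<and>
    contr (inSym x1) \<Psi> = Phi \<and>
    (\<forall>\<mu>\<in>Sym0 (2*n - 1). contr (bc \<mu>) \<Psi> = 0))"

text \<open>The algebra map \<open>Sym U \<rightarrow> Sym U\<^sub>0\<close> induced by the projection \<open>u \<mapsto> u - x\<^sub>1\<^sup>*(u) x\<^sub>1\<close> of \<open>U\<close> onto \<open>U\<^sub>0\<close>.\<close>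

definition proj :: "rr sym \<Rightarrow> rr sym"
  where "proj f = (\<Sum>m\<in>keys f.
    scl (lookup f m) (\<Prod>i\<in>#m. inSym (x i - scale (x1s (x i)) x1)))"

definition Kos :: "rr ext \<Rightarrow> rr ext"
  where "Kos \<theta> = (\<Sum>i=1..d. scl (inR (x i)) (act (xs i) \<theta>))"

definition B :: "nat \<Rightarrow> bmod set"
  where "B r =
    (if r = 0 then {(\<alpha>, 0, 0, 0) | \<alpha>. \<alpha> \<in> \<RR>}
     else if r < d then {(0, k, l, 0) | k l. k \<in> tensR (K0 (r - 1) (n - 1)) \<and> l \<in> tensR (L0 (r - 1) n)}
     else if r = d then {(0, 0, 0, \<omega>) | \<omega>. \<omega> \<in> tensR (Ext0 (d - 1))}
     else {0})"

text \<open>\<open>b_XY\<close> is the component of \<open>b\<^sub>r\<close> (\<open>2 \<le> r \<le> d - 1\<close>) from the \<open>X\<close>-summand of \<open>B\<^sub>r\<close> to the \<open>Y\<close>-summand of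
  \<open>B\<^bsub>r-1\<^esub>\<close>.\<close>

definition b_KK :: "rr ext_dpow \<Rightarrow> rr ext_dpow"
  where "b_KK = lin_ext (\<lambda>\<theta> \<nu>.
    - scl (inR x1) (eta (tens \<theta> (contr (q \<nu>) Phi_tilde))) + scl delta (tens (Kos \<theta>) \<nu>))"

definition b_KL :: "rr ext_dpow \<Rightarrow> rr ext_sym"
  where "b_KL = lin_ext (\<lambda>\<theta> \<nu>. - scl (inR x1) (kappa (tens \<theta> (proj (q \<nu>)))))"

definition b_LK :: "rr ext_sym \<Rightarrow> rr ext_dpow"
  where "b_LK = lin_ext (\<lambda>\<theta> \<mu>.
    scl (inR x1) (eta (tens \<theta> (contr (q (contr \<mu> Phi_tilde)) Phi_tilde))))"

definition b_LL :: "rr ext_sym \<Rightarrow> rr ext_sym"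
  where "b_LL = lin_ext (\<lambda>\<theta> \<mu>.
    scl (inR x1) (kappa (tens \<theta> (proj (q (contr \<mu> Phi_tilde))))) + scl delta (tens (Kos \<theta>) \<mu>))"

definition b1_K :: "rr dpow \<Rightarrow> rr"
  where "b1_K \<nu> = inR x1 * toR (q \<nu>)"

definition b1_L :: "rr sym \<Rightarrow> rr"
  where "b1_L \<mu> = delta * toR \<mu> - inR x1 * toR (q (contr \<mu> Phi_tilde))"

definition bd_K :: "rr ext \<Rightarrow> rr ext_dpow"
  where "bd_K \<omega> = (\<Sum>m\<in>mons {2..d} n.
    scl (delta * toR (single m 1)
         - inR x1 * toR (q (contr (single m 1) Phi_tilde)))
      (eta (tens \<omega> (single m 1))))"

definition bd_L :: "rr ext \<Rightarrow> rr ext_sym"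
  where "bd_L \<omega> = - (\<Sum>m\<in>mons {2..d} (n - 1).
    scl (inR x1 * toR (q (single m 1))) (kappa (tens \<omega> (single m 1))))"

definition b :: "nat \<Rightarrow> bmod \<Rightarrow> bmod"
  where "b r = (\<lambda>(\<alpha>, k, l, \<omega>).
    if r = 1 then (b1_K (ext0_part k) + b1_L (ext0_part l), 0, 0, 0)
    else if r < d then (0, b_KK k + b_LK l, b_KL k + b_LL l, 0)
    else (0, bd_K \<omega>, bd_L \<omega>, 0))"

definition is_pp :: "nat \<Rightarrow> (bmod \<Rightarrow> bmod \<Rightarrow> bmod) \<Rightarrow> bool"
  where "is_pp r \<beta> \<longleftrightarrow>
    bilinear_over \<RR> bscl (B r) (B (d - r)) (B d) \<beta> \<and>
    (\<forall>\<theta>\<in>Ext0 r. \<forall>\<theta>'\<in>Ext0 r. \<forall>\<rho>\<in>Ext0 (d - r). \<forall>\<rho>'\<in>Ext0 (d - r).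
      \<forall>\<nu>\<in>D0 n. \<forall>\<nu>'\<in>D0 n. \<forall>\<mu>\<in>Sym0 (n - 1). \<forall>\<mu>'\<in>Sym0 (n - 1).
      \<beta> (0, bc (eta (tens \<theta> \<nu>)), bc (kappa (tens \<theta>' \<mu>)), 0)
        (0, bc (eta (tens \<rho> \<nu>')), bc (kappa (tens \<rho>' \<mu>')), 0)
      = (0, 0, 0, bc (wedge (act (functional (contr \<mu> \<nu>')) \<theta>') \<rho>
                      - wedge (act (functional (contr \<mu>' \<nu>)) \<theta>) \<rho>')))"

text \<open>As the elements in \<open>is_pp\<close> generate \<open>B\<^sub>r\<close> and \<open>B\<^bsub>d-r\<^esub>\<close>, a map with \<open>is_pp r\<close> is determined on
  \<open>B\<^sub>r \<times> B\<^bsub>d-r\<^esub>\<close>; the choice operator only selects its irrelevant values elsewhere.\<close>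

definition pp :: "nat \<Rightarrow> bmod \<Rightarrow> bmod \<Rightarrow> bmod"
  where "pp r =
    (if r = 0 then (\<lambda>(\<alpha>, _, _, _) (_, _, _, \<omega>). (0, 0, 0, scl \<alpha> \<omega>))
     else if r = d then (\<lambda>(_, _, _, \<omega>) (\<alpha>, _, _, _). (0, 0, 0, scl \<alpha> \<omega>))
     else (SOME \<beta>. is_pp r \<beta>))"

end


section \<open>Consistency of the basis descriptions\<close>

lemma lookup_scl: "lookup (scl c f) k = c * lookup f k"
  by (simp add: scl_def Poly_Mapping.map.rep_eq when_def)

lemma lookup_contr:
  "lookup (contr \<mu> \<nu>) j = (\<Sum>m\<in>keys \<mu>. lookup \<mu> m * lookup \<nu> (m + j))"
proof -
  have "(\<Sum>k\<in>keys \<nu>. lookup (if m \<subseteq># k then single (k - m) (lookup \<mu> m * lookup \<nu> k) else 0) j)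
        = lookup \<mu> m * lookup \<nu> (m + j)" for m
  proof -
    have "(\<Sum>k\<in>keys \<nu>. lookup (if m \<subseteq># k then single (k - m) (lookup \<mu> m * lookup \<nu> k) else 0) j)
        = (\<Sum>k\<in>keys \<nu>. if k = m + j then lookup \<mu> m * lookup \<nu> k else 0)"
      by (intro sum.cong refl) (auto simp: lookup_single when_def)
    then show ?thesis by (simp add: in_keys_iff)
  qed
  then show ?thesis by (simp add: contr_def lookup_sum)
qed

lemma pair_superset:
  assumes "finite A" "keys \<mu> \<subseteq> A"
  shows "pair \<nu> \<mu> = (\<Sum>m\<in>A. lookup \<mu> m * lookup \<nu> m)"
  unfolding pair_def using assms by (intro sum.mono_neutral_left) (auto simp: in_keys_iff)

lemma pair_add: "pair \<nu> (\<mu> + \<mu>') = pair \<nu> \<mu> + pair \<nu> \<mu>'"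
proof -
  have "keys (\<mu> + \<mu>') \<subseteq> keys \<mu> \<union> keys \<mu>'" by (rule keys_add)
  then show ?thesis
    by (simp add: pair_superset[where A = "keys \<mu> \<union> keys \<mu>'"] lookup_add distrib_right sum.distrib)
qed

lemma pair_zero: "pair \<nu> 0 = 0"
  by (simp add: pair_def)

lemma pair_sum: "pair \<nu> (\<Sum>i\<in>A. f i) = (\<Sum>i\<in>A. pair \<nu> (f i))"
  by (induction A rule: infinite_finite_induct) (simp_all add: pair_add pair_zero)

lemma pair_single: "pair \<nu> (single m c) = c * lookup \<nu> m"
  by (simp add: pair_def)

lemma sum_singles: "f = (\<Sum>m\<in>keys f. single m (lookup f m))"
  by (rule poly_mapping_eqI) (simp add: lookup_sum lookup_single when_def in_keys_iff)

lemma pair_contr: "pair (contr \<mu> \<nu>) \<mu>' = pair \<nu> (\<mu> * \<mu>')"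
proof -
  have "\<mu> * \<mu>' = (\<Sum>m\<in>keys \<mu>. \<Sum>j\<in>keys \<mu>'. single (m + j) (lookup \<mu> m * lookup \<mu>' j))"
    using arg_cong2[OF sum_singles[of \<mu>] sum_singles[of \<mu>'], of "(*)"]
    by (simp only: sum_product mult_single)
  then have "pair \<nu> (\<mu> * \<mu>') = (\<Sum>m\<in>keys \<mu>. \<Sum>j\<in>keys \<mu>'. lookup \<mu> m * lookup \<mu>' j * lookup \<nu> (m + j))"
    by (simp only: pair_sum pair_single)
  also have "\<dots> = (\<Sum>j\<in>keys \<mu>'. \<Sum>m\<in>keys \<mu>. lookup \<mu> m * lookup \<mu>' j * lookup \<nu> (m + j))"
    by (rule sum.swap)
  also have "\<dots> = pair (contr \<mu> \<nu>) \<mu>'"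
    unfolding pair_def[of "contr \<mu> \<nu>"] lookup_contr sum_distrib_left
    by (intro sum.cong refl) (simp only: ac_simps)
  finally show ?thesis by simp
qed

lemma finite_mons: "finite V \<Longrightarrow> finite (mons V s)"
proof -
  assume "finite V"
  have "mons V s \<subseteq> mset ` {xs. set xs \<subseteq> V \<and> length xs = s}"
  proof
    fix m assume "m \<in> mons V s"
    moreover obtain xs where "m = mset xs" by (metis ex_mset)
    ultimately show "m \<in> mset ` {xs. set xs \<subseteq> V \<and> length xs = s}" by (auto simp: mons_def)
  qed
  then show ?thesis
    by (rule finite_subset) (intro finite_imageI finite_lists_length_eq \<open>finite V\<close>)
qed

context pointed_free_module
begin

lemma basis_list: "distinct basis_list" "set basis_list = mons {1..d} (n - 1)"
proof -
  have "finite (mons {1..d} (n - 1))" by (rule finite_mons) (rule finite_atLeastAtMost)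
  then have "\<exists>ms. distinct ms \<and> set ms = mons {1..d} (n - 1)"
    using finite_distinct_list by blast
  then have "distinct basis_list \<and> set basis_list = mons {1..d} (n - 1)"
    unfolding basis_list_def by (rule someI_ex)
  then show "distinct basis_list" "set basis_list = mons {1..d} (n - 1)" by (rule conjunct1, rule conjunct2)
qed

lemma lookup_Phi:
  "lookup Phi m = (if m \<in> mons {1..d} (2*n - 2) then single {#Inr m#} 1 else 0)"
proof -
  have "finite (mons {1..d} (2*n - 2))" by (rule finite_mons) (rule finite_atLeastAtMost)
  then show ?thesis by (simp add: Phi_def lookup_sum lookup_single when_def)
qed

lemma contr_q_Phi:
  assumes "keys \<nu> \<subseteq> mons {1..d} (n - 1)"
  shows "contr (q \<nu>) Phi = scl delta \<nu>"
proof (rule poly_mapping_eqI)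
  fix k
  let ?N = "length basis_list"
  let ?A = "adj_mat p_mat"
  have bl: "size (basis_list ! i) = n - 1" if "i < ?N" for i
    using that basis_list(2) nth_mem[OF that] by (auto simp: mons_def)
  have P: "p_mat \<in> carrier_mat ?N ?N" by (simp add: p_mat_def)
  have Pij: "p_mat $$ (i, j) = lookup Phi (basis_list ! j + basis_list ! i)" if "i < ?N" "j < ?N" for i j
    using that by (simp add: p_mat_def p_def lookup_contr)
  have "lookup (contr (q \<nu>) Phi) k = pair (contr (q \<nu>) Phi) (single k 1)"
    by (simp add: pair_single)
  also have "\<dots> = pair (contr (single k 1) Phi) (q \<nu>)"
    by (simp add: pair_contr mult.commute)
  also have "\<dots> = (\<Sum>i<?N. \<Sum>j<?N. ?A $$ (i, j) * lookup \<nu> (basis_list ! j) * lookup Phi (k + basis_list ! i))"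
    by (simp add: q_def pair_sum pair_single lookup_contr)
  finally have *: "lookup (contr (q \<nu>) Phi) k = \<dots>" .
  show "lookup (contr (q \<nu>) Phi) k = lookup (scl delta \<nu>) k"
  proof (cases "k \<in> mons {1..d} (n - 1)")
    case True
    then obtain l where l: "l < ?N" "k = basis_list ! l"
      using basis_list(2) by (metis in_set_conv_nth)
    have "(\<Sum>i<?N. p_mat $$ (l, i) * ?A $$ (i, j)) = (if l = j then delta else 0)" if j: "j < ?N" for j
    proof -
      have "(p_mat * ?A) $$ (l, j) = (delta \<cdot>\<^sub>m 1\<^sub>m ?N) $$ (l, j)"
        using adj_mat(2)[OF P] by (simp add: delta_def)
      then show ?thesis
        using l j P adj_mat(1)[OF P] by (simp add: scalar_prod_def atLeast0LessThan)
    qed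
    note row = this
    have "lookup (contr (q \<nu>) Phi) k =
        (\<Sum>j<?N. \<Sum>i<?N. ?A $$ (i, j) * lookup \<nu> (basis_list ! j) * lookup Phi (k + basis_list ! i))"
      unfolding * by (rule sum.swap)
    also have "\<dots> = (\<Sum>j<?N. (\<Sum>i<?N. p_mat $$ (l, i) * ?A $$ (i, j)) * lookup \<nu> (basis_list ! j))"
      unfolding sum_distrib_right
      by (intro sum.cong refl) (use l in \<open>simp only: Pij lessThan_iff ac_simps\<close>)
    also have "\<dots> = (\<Sum>j<?N. if l = j then delta * lookup \<nu> (basis_list ! j) else 0)"
      by (intro sum.cong refl) (simp add: row)
    also have "\<dots> = delta * lookup \<nu> k"
      using l by simp
    finally show ?thesis by (simp add: lookup_scl)
  next
    case False
    have "k + basis_list ! i \<notin> mons {1..d} (2 * n - 2)" if "i < ?N" for i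
    proof
      assume "k + basis_list ! i \<in> mons {1..d} (2 * n - 2)"
      then have "set_mset k \<subseteq> {1..d}" "size k + (n - 1) = 2 * n - 2"
        unfolding mons_def using bl[OF that] by simp_all
      then have "k \<in> mons {1..d} (n - 1)"
        unfolding mons_def by simp
      then show False using False by blast
    qed
    then have "lookup Phi (k + basis_list ! i) = 0" if "i < ?N" for i
      using that by (simp only: lookup_Phi if_False)
    then have "lookup (contr (q \<nu>) Phi) k = 0"
      unfolding * by (intro sum.neutral ballI) (simp only: lessThan_iff mult_zero_right)
    moreover have "lookup \<nu> k = 0"
      using False assms by (meson in_keys_iff subsetD)
    ultimately show ?thesis by (simp only: lookup_scl mult_zero_right)
  qed
qed

end

end

theory Submission
  imports Defs
begin

text \<open>Let \<open>V = {2..d}\<close> index the basis \<open>x\<^sub>2, \<dots>, x\<^sub>d\<close> of \<open>U\<^sub>0\<close>. The multiplication of the exterior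
  algebra and the evaluation of divided powers on polynomials combine to one bilinear form,
  \<open>etpair\<close>, between \<open>\<And>\<^sup>rU\<^sub>0 \<otimes> D\<^sub>s(U\<^sub>0\<^sup>*)\<close> and \<open>\<And>\<^bsup>d-1-r\<^esup>U\<^sub>0 \<otimes> Sym\<^sub>sU\<^sub>0\<close>. It is perfect, since it
  matches the two bases up to signs. As \<open>\<And>\<^sup>dU\<^sub>0 = 0\<close>, an interior product can be moved from one
  factor of \<open>\<theta> \<and> \<rho>\<close> to the other at the cost of a sign, and contraction by \<open>x\<^sub>i\<close> is the adjoint of
  multiplication by \<open>x\<^sub>i\<close>. Hence \<eta> and \<kappa> are adjoint up to sign (\<open>etpair_dkosz\<close>, \<open>etpair_kosz\<close>), and
  so is \<open>Kos\<close> to itself (\<open>etpair_lprod\<close>).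

  The complexes of \<kappa> and of \<eta> have explicit contracting homotopies (\<open>kosz_khtpy\<close>, \<open>dkosz_dkhtpy\<close>).
  So in the degrees that occur their cycles are boundaries, over \<open>\<int>\<close> and over \<open>\<RR>\<close>, and for \<open>1 \<le> r <
  d\<close> the summands of \<open>B\<^sub>r\<close> are the cycles with coefficients in \<open>\<RR>\<close> (\<open>tensR_K0\<close>, \<open>tensR_L0\<close>). If \<open>S\<close>
  and \<open>S'\<close> are elements (called chains below) of the tensor products with \<open>\<kappa> S = l\<close> and \<open>\<kappa> S' = l'\<close>,
  then the pairing of \<open>(k, l)\<close> and \<open>(k', l')\<close> is \<open>(-1)\<^bsup>r+1\<^esup> etpair S k' - etpair k S'\<close>. By
  adjointness this does not depend on the chains, so it has the prescribed values on generators; it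
  is the only such map because the boundaries of basis elements generate \<open>B\<^sub>r\<close> (\<open>is_pp_ppx\<close>,
  \<open>is_pp_unique\<close>).

  The sign in the graded symmetry comes from exchanging the factors of \<open>\<theta> \<and> \<rho>\<close> (\<open>ppc_swap\<close>). For the
  perfectness, a homomorphism on \<open>B\<^bsub>d - r\<^esub>\<close> composed with the boundary maps is a linear form on
  chains; it is represented by a chain, which is a cycle because the form vanishes on boundaries of
  boundaries (\<open>ppx_surjective\<close>).

  For the Leibniz rule, each component of \<open>b\<^sub>r\<close> in the middle degrees is the boundary of an explicit
  chain plus \<open>delta Kos\<close>. The boundaries are paired by means of these chains, and \<open>Kos l\<close> is, up to
  sign, the boundary of \<open>Kos S\<close> if \<open>\<kappa> S = l\<close>. The \<open>delta\<close>-terms then cancel because \<open>Kos\<close> is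
  self-adjoint up to sign. The remaining terms cancel because the four maps \<open>proj \<circ> q\<close>, \<open>\<nu> \<mapsto>
  [q(\<nu>)](Phi_tilde)\<close> and their composites with \<open>\<mu> \<mapsto> \<mu>(Phi_tilde)\<close> are adjoint to each other
  (\<open>etpair_chains\<close>). All four adjunctions reduce to the symmetry of \<open>q\<close>, the adjugate of a symmetric
  matrix. The case \<open>r = 0\<close> is an expansion in bases, and \<open>r = d - 1\<close> follows from it by the graded
  symmetry.\<close>

section \<open>Free modules with a basis\<close>

text \<open>An element of a free module with basis indexed by \<open>'k\<close> is a finitely supported function
  \<open>'k \<Rightarrow>\<^sub>0 'a\<close>; \<open>hom\<close> and \<open>form\<close> are the linear maps between such modules and the linear forms on them.\<close>

lemma module_scl: "Modules.module (scl :: 'a::comm_ring_1 \<Rightarrow> ('k \<Rightarrow>\<^sub>0 'a) \<Rightarrow> _)"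
  by unfold_locales (auto intro!: poly_mapping_eqI simp: lookup_scl lookup_add algebra_simps)

lemma module_mult: "Modules.module ((*) :: 'a::comm_ring_1 \<Rightarrow> 'a \<Rightarrow> 'a)"
  by unfold_locales (auto simp: algebra_simps)

abbreviation hom :: "(('k \<Rightarrow>\<^sub>0 'a::comm_ring_1) \<Rightarrow> ('l \<Rightarrow>\<^sub>0 'a)) \<Rightarrow> bool"
  where "hom \<equiv> Modules.module_hom scl scl"

abbreviation form :: "(('k \<Rightarrow>\<^sub>0 'a::comm_ring_1) \<Rightarrow> 'a) \<Rightarrow> bool"
  where "form \<equiv> Modules.module_hom scl (*)"

lemma homI:
  assumes "\<And>a b. f (a + b) = f a + f b" "\<And>c a. f (scl c a) = scl c (f a)"
  shows "hom f"
  unfolding Modules.module_hom_def module_hom_axioms_def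
  by (intro conjI module_scl allI assms)

lemma formI:
  assumes "\<And>a b. f (a + b) = f a + f b" "\<And>c a. f (scl c a) = c * f a"
  shows "form f"
  unfolding Modules.module_hom_def module_hom_axioms_def
  by (intro conjI module_scl module_mult allI assms)

lemmas hom_add = Modules.module_hom.add
lemmas hom_scl = Modules.module_hom.scale
lemmas hom_sum = Modules.module_hom.sum
lemmas hom_zero = Modules.module_hom.zero
lemmas hom_neg = Modules.module_hom.neg
lemmas hom_diff = Modules.module_hom.diff

lemma scl_zero [simp]: "scl c 0 = 0"
  by (rule poly_mapping_eqI) (simp add: lookup_scl)

lemma scl_0_left [simp]: "scl 0 f = 0"
  by (rule poly_mapping_eqI) (simp add: lookup_scl)

lemma scl_one [simp]: "scl 1 f = f"
  by (rule poly_mapping_eqI) (simp add: lookup_scl)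

lemma scl_scl [simp]: "scl c (scl e f) = scl (c * e) f"
  by (rule poly_mapping_eqI) (simp add: lookup_scl mult.assoc)

lemma scl_single [simp]: "scl c (single k e) = single k (c * e)"
  by (rule poly_mapping_eqI) (simp add: lookup_scl lookup_single when_def)

lemma scl_add: "scl c (f + g) = scl c f + scl c g"
  by (rule poly_mapping_eqI) (simp add: lookup_scl lookup_add distrib_left)

lemma scl_add_left: "scl (c + e) f = scl c f + scl e f"
  by (rule poly_mapping_eqI) (simp add: lookup_scl lookup_add distrib_right)

lemma scl_uminus: "scl (- c) f = - scl c f"
  by (rule poly_mapping_eqI) (simp add: lookup_scl)

lemma scl_minus: "scl c (- f) = - scl c f"
  by (rule poly_mapping_eqI) (simp add: lookup_scl)

lemma scl_sum: "scl c (\<Sum>i\<in>A. f i) = (\<Sum>i\<in>A. scl c (f i))"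
  by (rule poly_mapping_eqI) (simp add: lookup_scl lookup_sum sum_distrib_left)

lemma keys_scl: "keys (scl c f) \<subseteq> keys f"
  by (auto simp: in_keys_iff lookup_scl)

lemma keys_single_subset: "keys (single k c) \<subseteq> {k}"
  by (auto simp: in_keys_iff lookup_single when_def split: if_splits)

lemma keys_sum_subset: "(\<And>i. i \<in> A \<Longrightarrow> keys (f i) \<subseteq> X) \<Longrightarrow> keys (\<Sum>i\<in>A. f i) \<subseteq> X"
  by (induction A rule: infinite_finite_induct)
    (auto dest!: subsetD[OF keys_add])

lemma basis_expansion: "T = (\<Sum>k\<in>keys T. scl (lookup T k) (single k 1))"
  using sum_singles[of T] by simp

lemma hom_expansion:
  assumes "Modules.module_hom scl s f"
  shows "f T = (\<Sum>k\<in>keys T. s (lookup T k) (f (single k 1)))"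
proof -
  have "f T = f (\<Sum>k\<in>keys T. scl (lookup T k) (single k 1))"
    using basis_expansion[of T] by simp
  then show ?thesis by (simp only: hom_sum[OF assms] hom_scl[OF assms])
qed

lemma hom_eqI:
  assumes "Modules.module_hom scl s f" "Modules.module_hom scl s g"
    and "\<And>k. k \<in> keys T \<Longrightarrow> f (single k 1) = g (single k 1)"
  shows "f T = g T"
  using assms by (simp add: hom_expansion[OF assms(1), of T] hom_expansion[OF assms(2), of T])

lemma hom_ident: "hom (\<lambda>T. T)"
  by (rule homI) simp_all

lemma hom_compose:
  assumes "hom f" "hom g"
  shows "hom (\<lambda>T. f (g T))"
  by (rule homI)
    (simp_all only: hom_add[OF assms(1)] hom_add[OF assms(2)] hom_scl[OF assms(1)] hom_scl[OF assms(2)])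

lemma form_compose:
  assumes "form f" "hom g"
  shows "form (\<lambda>T. f (g T))"
  by (rule formI)
    (simp_all only: hom_add[OF assms(1)] hom_add[OF assms(2)] hom_scl[OF assms(1)] hom_scl[OF assms(2)])

lemma hom_sumI: "(\<And>i. i \<in> A \<Longrightarrow> hom (f i)) \<Longrightarrow> hom (\<lambda>T. \<Sum>i\<in>A. f i T)"
  by (rule homI; unfold sum.distrib[symmetric] scl_sum; rule sum.cong[OF refl])
    (blast intro: hom_add hom_scl)+

lemma hom_sclI: "hom f \<Longrightarrow> hom (\<lambda>T. scl c (f T))"
  by (rule homI) (simp_all add: hom_add hom_scl scl_add mult.commute)

lemma hom_addI: "hom f \<Longrightarrow> hom g \<Longrightarrow> hom (\<lambda>T. f T + g T)"
  by (rule homI) (simp_all add: hom_add hom_scl scl_add)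

lemma hom_negI: "hom f \<Longrightarrow> hom (\<lambda>T. - f T)"
  by (rule homI) (simp_all add: hom_add hom_scl scl_minus)

lemma form_multI: "form f \<Longrightarrow> form (\<lambda>T. c * f T)"
  by (rule formI) (simp_all add: hom_add hom_scl algebra_simps)

lemma form_lookup: "form (\<lambda>T. lookup T k)"
  by (rule formI) (simp_all add: lookup_add lookup_scl)

lemma form_lookup_compose: "hom f \<Longrightarrow> form (\<lambda>T. lookup (f T) k)"
  by (rule form_compose[OF form_lookup])

text \<open>The linear map with prescribed values on the basis.\<close>

definition lext :: "('k \<Rightarrow> ('l \<Rightarrow>\<^sub>0 'a::comm_ring_1)) \<Rightarrow> ('k \<Rightarrow>\<^sub>0 'a) \<Rightarrow> ('l \<Rightarrow>\<^sub>0 'a)"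
  where "lext G T = (\<Sum>k\<in>keys T. scl (lookup T k) (G k))"

lemma lext_superset:
  assumes "finite A" "keys T \<subseteq> A"
  shows "lext G T = (\<Sum>k\<in>A. scl (lookup T k) (G k))"
  unfolding lext_def using assms by (intro sum.mono_neutral_left) (auto simp: in_keys_iff)

lemma hom_lext: "hom (lext G)"
  for G :: "'a \<Rightarrow> ('b \<Rightarrow>\<^sub>0 'c::comm_ring_1)"
proof (rule homI)
  fix a b :: "'a \<Rightarrow>\<^sub>0 'c"
  have "keys (a + b) \<subseteq> keys a \<union> keys b" by (rule keys_add)
  then show "lext G (a + b) = lext G a + lext G b"
    by (simp add: lext_superset[of "keys a \<union> keys b"] lookup_add scl_add_left sum.distrib)
next
  fix c :: 'c and a :: "'a \<Rightarrow>\<^sub>0 'c"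
  show "lext G (scl c a) = scl c (lext G a)"
    by (simp add: lext_superset[OF _ keys_scl] lookup_scl scl_sum lext_def[of G a])
qed

lemma lext_single [simp]: "lext G (single k c) = scl c (G k)"
  using lext_superset[OF _ keys_single_subset, of k G c] by simp

lemma keys_lext: "(\<And>k. k \<in> keys T \<Longrightarrow> keys (G k) \<subseteq> X) \<Longrightarrow> keys (lext G T) \<subseteq> X"
  unfolding lext_def by (rule keys_sum_subset) (rule order_trans[OF keys_scl])

lemma lin_ext_eq_lext: "lin_ext F = lext (\<lambda>(I, m). F (single I 1) (single m 1))"
proof
  fix T
  show "lin_ext F T = lext (\<lambda>(I, m). F (single I 1) (single m 1)) T"
    unfolding lin_ext_def lext_def
  proof (rule sum.cong[OF refl])
    fix k show "(case k of (I, m) \<Rightarrow> scl (lookup T (I, m)) (F (single I 1) (single m 1))) =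
        scl (lookup T k) (case k of (I, m) \<Rightarrow> F (single I 1) (single m 1))"
      by (cases k) simp
  qed
qed

lemma hom_lin_ext: "hom (lin_ext F)"
  unfolding lin_ext_eq_lext by (rule hom_lext)

lemma lin_ext_single: "lin_ext F (single (I, m) c) = scl c (F (single I 1) (single m 1))"
  by (simp add: lin_ext_eq_lext)


section \<open>Tensor products of linear maps\<close>

lemma lookup_tens: "lookup (tens \<theta> \<mu>) (I, m) = lookup \<theta> I * lookup \<mu> m"
proof -
  have "lookup (tens \<theta> \<mu>) (I, m) =
      (\<Sum>J\<in>keys \<theta>. \<Sum>k\<in>keys \<mu>. if J = I then if k = m then lookup \<theta> J * lookup \<mu> k else 0 else 0)"
    unfolding tens_def lookup_sum
    by (intro sum.cong refl) (auto simp: lookup_single when_def)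
  also have "\<dots> = (\<Sum>J\<in>keys \<theta>. if J = I then \<Sum>k\<in>keys \<mu>. if k = m then lookup \<theta> J * lookup \<mu> k else 0 else 0)"
    by (intro sum.cong refl) auto
  finally show ?thesis by (simp add: in_keys_iff)
qed

lemma tens_single: "tens (single I c) (single m e) = single (I, m) (c * e)"
proof (rule poly_mapping_eqI)
  fix k show "lookup (tens (single I c) (single m e)) k = lookup (single (I, m) (c * e)) k"
    by (cases k) (simp add: lookup_tens lookup_single when_def)
qed

lemma hom_tens_left: "hom (\<lambda>\<theta>. tens \<theta> \<mu>)"
  by (intro homI poly_mapping_eqI)
    (simp_all add: split_paired_all lookup_tens lookup_add lookup_scl algebra_simps)

lemma hom_tens_right: "hom (tens \<theta>)"
  by (intro homI poly_mapping_eqI)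
    (simp_all add: split_paired_all lookup_tens lookup_add lookup_scl algebra_simps)

lemma keys_tens: "keys (tens \<theta> \<mu>) \<subseteq> keys \<theta> \<times> keys \<mu>"
  by (auto simp: in_keys_iff lookup_tens)

text \<open>The tensor product \<open>f \<otimes> g\<close> of linear maps. It is determined by the values of \<open>f\<close> and \<open>g\<close> on basis
  elements; these need not be linear for \<open>tmap f g\<close> to be so.\<close>

definition tmap :: "('a::comm_ring_1 ext \<Rightarrow> 'a ext) \<Rightarrow> ((mon \<Rightarrow>\<^sub>0 'a) \<Rightarrow> (mon \<Rightarrow>\<^sub>0 'a)) \<Rightarrow>
    ((nat set \<times> mon) \<Rightarrow>\<^sub>0 'a) \<Rightarrow> ((nat set \<times> mon) \<Rightarrow>\<^sub>0 'a)"
  where "tmap f g = lext (\<lambda>(I, m). tens (f (single I 1)) (g (single m 1)))"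

lemma hom_tmap: "hom (tmap f g)"
  unfolding tmap_def by (rule hom_lext)

lemma tmap_single: "tmap f g (single (I, m) c) = scl c (tens (f (single I 1)) (g (single m 1)))"
  by (simp add: tmap_def)

lemma tmap_tens:
  assumes "hom f" "hom g"
  shows "tmap f g (tens \<theta> \<mu>) = tens (f \<theta>) (g \<mu>)"
proof -
  have "tmap f g (tens \<theta> \<mu>) = tens (f \<theta>) (g \<mu>)" if "\<mu> = single m 1" "\<theta> = single I 1" for \<theta> \<mu> m I
    using that by (simp add: tens_single tmap_single)
  then have "tmap f g (tens \<theta> \<mu>) = tens (f \<theta>) (g \<mu>)" if "\<mu> = single m 1" for \<theta> \<mu> m
    using that
    by (intro hom_eqI[of scl "\<lambda>\<theta>. tmap f g (tens \<theta> \<mu>)" "\<lambda>\<theta>. tens (f \<theta>) (g \<mu>)" \<theta>]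
        hom_compose[OF hom_tmap hom_tens_left] hom_compose[OF hom_tens_left assms(1)]) auto
  then show ?thesis
    by (intro hom_eqI[of scl "\<lambda>\<mu>. tmap f g (tens \<theta> \<mu>)" "\<lambda>\<mu>. tens (f \<theta>) (g \<mu>)" \<mu>]
        hom_compose[OF hom_tmap hom_tens_right] hom_compose[OF hom_tens_right assms(2)]) auto
qed

lemma tmap_tmap:
  assumes "hom f" "hom g"
  shows "tmap f g (tmap f' g' T) = tmap (\<lambda>\<theta>. f (f' \<theta>)) (\<lambda>\<mu>. g (g' \<mu>)) T"
  by (rule hom_eqI[OF hom_compose[OF hom_tmap hom_tmap] hom_tmap])
    (auto simp: tmap_single tmap_tens[OF assms])

lemma tmap_cong:
  assumes "\<And>I m. (I, m) \<in> keys T \<Longrightarrow> f (single I 1) = f' (single I 1)"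
    and "\<And>I m. (I, m) \<in> keys T \<Longrightarrow> g (single m 1) = g' (single m 1)"
  shows "tmap f g T = tmap f' g' T"
  by (rule hom_eqI[OF hom_tmap hom_tmap]) (auto simp: tmap_single assms)

lemma tmap_sum_left: "tmap (\<lambda>\<theta>. \<Sum>i\<in>A. f i \<theta>) g T = (\<Sum>i\<in>A. tmap (f i) g T)"
  by (rule hom_eqI[OF hom_tmap hom_sumI[OF hom_tmap]])
    (auto simp: tmap_single hom_sum[OF hom_tens_left])

lemma tmap_scl_left: "tmap (\<lambda>\<theta>. scl c (f \<theta>)) g T = scl c (tmap f g T)"
  by (rule hom_eqI[OF hom_tmap hom_sclI[OF hom_tmap]])
    (auto simp: tmap_single hom_scl[OF hom_tens_left])

lemma tmap_scl_right: "tmap f (\<lambda>\<mu>. scl c (g \<mu>)) T = scl c (tmap f g T)"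
  by (rule hom_eqI[OF hom_tmap hom_sclI[OF hom_tmap]])
    (auto simp: tmap_single hom_scl[OF hom_tens_right])

lemma tmap_neg_left: "tmap (\<lambda>\<theta>. - f \<theta>) g T = - tmap f g T"
  by (rule hom_eqI[OF hom_tmap hom_negI[OF hom_tmap]])
    (auto simp: tmap_single hom_neg[OF hom_tens_left])

lemma tmap_ident: "tmap (\<lambda>\<theta>. \<theta>) (\<lambda>\<mu>. \<mu>) T = T"
  by (rule hom_eqI[OF hom_tmap hom_ident]) (auto simp: tmap_single tens_single)

lemma keys_tmap:
  assumes "keys T \<subseteq> A \<times> S" "\<And>I. I \<in> A \<Longrightarrow> keys (f (single I 1)) \<subseteq> A'"
    and "\<And>m. m \<in> S \<Longrightarrow> keys (g (single m 1)) \<subseteq> S'"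
  shows "keys (tmap f g T) \<subseteq> A' \<times> S'"
  unfolding tmap_def
proof (rule keys_lext)
  fix k assume "k \<in> keys T"
  then obtain I m where "k = (I, m)" "I \<in> A" "m \<in> S" using assms(1) by blast
  then show "keys (case k of (I, m) \<Rightarrow> tens (f (single I 1)) (g (single m 1))) \<subseteq> A' \<times> S'"
    using keys_tens[of "f (single I 1)" "g (single m 1)"] assms(2)[of I] assms(3)[of m] by auto
qed


section \<open>Multiplication, contraction and the evaluation pairing\<close>

lemma pair_commute: "pair \<nu> \<mu> = pair \<mu> \<nu>"
proof -
  have "pair \<nu> \<mu> = (\<Sum>m\<in>keys \<mu> \<union> keys \<nu>. lookup \<mu> m * lookup \<nu> m)"
    by (rule pair_superset) auto
  also have "\<dots> = (\<Sum>m\<in>keys \<mu> \<union> keys \<nu>. lookup \<nu> m * lookup \<mu> m)"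
    by (simp only: mult.commute)
  also have "\<dots> = pair \<mu> \<nu>"
    by (rule pair_superset[symmetric]) auto
  finally show ?thesis .
qed

lemma form_pair_right: "form (pair \<nu>)"
proof (rule formI)
  show "pair \<nu> (scl c a) = c * pair \<nu> a" for c a
    by (simp add: pair_superset[OF _ keys_scl] lookup_scl sum_distrib_left mult.assoc pair_def[of \<nu> a])
qed (rule pair_add)

lemma form_pair_left: "form (\<lambda>\<nu>. pair \<nu> \<mu>)"
  unfolding pair_commute[of _ \<mu>] by (rule form_pair_right)

lemma lookup_eq_pair: "lookup \<nu> m = pair \<nu> (single m 1)"
  by (simp add: pair_single)

lemma hom_times: "hom ((*) f)" for f :: "'a::comm_ring_1 sym"
proof (rule homI)
  fix c :: 'a and a :: "'a sym"
  have scl: "scl c g = single {#} c * g" for g :: "'a sym"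
  proof -
    have "single {#} c * g = single {#} c * (\<Sum>m\<in>keys g. single m (lookup g m))"
      using sum_singles[of g] by simp
    also have "\<dots> = (\<Sum>m\<in>keys g. scl c (single m (lookup g m)))"
      by (simp add: sum_distrib_left mult_single)
    also have "\<dots> = scl c g"
      using sum_singles[of g] by (simp only: scl_sum[symmetric])
    finally show ?thesis by simp
  qed
  show "f * scl c a = scl c (f * a)" by (simp add: scl ac_simps)
qed (simp add: algebra_simps)

lemma hom_contr_right: "hom (contr \<mu>)"
  by (intro homI poly_mapping_eqI)
    (simp_all add: lookup_contr lookup_add lookup_scl algebra_simps sum.distrib sum_distrib_left)

lemma hom_contr_left: "hom (\<lambda>\<mu>. contr \<mu> \<nu>)"
proof -
  have "lookup (contr \<mu> \<nu>) k = pair \<nu> (single k 1 * \<mu>)" for \<mu> k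
    by (simp add: lookup_eq_pair pair_contr mult.commute)
  then show ?thesis
    by (intro homI poly_mapping_eqI)
      (simp_all add: lookup_add lookup_scl hom_add[OF hom_times] hom_scl[OF hom_times]
        hom_add[OF form_pair_right] hom_scl[OF form_pair_right])
qed

lemma contr_contr: "contr \<mu> (contr \<mu>' \<nu>) = contr (\<mu> * \<mu>') \<nu>"
  by (rule poly_mapping_eqI) (simp add: lookup_eq_pair pair_contr ac_simps)

lemma contr_single:
  "contr (single k 1) (single m 1) = (if k \<subseteq># m then single (m - k) 1 else (0::'a::comm_ring_1 dpow))"
  by (simp add: contr_def)

lemma keys_contr: "keys (contr \<mu> \<nu>) \<subseteq> {j. \<exists>m\<in>keys \<mu>. m + j \<in> keys \<nu>}"
proof
  fix j assume "j \<in> keys (contr \<mu> \<nu>)"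
  then have "(\<Sum>m\<in>keys \<mu>. lookup \<mu> m * lookup \<nu> (m + j)) \<noteq> 0" by (simp add: in_keys_iff lookup_contr)
  then obtain m where "m \<in> keys \<mu>" "lookup \<mu> m * lookup \<nu> (m + j) \<noteq> 0" by (meson sum.not_neutral_contains_not_neutral)
  then have "m + j \<in> keys \<nu>" by (auto simp: in_keys_iff)
  with \<open>m \<in> keys \<mu>\<close> show "j \<in> {j. \<exists>m\<in>keys \<mu>. m + j \<in> keys \<nu>}" by blast
qed

section \<open>Interior products and the maps \<kappa> and \<eta>\<close>

text \<open>The sign of the contraction of the basis element with index set \<open>I\<close> by \<open>x\<^sub>i\<^sup>*\<close>.\<close>

definition isgn :: "nat \<Rightarrow> nat set \<Rightarrow> 'a::comm_ring_1"
  where "isgn i I = (- 1) ^ card {j \<in> I. j < i}"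

lemma isgn_insert_less:
  assumes "finite I" "i \<notin> I" "i < j"
  shows "isgn j (insert i I) = - isgn j I"
proof -
  have "{k \<in> insert i I. k < j} = insert i {k \<in> I. k < j}" using assms by auto
  then show ?thesis using assms by (simp add: isgn_def)
qed

lemma isgn_insert_ge:
  assumes "\<not> i < j"
  shows "isgn j (insert i I) = isgn j I"
proof -
  have "{k \<in> insert i I. k < j} = {k \<in> I. k < j}" using assms by auto
  then show ?thesis by (simp add: isgn_def)
qed

lemma isgn_remove_ge: "\<not> i < j \<Longrightarrow> isgn j (I - {i}) = isgn j I"
  by (cases "i \<in> I") (metis insert_Diff isgn_insert_ge, simp)

lemma isgn_remove_less: "finite I \<Longrightarrow> i \<in> I \<Longrightarrow> i < j \<Longrightarrow> isgn j (I - {i}) = - isgn j I"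
  using isgn_insert_less[of "I - {i}" i j, where 'a = 'a] by (simp add: insert_absorb)

lemma isgn_square [simp]: "isgn i I * isgn i I = (1::'a::comm_ring_1)"
  by (simp add: isgn_def flip: power_mult_distrib)

lemma isgn_lowest: "(\<And>j. j \<in> I \<Longrightarrow> i \<le> j) \<Longrightarrow> isgn i I = 1"
proof -
  assume "\<And>j. j \<in> I \<Longrightarrow> i \<le> j"
  then have "{j \<in> I. j < i} = {}" by force
  then show ?thesis unfolding isgn_def by (simp only: card.empty power_0)
qed

text \<open>The interior product with \<open>x\<^sub>i\<^sup>*\<close>. Infinite index sets, which do not belong to the exterior algebra,
  are sent to zero.\<close>

definition iprod :: "nat \<Rightarrow> 'a::comm_ring_1 ext \<Rightarrow> 'a ext"
  where "iprod i = lext (\<lambda>I. if finite I \<and> i \<in> I then single (I - {i}) (isgn i I) else 0)"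

lemma hom_iprod: "hom (iprod i)"
  unfolding iprod_def by (rule hom_lext)

lemma iprod_single:
  "iprod i (single I c) = (if finite I \<and> i \<in> I then single (I - {i}) (c * isgn i I) else 0)"
  by (simp add: iprod_def)

lemma iprod_anticommute: "iprod i (iprod j \<theta>) = - iprod j (iprod i \<theta>)"
proof (rule hom_eqI[OF hom_compose[OF hom_iprod hom_iprod] hom_negI[OF hom_compose[OF hom_iprod hom_iprod]]])
  fix I :: "nat set"
  have *: "isgn j I * isgn i (I - {j}) = - (isgn i I * isgn j (I - {i}) :: 'a)"
    if "finite I" "i \<in> I" "j \<in> I" "i < j" for i j
    using that by (simp add: isgn_remove_less isgn_remove_ge mult.commute)
  have "isgn j I * isgn i (I - {j}) = - (isgn i I * isgn j (I - {i}) :: 'a)"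
    if "finite I" "i \<in> I" "j \<in> I" "i \<noteq> j"
    using that *[of i j] *[of j i] by (cases "i < j") auto
  moreover have "I - {j} - {i} = I - {i} - {j}" by blast
  ultimately show "iprod i (iprod j (single I 1)) = - iprod j (iprod i (single I 1) :: 'a ext)"
    by (auto simp: iprod_single hom_zero[OF hom_iprod] single_uminus)
qed

lemma iprod_iprod: "iprod i (iprod i \<theta>) = 0"
  by (rule hom_eqI[of scl _ "\<lambda>_. 0", OF hom_compose[OF hom_iprod hom_iprod] homI])
    (auto simp: iprod_single hom_zero[OF hom_iprod])

text \<open>The maps \<open>\<Sum>\<^sub>i x\<^sub>i\<^sup>* \<otimes> h\<^sub>i\<close>, where the \<open>h\<^sub>i\<close> are commuting linear maps on the second factor. For
  multiplication by \<open>x\<^sub>i\<close> this is \<kappa>, for contraction by \<open>x\<^sub>i\<close> it is \<eta>; the index \<open>i\<close> runs over \<open>X\<close>.\<close>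

definition cmap :: "nat set \<Rightarrow> (nat \<Rightarrow> (mon \<Rightarrow>\<^sub>0 'a) \<Rightarrow> (mon \<Rightarrow>\<^sub>0 'a)) \<Rightarrow>
    ((nat set \<times> mon) \<Rightarrow>\<^sub>0 'a::comm_ring_1) \<Rightarrow> ((nat set \<times> mon) \<Rightarrow>\<^sub>0 'a)"
  where "cmap X h T = (\<Sum>i\<in>X. tmap (iprod i) (h i) T)"

definition kosz :: "nat set \<Rightarrow> 'a::comm_ring_1 ext_sym \<Rightarrow> 'a ext_sym"
  where "kosz X = cmap X (\<lambda>i. (*) (single {#i#} 1))"

definition dkosz :: "nat set \<Rightarrow> 'a::comm_ring_1 ext_dpow \<Rightarrow> 'a ext_dpow"
  where "dkosz X = cmap X (\<lambda>i. contr (single {#i#} 1))"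

lemma kosz_eq: "kosz X T = (\<Sum>i\<in>X. tmap (iprod i) ((*) (single {#i#} 1)) T)"
  by (simp add: kosz_def cmap_def)

lemma dkosz_eq: "dkosz X T = (\<Sum>i\<in>X. tmap (iprod i) (contr (single {#i#} 1)) T)"
  by (simp add: dkosz_def cmap_def)

lemma hom_cmap: "hom (cmap X h)"
  unfolding cmap_def[abs_def] by (intro hom_sumI hom_tmap)

lemma hom_kosz: "hom (kosz X)"
  unfolding kosz_def by (rule hom_cmap)

lemma hom_dkosz: "hom (dkosz X)"
  unfolding dkosz_def by (rule hom_cmap)

lemma sum_antisymmetric:
  fixes a :: "'i \<Rightarrow> 'i \<Rightarrow> 'b::ab_group_add"
  assumes "\<And>i j. a i j = - a j i" "\<And>i. a i i = 0"
  shows "(\<Sum>i\<in>X. \<Sum>j\<in>X. a i j) = 0"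
proof (induction X rule: infinite_finite_induct)
  case (insert y X)
  have "(\<Sum>j\<in>X. a y j) = - (\<Sum>j\<in>X. a j y)"
    by (simp add: assms(1)[of y] sum_negf)
  with insert show ?case by (simp add: sum.distrib assms(2))
qed simp_all

lemma cmap_cmap:
  assumes hom: "\<And>i. hom (h i)" and comm: "\<And>i j \<mu>. h i (h j \<mu>) = h j (h i \<mu>)"
  shows "cmap X h (cmap X h T) = 0"
proof -
  let ?a = "\<lambda>i j. tmap (\<lambda>\<theta>. iprod i (iprod j \<theta>)) (\<lambda>\<mu>. h i (h j \<mu>)) T"
  have "cmap X h (cmap X h T) = (\<Sum>i\<in>X. \<Sum>j\<in>X. ?a i j)"
    by (simp add: cmap_def hom_sum[OF hom_tmap] tmap_tmap[OF hom_iprod hom])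
  also have "\<dots> = 0"
  proof (rule sum_antisymmetric)
    show "?a i j = - ?a j i" for i j
      by (subst iprod_anticommute) (simp only: tmap_neg_left comm[of i])
    show "?a i i = 0" for i
      unfolding iprod_iprod
      by (rule hom_eqI[of scl _ "\<lambda>_. 0", OF hom_tmap homI])
        (auto simp: tmap_single hom_zero[OF hom_tens_left])
  qed
  finally show ?thesis .
qed

lemma kosz_kosz: "kosz X (kosz X T) = 0"
  unfolding kosz_def by (rule cmap_cmap[OF hom_times]) (simp add: mult.left_commute)

lemma dkosz_dkosz: "dkosz X (dkosz X T) = 0"
  unfolding dkosz_def by (rule cmap_cmap[OF hom_contr_right]) (simp add: contr_contr mult.commute)

lemma kosz_single:
  assumes "finite X" "I \<subseteq> X"
  shows "kosz X (single (I, m) 1) = (\<Sum>i\<in>I. single (I - {i}, add_mset i m) (isgn i I))"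
proof -
  have fin: "finite I" using assms finite_subset by blast
  have "kosz X (single (I, m) 1) =
      (\<Sum>i\<in>X. if i \<in> I then single (I - {i}, add_mset i m) (isgn i I) else 0)"
    unfolding kosz_eq using fin
    by (intro sum.cong refl)
      (auto simp: tmap_single iprod_single tens_single mult_single hom_zero[OF hom_tens_left])
  also have "\<dots> = (\<Sum>i\<in>I. single (I - {i}, add_mset i m) (isgn i I))"
    using assms by (simp add: sum.If_cases Int_absorb1)
  finally show ?thesis .
qed

lemma dkosz_single:
  assumes "finite X" "I \<subseteq> X"
  shows "dkosz X (single (I, m) 1) =
    (\<Sum>i\<in>{i \<in> I. i \<in># m}. single (I - {i}, m - {#i#}) (isgn i I))"
proof -
  have fin: "finite I" using assms finite_subset by blast
  have "dkosz X (single (I, m) 1) =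
      (\<Sum>i\<in>X. if i \<in> I \<and> i \<in># m then single (I - {i}, m - {#i#}) (isgn i I) else 0)"
    unfolding dkosz_eq using fin
    by (intro sum.cong refl)
      (auto simp: tmap_single iprod_single tens_single contr_single hom_zero[OF hom_tens_left]
        hom_zero[OF hom_tens_right])
  also have "\<dots> = (\<Sum>i\<in>{i \<in> I. i \<in># m}. single (I - {i}, m - {#i#}) (isgn i I))"
  proof -
    have "{i \<in> X. i \<in> I \<and> i \<in># m} = {i \<in> I. i \<in># m}" using assms(2) by auto
    then show ?thesis by (simp only: sum.inter_filter[OF assms(1), symmetric])
  qed
  finally show ?thesis .
qed

subsection \<open>Contracting homotopies\<close>

text \<open>On a basis element \<open>x\<^sub>I \<otimes> m\<close>, the homotopy for \<kappa> moves the lowest variable that occurs in \<open>x\<^sub>I \<otimes> m\<close>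
  from \<open>m\<close> to the exterior factor, unless it is already there.\<close>

definition khtpy :: "'a::comm_ring_1 ext_sym \<Rightarrow> 'a ext_sym"
  where "khtpy = lext (\<lambda>(I, m). let i = Min (I \<union> set_mset m) in
    if i \<in> I then 0 else single (insert i I, m - {#i#}) 1)"

text \<open>The homotopy for \<eta> is its adjoint. It multiplies both factors by \<open>x\<^sub>i\<close>, up to sign, where \<open>i\<close> is the
  lowest index that is missing in \<open>I\<close> or occurs in \<open>m\<close>; the result is zero if \<open>i \<in> I\<close>.\<close>

definition dkhtpy :: "nat set \<Rightarrow> 'a::comm_ring_1 ext_dpow \<Rightarrow> 'a ext_dpow"
  where "dkhtpy X = lext (\<lambda>(I, m). let i = Min ((X - I) \<union> set_mset m) in
    if i \<in> I then 0 else single (insert i I, add_mset i m) (isgn i I))"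

lemma hom_khtpy: "hom khtpy"
  unfolding khtpy_def by (rule hom_lext)

lemma hom_dkhtpy: "hom (dkhtpy X)"
  unfolding dkhtpy_def by (rule hom_lext)

lemma khtpy_single:
  assumes "finite I" "i \<in> I \<union> set_mset m" "\<And>j. j \<in> I \<union> set_mset m \<Longrightarrow> i \<le> j"
  shows "khtpy (single (I, m) c) = (if i \<in> I then 0 else single (insert i I, m - {#i#}) c)"
proof -
  have "Min (I \<union> set_mset m) = i" using assms by (intro Min_eqI) auto
  then show ?thesis by (simp add: khtpy_def)
qed

lemma dkhtpy_single:
  assumes "finite X" "i \<in> (X - I) \<union> set_mset m" "\<And>j. j \<in> (X - I) \<union> set_mset m \<Longrightarrow> i \<le> j"
  shows "dkhtpy X (single (I, m) c) =
    (if i \<in> I then 0 else single (insert i I, add_mset i m) (c * isgn i I))"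
proof -
  have "Min ((X - I) \<union> set_mset m) = i" using assms by (intro Min_eqI) auto
  then show ?thesis by (simp add: dkhtpy_def)
qed

text \<open>The basis element \<open>1 \<otimes> 1\<close> is excluded; at it, the complex of \<kappa> is not exact.\<close>

lemma kosz_khtpy:
  assumes X: "finite X"
    and T: "\<And>I m. (I, m) \<in> keys T \<Longrightarrow> I \<subseteq> X \<and> set_mset m \<subseteq> X \<and> (I \<noteq> {} \<or> m \<noteq> {#})"
  shows "kosz X (khtpy T) + khtpy (kosz X T) = T"
proof (rule hom_eqI[OF hom_addI[OF hom_compose[OF hom_kosz hom_khtpy] hom_compose[OF hom_khtpy hom_kosz]] hom_ident])
  fix k assume "k \<in> keys T"
  then obtain I m where k: "k = (I, m)" and I: "I \<subseteq> X" "set_mset m \<subseteq> X" "I \<union> set_mset m \<noteq> {}"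
    using T by (cases k) force
  \<comment> \<open>The lowest variable \<open>i\<close> does not change when \<kappa> moves another one.\<close>
  define i where "i = Min (I \<union> set_mset m)"
  have fin: "finite I" using I X finite_subset by blast
  then have i: "i \<in> I \<union> set_mset m" "\<And>j. j \<in> I \<union> set_mset m \<Longrightarrow> i \<le> j"
    using Min_in[of "I \<union> set_mset m"] Min_le[of "I \<union> set_mset m"] I(3) fin by (simp_all add: i_def)
  have htpy0: "khtpy (single (I, m) c) = (if i \<in> I then 0 else single (insert i I, m - {#i#}) c)"
    for c :: 'a
    by (rule khtpy_single[OF fin i])
  have htpy: "khtpy (single (I - {j}, add_mset j m) c) =
      (if j = i then single (I, m) c
       else if i \<in> I then 0 else single (insert i (I - {j}), add_mset j m - {#i#}) c)"
    if "j \<in> I" for j and c :: 'a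
  proof -
    have "khtpy (single (I - {j}, add_mset j m) c) = (if i \<in> I - {j} then 0
        else single (insert i (I - {j}), add_mset j m - {#i#}) c)"
      using fin i that by (intro khtpy_single) auto
    then show ?thesis using that by (auto simp: insert_absorb)
  qed
  have second: "khtpy (kosz X (single (I, m) 1)) =
      (\<Sum>j\<in>I. khtpy (single (I - {j}, add_mset j m) (isgn j I :: 'a)))"
    by (simp add: kosz_single[OF X I(1)] hom_sum[OF hom_khtpy])
  show "kosz X (khtpy (single k 1)) + khtpy (kosz X (single k 1)) = (single k 1 :: 'a ext_sym)"
  proof (cases "i \<in> I")
    case True
    have "khtpy (kosz X (single (I, m) 1)) =
        (\<Sum>j\<in>I. if j = i then single (I, m) (isgn i I :: 'a) else 0)"
      unfolding second by (intro sum.cong refl) (use True in \<open>simp add: htpy\<close>)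
    then have "khtpy (kosz X (single (I, m) 1)) = (single (I, m) (isgn i I) :: 'a ext_sym)"
      using True fin by simp
    moreover have "khtpy (single (I, m) 1) = (0 :: 'a ext_sym)"
      using True by (simp add: htpy0)
    moreover have "isgn i I = (1 :: 'a)"
      using i(2) by (intro isgn_lowest) blast
    ultimately show ?thesis by (simp add: k hom_zero[OF hom_kosz])
  next
    case False
    then have "i \<in># m" using i(1) by blast
    have lt: "i < j" if "j \<in> I" for j using that i(2)[of j] False by (metis UnCI le_neq_implies_less)
    have "kosz X (khtpy (single (I, m) 1)) = kosz X (single (insert i I, m - {#i#}) (1::'a))"
      using False by (simp add: htpy0)
    also have "\<dots> = (\<Sum>j\<in>insert i I. single (insert i I - {j}, add_mset j (m - {#i#})) (isgn j (insert i I)))"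
      using I(1,2) \<open>i \<in># m\<close> by (intro kosz_single[OF X]) auto
    also have "\<dots> = single (I, m) 1 +
        (\<Sum>j\<in>I. single (insert i I - {j}, add_mset j (m - {#i#})) (isgn j (insert i I)))"
    proof -
      have "isgn i (insert i I) = (1 :: 'a)" using i(2) by (intro isgn_lowest) blast
      then show ?thesis using False fin \<open>i \<in># m\<close> by simp
    qed
    also have "(\<Sum>j\<in>I. single (insert i I - {j}, add_mset j (m - {#i#})) (isgn j (insert i I))) =
        (\<Sum>j\<in>I. - khtpy (single (I - {j}, add_mset j m) (isgn j I :: 'a)))"
    proof (intro sum.cong refl)
      fix j assume j: "j \<in> I"
      then have "insert i I - {j} = insert i (I - {j})" "add_mset j (m - {#i#}) = add_mset j m - {#i#}"
        using False \<open>i \<in># m\<close> by auto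
      then show "single (insert i I - {j}, add_mset j (m - {#i#})) (isgn j (insert i I)) =
          - khtpy (single (I - {j}, add_mset j m) (isgn j I :: 'a))"
        using j False fin lt[OF j] by (auto simp: htpy isgn_insert_less single_uminus)
    qed
    finally show ?thesis by (simp add: k second sum_negf)
  qed
qed

text \<open>The basis element \<open>x\<^sub>X \<otimes> 1\<close> is excluded; at it, the complex of \<eta> is not exact.\<close>

lemma dkosz_dkhtpy:
  assumes X: "finite X"
    and T: "\<And>I m. (I, m) \<in> keys T \<Longrightarrow> I \<subseteq> X \<and> set_mset m \<subseteq> X \<and> (I \<noteq> X \<or> m \<noteq> {#})"
  shows "dkosz X (dkhtpy X T) + dkhtpy X (dkosz X T) = T"
proof (rule hom_eqI[OF hom_addI[OF hom_compose[OF hom_dkosz hom_dkhtpy] hom_compose[OF hom_dkhtpy hom_dkosz]] hom_ident])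
  fix k assume "k \<in> keys T"
  then obtain I m where k: "k = (I, m)" and I: "I \<subseteq> X" "set_mset m \<subseteq> X" "(X - I) \<union> set_mset m \<noteq> {}"
    using T by (cases k) force
  define i where "i = Min ((X - I) \<union> set_mset m)"
  have fin: "finite I" using I X finite_subset by blast
  have i: "i \<in> (X - I) \<union> set_mset m" "\<And>j. j \<in> (X - I) \<union> set_mset m \<Longrightarrow> i \<le> j"
    using Min_in[of "(X - I) \<union> set_mset m"] Min_le[of "(X - I) \<union> set_mset m"] I(3) X
    by (simp_all add: i_def)
  have "i \<in> X" using i(1) I(2) by blast
  let ?J = "{j \<in> I. j \<in># m}"
  have htpy0: "dkhtpy X (single (I, m) c) =
      (if i \<in> I then 0 else single (insert i I, add_mset i m) (c * isgn i I))" for c :: 'a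
    by (rule dkhtpy_single[OF X i])
  have htpy: "dkhtpy X (single (I - {j}, m - {#j#}) c) =
      (if j = i then single (I, m) (c * isgn i I)
       else if i \<in> I then 0 else single (insert i (I - {j}), add_mset i (m - {#j#})) (c * isgn i (I - {j})))"
    if "j \<in> ?J" for j and c :: 'a
  proof -
    have "i \<in> (X - (I - {j})) \<union> set_mset (m - {#j#})"
      using i(1) I(1) \<open>i \<in> X\<close> by (cases "i = j") (auto simp: in_diff_count)
    moreover have "i \<le> l" if "l \<in> (X - (I - {j})) \<union> set_mset (m - {#j#})" for l
      using that i(2) \<open>j \<in> ?J\<close> by (auto dest: in_diffD)
    ultimately have "dkhtpy X (single (I - {j}, m - {#j#}) c) = (if i \<in> I - {j} then 0
        else single (insert i (I - {j}), add_mset i (m - {#j#})) (c * isgn i (I - {j})))"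
      by (intro dkhtpy_single X)
    then show ?thesis using that by (auto simp: insert_absorb isgn_remove_ge)
  qed
  have second: "dkhtpy X (dkosz X (single (I, m) 1)) =
      (\<Sum>j\<in>?J. dkhtpy X (single (I - {j}, m - {#j#}) (isgn j I :: 'a)))"
    by (simp add: dkosz_single[OF X I(1)] hom_sum[OF hom_dkhtpy])
  show "dkosz X (dkhtpy X (single k 1)) + dkhtpy X (dkosz X (single k 1)) = (single k 1 :: 'a ext_dpow)"
  proof (cases "i \<in> I")
    case True
    then have "i \<in> ?J" using i(1) by blast
    have "dkhtpy X (dkosz X (single (I, m) 1)) =
        (\<Sum>j\<in>?J. if j = i then single (I, m) (1 :: 'a) else 0)"
      unfolding second by (intro sum.cong refl) (use True in \<open>simp add: htpy\<close>)
    then have "dkhtpy X (dkosz X (single (I, m) 1)) = (single (I, m) 1 :: 'a ext_dpow)"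
      using \<open>i \<in> ?J\<close> fin by simp
    moreover have "dkhtpy X (single (I, m) 1) = (0 :: 'a ext_dpow)"
      using True by (simp add: htpy0)
    ultimately show ?thesis by (simp add: k hom_zero[OF hom_dkosz])
  next
    case False
    have lt: "i < j" if "j \<in> ?J" for j using that i(2)[of j] False by (auto simp: le_less)
    have J: "{j \<in> insert i I. j \<in># add_mset i m} = insert i ?J" using False by auto
    have "dkhtpy X (single (I, m) 1) = (single (insert i I, add_mset i m) (isgn i I) :: 'a ext_dpow)"
      using False by (simp add: htpy0)
    also have "\<dots> = scl (isgn i I) (single (insert i I, add_mset i m) 1)" by simp
    finally have "dkosz X (dkhtpy X (single (I, m) 1)) =
        scl (isgn i I :: 'a) (dkosz X (single (insert i I, add_mset i m) 1))"
      by (simp only: hom_scl[OF hom_dkosz])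
    also have "dkosz X (single (insert i I, add_mset i m) 1) =
        (\<Sum>j\<in>insert i ?J. single (insert i I - {j}, add_mset i m - {#j#}) (isgn j (insert i I)))"
      using I(1) \<open>i \<in> X\<close> by (subst dkosz_single[OF X]) (simp_all only: J insert_subset simp_thms)
    also have "\<dots> = single (I, m) (isgn i I) +
        (\<Sum>j\<in>?J. single (insert i I - {j}, add_mset i m - {#j#}) (isgn j (insert i I)))"
      using False fin by (simp add: isgn_insert_ge)
    also have "scl (isgn i I :: 'a) \<dots> = single (I, m) 1 +
        (\<Sum>j\<in>?J. single (insert i I - {j}, add_mset i m - {#j#}) (isgn i I * isgn j (insert i I)))"
      by (simp add: scl_add scl_sum)
    also have "(\<Sum>j\<in>?J. single (insert i I - {j}, add_mset i m - {#j#}) (isgn i I * isgn j (insert i I))) =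
        (\<Sum>j\<in>?J. - dkhtpy X (single (I - {j}, m - {#j#}) (isgn j I :: 'a)))"
    proof (intro sum.cong refl)
      fix j assume j: "j \<in> ?J"
      then have "insert i I - {j} = insert i (I - {j})" "add_mset i m - {#j#} = add_mset i (m - {#j#})"
        using False by auto
      then show "single (insert i I - {j}, add_mset i m - {#j#}) (isgn i I * isgn j (insert i I)) =
          - dkhtpy X (single (I - {j}, m - {#j#}) (isgn j I :: 'a))"
        using j False fin lt[OF j]
        by (auto simp: htpy[OF j] isgn_insert_less isgn_remove_ge single_uminus mult.commute)
    qed
    finally show ?thesis by (simp add: k second sum_negf)
  qed
qed

section \<open>The exterior pairing and its adjunctions\<close>

text \<open>The number of pairs out of order in \<open>x\<^sub>I \<and> x\<^sub>J\<close>; for \<open>I \<subseteq> V\<close>, \<open>csgn V I\<close> is the sign with \<open>x\<^sub>I \<and> x\<^bsub>V - I\<^esub> = csgn V I x\<^sub>V\<close>.\<close>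

definition inversions :: "nat set \<Rightarrow> nat set \<Rightarrow> nat"
  where "inversions I J = card {(i, j). i \<in> I \<and> j \<in> J \<and> j < i}"

definition csgn :: "nat set \<Rightarrow> nat set \<Rightarrow> 'a::comm_ring_1"
  where "csgn V I = (- 1) ^ inversions I (V - I)"

lemma inversions_insert_left:
  assumes "finite I" "finite J" "i \<notin> I"
  shows "inversions (insert i I) J = inversions I J + card {j \<in> J. j < i}"
proof -
  have "{(a, j). a \<in> insert i I \<and> j \<in> J \<and> j < a} =
      {(a, j). a \<in> I \<and> j \<in> J \<and> j < a} \<union> Pair i ` {j \<in> J. j < i}" by auto
  moreover have "finite {(a, j). a \<in> I \<and> j \<in> J \<and> j < a}"
    by (rule finite_subset[of _ "I \<times> J"]) (use assms in auto)
  moreover have "{(a, j). a \<in> I \<and> j \<in> J \<and> j < a} \<inter> Pair i ` {j \<in> J. j < i} = {}" using assms by auto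
  moreover have "card (Pair i ` {j \<in> J. j < i}) = card {j \<in> J. j < i}"
    by (rule card_image) (simp add: inj_on_def)
  ultimately show ?thesis using assms by (simp add: inversions_def card_Un_disjoint)
qed

lemma inversions_insert_right:
  assumes "finite I" "finite J" "j \<notin> J"
  shows "inversions I (insert j J) = inversions I J + card {i \<in> I. j < i}"
proof -
  have "{(i, b). i \<in> I \<and> b \<in> insert j J \<and> b < i} =
      {(i, b). i \<in> I \<and> b \<in> J \<and> b < i} \<union> (\<lambda>i. (i, j)) ` {i \<in> I. j < i}" by auto
  moreover have "finite {(i, b). i \<in> I \<and> b \<in> J \<and> b < i}"
    by (rule finite_subset[of _ "I \<times> J"]) (use assms in auto)
  moreover have "{(i, b). i \<in> I \<and> b \<in> J \<and> b < i} \<inter> (\<lambda>i. (i, j)) ` {i \<in> I. j < i} = {}" using assms by auto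
  moreover have "card ((\<lambda>i. (i, j)) ` {i \<in> I. j < i}) = card {i \<in> I. j < i}"
    by (rule card_image) (simp add: inj_on_def)
  ultimately show ?thesis using assms by (simp add: inversions_def card_Un_disjoint)
qed

lemma inversions_swap:
  assumes "finite I" "finite J" "I \<inter> J = {}"
  shows "inversions I J + inversions J I = card I * card J"
proof -
  let ?A = "{(i, j). i \<in> I \<and> j \<in> J \<and> j < i}" and ?B = "{(i, j). i \<in> I \<and> j \<in> J \<and> i < j}"
  have "{(j, i). j \<in> J \<and> i \<in> I \<and> i < j} = prod.swap ` ?B" by auto
  then have "inversions J I = card ?B"
    by (simp add: inversions_def card_image)
  moreover have "I \<times> J = ?A \<union> ?B" "?A \<inter> ?B = {}" using assms(3) by (auto simp: not_less_iff_gr_or_eq)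
  then have "card (I \<times> J) = card ?A + card ?B"
  proof -
    have "finite (I \<times> J)" using assms by simp
    then have "finite ?A" "finite ?B" by (auto intro: finite_subset[of _ "I \<times> J"])
    then show ?thesis using \<open>I \<times> J = ?A \<union> ?B\<close> \<open>?A \<inter> ?B = {}\<close> by (simp add: card_Un_disjoint)
  qed
  ultimately show ?thesis by (simp add: inversions_def card_cartesian_product)
qed

lemma csgn_square [simp]: "csgn V I * csgn V I = (1::'a::comm_ring_1)"
  by (simp add: csgn_def flip: power_mult_distrib)

lemma csgn_empty [simp]: "csgn V {} = 1"
  by (simp add: csgn_def inversions_def)

lemma csgn_compl:
  assumes "finite V" "I \<subseteq> V"
  shows "csgn V (V - I) = (- 1) ^ (card I * card (V - I)) * (csgn V I :: 'a::comm_ring_1)"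
proof -
  have "card I * card (V - I) = inversions I (V - I) + inversions (V - I) I"
    using assms finite_subset[of I V] by (intro inversions_swap[symmetric]) auto
  then have "(- 1) ^ (card I * card (V - I)) * (csgn V I :: 'a) =
      (csgn V I * csgn V I) * (- 1) ^ inversions (V - I) I"
    by (simp only: csgn_def power_add ac_simps)
  then show ?thesis
    using assms by (simp add: csgn_def double_diff)
qed

text \<open>The sign rule behind the self-adjointness of interior products.\<close>

lemma csgn_remove:
  assumes "finite V" "I \<subseteq> V" "i \<in> I"
  shows "isgn i I * csgn V (I - {i}) =
    (- 1) ^ (card I + 1) * (csgn V I * isgn i (insert i (V - I)) :: 'a::comm_ring_1)"
proof -
  define K J where "K = I - {i}" and "J = V - I"
  have I: "I = insert i K" "i \<notin> K" "i \<notin> J" "V - K = insert i J" and fin: "finite K" "finite J"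
    using assms finite_subset[of I V] by (auto simp: K_def J_def)
  have "card {j \<in> K. j < i} + card {j \<in> K. i < j} = card ({j \<in> K. j < i} \<union> {j \<in> K. i < j})"
    using fin by (intro card_Un_disjoint[symmetric]) auto
  also have "{j \<in> K. j < i} \<union> {j \<in> K. i < j} = K"
    using I(2) by (auto simp: not_less_iff_gr_or_eq)
  finally have K: "card {j \<in> K. j < i} + card {j \<in> K. i < j} = card K" .
  have "isgn i I * (csgn V K :: 'a) =
      (- 1) ^ (card {j \<in> K. j < i} + inversions K J + card {j \<in> K. i < j})"
    using fin I by (simp add: isgn_insert_ge isgn_def[of i K] csgn_def inversions_insert_right power_add)
  also have "\<dots> = (- 1) ^ (card K + inversions K J)"
    by (simp only: K[symmetric] ac_simps)
  also have "\<dots> = (- 1) ^ card K * (- 1) ^ inversions K J * (isgn i J * isgn i J)"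
    by (simp add: power_add)
  also have "\<dots> = (- 1) ^ (card I + 1) * ((- 1) ^ inversions I J * isgn i J)"
    using fin I by (simp add: inversions_insert_left power_add isgn_def[of i J] ac_simps)
  also have "\<dots> = (- 1) ^ (card I + 1) * (csgn V I * isgn i (insert i (V - I)))"
    by (simp add: csgn_def J_def isgn_insert_ge)
  finally show ?thesis by (simp add: K_def)
qed

text \<open>If all indices in \<open>\<theta>\<close> and \<open>\<rho>\<close> are in \<open>V\<close>, then \<open>epair V \<theta> \<rho>\<close> is the coefficient of \<open>x\<^sub>V\<close> in \<open>\<theta> \<and> \<rho>\<close>. The
  form \<open>etpair V\<close> is its tensor product with the evaluation pairing between divided powers and
  polynomials.\<close>

definition epair :: "nat set \<Rightarrow> 'a::comm_ring_1 ext \<Rightarrow> 'a ext \<Rightarrow> 'a"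
  where "epair V \<theta> \<rho> = (\<Sum>I\<in>keys \<theta>. lookup \<theta> I * (csgn V I * lookup \<rho> (V - I)))"

definition etpair :: "nat set \<Rightarrow> ((nat set \<times> mon) \<Rightarrow>\<^sub>0 'a::comm_ring_1) \<Rightarrow> ((nat set \<times> mon) \<Rightarrow>\<^sub>0 'a) \<Rightarrow> 'a"
  where "etpair V T S = (\<Sum>k\<in>keys T. lookup T k * (csgn V (fst k) * lookup S (V - fst k, snd k)))"

lemma form_weighted_sum: "form (\<lambda>T. \<Sum>k\<in>keys T. lookup T k * w k)"
  for w :: "'k \<Rightarrow> 'a::comm_ring_1"
proof -
  have "(\<Sum>k\<in>keys T. lookup T k * w k) = lookup (lext (\<lambda>k. single () (w k)) T) ()" for T
    by (simp add: lext_def lookup_sum)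
  then show ?thesis by (simp only: form_lookup_compose[OF hom_lext])
qed

lemma form_epair_left: "form (\<lambda>\<theta>. epair V \<theta> \<rho>)"
  unfolding epair_def by (rule form_weighted_sum)

lemma form_etpair_left: "form (\<lambda>T. etpair V T S)"
  unfolding etpair_def by (rule form_weighted_sum)

lemma form_etpair_right: "form (etpair V T)"
  by (rule formI)
    (simp_all add: etpair_def lookup_add lookup_scl algebra_simps sum.distrib sum_distrib_left)

lemma epair_single: "epair V (single I 1) \<rho> = csgn V I * lookup \<rho> (V - I)"
  by (simp add: epair_def)

lemma etpair_single: "etpair V (single (I, m) 1) S = csgn V I * lookup S (V - I, m)"
  by (simp add: etpair_def)

lemma etpair_tens: "etpair V (tens \<theta> \<nu>) (tens \<rho> \<mu>) = epair V \<theta> \<rho> * pair \<nu> \<mu>"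
proof -
  have "etpair V (tens \<theta> \<nu>) (tens \<rho> \<mu>) = (\<Sum>k\<in>keys \<theta> \<times> keys \<nu>.
      lookup (tens \<theta> \<nu>) k * (csgn V (fst k) * lookup (tens \<rho> \<mu>) (V - fst k, snd k)))"
    unfolding etpair_def using keys_tens[of \<theta> \<nu>]
    by (intro sum.mono_neutral_left) (auto simp: in_keys_iff)
  also have "\<dots> = (\<Sum>I\<in>keys \<theta>. \<Sum>m\<in>keys \<nu>.
      (lookup \<theta> I * (csgn V I * lookup \<rho> (V - I))) * (lookup \<nu> m * lookup \<mu> m))"
    unfolding sum.cartesian_product
    by (intro sum.cong refl) (auto simp: lookup_tens ac_simps)
  also have "\<dots> = epair V \<theta> \<rho> * pair \<mu> \<nu>"
    by (simp only: epair_def pair_def sum_product)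
  finally show ?thesis by (simp add: pair_commute)
qed

text \<open>Subsets of \<open>V\<close> of a given size, indexing a basis of an exterior power.\<close>

definition subs :: "nat set \<Rightarrow> nat \<Rightarrow> nat set set"
  where "subs V a = {I. I \<subseteq> V \<and> card I = a}"

lemma etpair_adjoint:
  assumes T: "keys T \<subseteq> A \<times> M" and S: "keys S \<subseteq> A' \<times> M'"
    and f: "\<And>I J. I \<in> A \<Longrightarrow> J \<in> A' \<Longrightarrow>
      epair V (f (single I 1)) (single J 1) = c * epair V (single I 1) (f' (single J 1))"
    and g: "\<And>m m'. m \<in> M \<Longrightarrow> m' \<in> M' \<Longrightarrow>
      pair (g (single m 1)) (single m' 1) = pair (single m 1) (g' (single m' 1))"
  shows "etpair V (tmap f g T) S = c * etpair V T (tmap f' g' S)"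
proof (rule hom_eqI[OF form_compose[OF form_etpair_left hom_tmap] form_multI[OF form_etpair_left]])
  fix k assume "k \<in> keys T"
  then obtain I m where k: "k = (I, m)" "I \<in> A" "m \<in> M" using T by blast
  show "etpair V (tmap f g (single k 1)) S = c * etpair V (single k 1) (tmap f' g' S)"
  proof (rule hom_eqI[OF form_etpair_right form_multI[OF form_compose[OF form_etpair_right hom_tmap]]])
    fix l assume "l \<in> keys S"
    then obtain J m' where l: "l = (J, m')" "J \<in> A'" "m' \<in> M'" using S by blast
    have "etpair V (tmap f g (single k 1)) (single l 1) =
        epair V (f (single I 1)) (single J 1) * pair (g (single m 1)) (single m' 1)"
      using etpair_tens[of V "f (single I 1)" "g (single m 1)" "single J 1" "single m' 1"]
      by (simp add: k l tmap_single tens_single)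
    also have "\<dots> = c * (epair V (single I 1) (f' (single J 1)) * pair (single m 1) (g' (single m' 1)))"
      using k l by (simp add: f g mult.assoc)
    also have "\<dots> = c * etpair V (single k 1) (tmap f' g' (single l 1))"
      using etpair_tens[of V "single I 1" "single m 1" "f' (single J 1)" "g' (single m' 1)"]
      by (simp add: k l tmap_single tens_single)
    finally show "etpair V (tmap f g (single k 1)) (single l 1) =
        c * etpair V (single k 1) (tmap f' g' (single l 1))" .
  qed
qed

text \<open>Since \<open>\<theta> \<and> \<rho> = 0\<close> when the degrees of \<open>\<theta>\<close> and \<open>\<rho>\<close> add up to more than \<open>card V\<close>, interior products are
  adjoint to themselves up to sign.\<close>

lemma epair_iprod:
  assumes "finite V" "I \<subseteq> V" "J \<subseteq> V"
  shows "epair V (iprod i (single I 1)) (single J 1) =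
    (- 1) ^ (card I + 1) * epair V (single I 1) (iprod i (single J 1) :: 'a::comm_ring_1 ext)"
proof -
  have fin: "finite I" "finite J" using assms finite_subset by auto
  show ?thesis
  proof (cases "i \<in> I")
    case False
    have "lookup (iprod i (single J 1)) (V - I) = (0::'a)"
      using False assms by (auto simp: iprod_single lookup_single when_def)
    then show ?thesis using False
      by (simp add: iprod_single epair_single hom_zero[OF form_epair_left])
  next
    case True
    have "epair V (iprod i (single I 1)) (single J 1) = isgn i I * csgn V (I - {i}) *
        (if J = insert i (V - I) then 1 else 0 :: 'a)"
    proof -
      have "iprod i (single I 1) = scl (isgn i I) (single (I - {i}) (1::'a))"
        using True fin by (simp add: iprod_single)
      moreover have "V - (I - {i}) = insert i (V - I)" using True assms by auto
      ultimately show ?thesis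
        by (simp only: hom_scl[OF form_epair_left] epair_single lookup_single when_def mult.assoc)
    qed
    moreover have "lookup (iprod i (single J 1)) (V - I) =
        (if J = insert i (V - I) then isgn i (insert i (V - I)) else 0 :: 'a)"
    proof -
      have "i \<in> J \<and> J - {i} = V - I \<longleftrightarrow> J = insert i (V - I)" using True by auto
      then show ?thesis
        using fin by (cases "J = insert i (V - I)") (auto simp: iprod_single lookup_single when_def)
    qed
    ultimately show ?thesis
      by (cases "J = insert i (V - I)")
        (simp_all only: csgn_remove[OF assms(1,2) True] epair_single if_True if_False mult.assoc
          mult_zero_right mult_1_right simp_thms)
  qed
qed

text \<open>In the next three lemmas the exterior degree of \<open>S\<close> is not prescribed, as both sides depend only on
  the component of degree \<open>card V + 1 - r\<close>.\<close>

lemma etpair_cmap: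
  assumes "finite V" "keys T \<subseteq> subs V r \<times> UNIV" "keys S \<subseteq> Pow V \<times> UNIV"
    and "\<And>i m m'. pair (h i (single m 1)) (single m' 1) = pair (single m 1) (h' i (single m' 1))"
  shows "etpair V (cmap X h T) S = (- 1) ^ (r + 1) * etpair V T (cmap X h' S)"
proof -
  have "etpair V (tmap (iprod i) (h i) T) S =
      (- 1) ^ (r + 1) * etpair V T (tmap (iprod i) (h' i) S)" for i
    by (rule etpair_adjoint[OF assms(2,3)])
      (simp_all add: epair_iprod[OF assms(1)] subs_def assms(4) del: power_Suc)
  then show ?thesis
    by (simp add: cmap_def hom_sum[OF form_etpair_left] hom_sum[OF form_etpair_right]
        sum_distrib_left)
qed

lemma etpair_dkosz:
  assumes "finite V" "keys T \<subseteq> subs V r \<times> UNIV" "keys S \<subseteq> Pow V \<times> UNIV"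
  shows "etpair V (dkosz X T) S = (- 1) ^ (r + 1) * etpair V T (kosz X S)"
  unfolding kosz_def dkosz_def by (rule etpair_cmap[OF assms]) (rule pair_contr)

lemma etpair_kosz:
  assumes "finite V" "keys T \<subseteq> subs V r \<times> UNIV" "keys S \<subseteq> Pow V \<times> UNIV"
  shows "etpair V (kosz X T) S = (- 1) ^ (r + 1) * etpair V T (dkosz X S)"
  unfolding kosz_def dkosz_def
  by (rule etpair_cmap[OF assms]) (metis pair_commute pair_contr)

text \<open>The interior product with the linear form \<open>\<Sum> c\<^sub>i x\<^sub>i\<^sup>*\<close>, where \<open>i\<close> runs over \<open>X\<close>.\<close>

definition lprod :: "nat set \<Rightarrow> (nat \<Rightarrow> 'a::comm_ring_1) \<Rightarrow> 'a ext \<Rightarrow> 'a ext"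
  where "lprod X c \<theta> = (\<Sum>i\<in>X. scl (c i) (iprod i \<theta>))"

lemma tmap_lprod: "tmap (lprod X c) g T = (\<Sum>i\<in>X. scl (c i) (tmap (iprod i) g T))"
  unfolding lprod_def[abs_def] by (simp add: tmap_sum_left tmap_scl_left)

lemma etpair_lprod:
  assumes "finite V" "keys T \<subseteq> subs V r \<times> UNIV" "keys S \<subseteq> Pow V \<times> UNIV"
  shows "etpair V (tmap (lprod X c) (\<lambda>\<mu>. \<mu>) T) S =
    (- 1) ^ (r + 1) * etpair V T (tmap (lprod X c) (\<lambda>\<mu>. \<mu>) S)"
proof -
  have "etpair V (tmap (iprod i) (\<lambda>\<mu>. \<mu>) T) S =
      (- 1) ^ (r + 1) * etpair V T (tmap (iprod i) (\<lambda>\<mu>. \<mu>) S)" for i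
    by (rule etpair_adjoint[OF assms(2,3)])
      (simp_all add: epair_iprod[OF assms(1)] subs_def del: power_Suc)
  then show ?thesis
    by (simp add: tmap_lprod hom_sum[OF form_etpair_left] hom_sum[OF form_etpair_right]
        hom_scl[OF form_etpair_left] hom_scl[OF form_etpair_right] sum_distrib_left mult.left_commute)
qed

lemma cmap_lprod:
  assumes hom: "\<And>i. hom (h i)"
  shows "cmap X h (tmap (lprod Y c) (\<lambda>\<mu>. \<mu>) T) = - tmap (lprod Y c) (\<lambda>\<mu>. \<mu>) (cmap X h T)"
proof -
  have "cmap X h (tmap (lprod Y c) (\<lambda>\<mu>. \<mu>) T) =
      (\<Sum>i\<in>X. \<Sum>j\<in>Y. scl (c j) (tmap (\<lambda>\<theta>. iprod i (iprod j \<theta>)) (h i) T))"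
    by (simp add: cmap_def tmap_lprod hom_sum[OF hom_tmap] hom_scl[OF hom_tmap]
        tmap_tmap[OF hom_iprod hom])
  also have "\<dots> = (\<Sum>i\<in>X. \<Sum>j\<in>Y. scl (c j) (- tmap (\<lambda>\<theta>. iprod j (iprod i \<theta>)) (h i) T))"
    by (subst iprod_anticommute) (simp only: tmap_neg_left)
  also have "\<dots> = - tmap (lprod Y c) (\<lambda>\<mu>. \<mu>) (cmap X h T)"
    by (simp add: cmap_def tmap_lprod hom_sum[OF hom_tmap] tmap_tmap[OF hom_iprod hom_ident]
        scl_minus sum_negf scl_sum sum.swap[of _ X Y])
  finally show ?thesis .
qed

lemma kosz_lprod: "kosz X (tmap (lprod Y c) (\<lambda>\<mu>. \<mu>) T) = - tmap (lprod Y c) (\<lambda>\<mu>. \<mu>) (kosz X T)"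
  unfolding kosz_def by (rule cmap_lprod[OF hom_times])

lemma dkosz_lprod: "dkosz X (tmap (lprod Y c) (\<lambda>\<nu>. \<nu>) T) = - tmap (lprod Y c) (\<lambda>\<nu>. \<nu>) (dkosz X T)"
  unfolding dkosz_def by (rule cmap_lprod[OF hom_contr_right])

lemma etpair_swap:
  fixes S T :: "(nat set \<times> mon) \<Rightarrow>\<^sub>0 'a::comm_ring_1"
  assumes V: "finite V" and T: "keys T \<subseteq> subs V a \<times> UNIV" and S: "keys S \<subseteq> subs V b \<times> UNIV"
    and "a + b = card V"
  shows "etpair V S T = (- 1) ^ (a * b) * etpair V T S"
proof (rule hom_eqI[OF form_etpair_right form_multI[OF form_etpair_left]])
  fix k assume "k \<in> keys T"
  then obtain I m where k: "k = (I, m)" and I: "I \<subseteq> V" "card I = a" using T by (auto simp: subs_def)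
  show "etpair V S (single k 1) = (- 1) ^ (a * b) * etpair V (single k 1) S"
  proof (rule hom_eqI[OF form_etpair_left form_multI[OF form_etpair_right]])
    fix l assume "l \<in> keys S"
    then obtain J m' where l: "l = (J, m')" and J: "J \<subseteq> V" "card J = b" using S by (auto simp: subs_def)
    show "etpair V (single l 1) (single k 1) =
        (- 1) ^ (a * b) * etpair V (single k 1) (single l (1::'a))"
    proof (cases "J = V - I")
      case True
      then have "V - J = I" using I by blast
      moreover have "csgn V J = (- 1) ^ (a * b) * (csgn V I :: 'a)"
        using csgn_compl[OF V I(1), where 'a = 'a] True I J by simp
      ultimately show ?thesis
        using True by (simp add: k l etpair_single lookup_single when_def)
    next
      case False
      then have "V - J \<noteq> I" using J by blast
      with False show ?thesis by (simp add: k l etpair_single lookup_single)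
    qed
  qed
qed

lemma lookup_eq_etpair:
  fixes T :: "(nat set \<times> mon) \<Rightarrow>\<^sub>0 'a::comm_ring_1"
  assumes T: "keys T \<subseteq> Pow V \<times> UNIV" and "I \<subseteq> V"
  shows "lookup T (I, m) = csgn V I * etpair V T (single (V - I, m) 1)"
proof (rule hom_eqI[OF form_lookup form_multI[OF form_etpair_left]])
  fix k assume "k \<in> keys T"
  then obtain J m' where k: "k = (J, m')" "J \<subseteq> V" using T by blast
  then have "V - J = V - I \<longleftrightarrow> J = I" using assms(2) by blast
  then show "lookup (single k (1::'a)) (I, m) =
      csgn V I * etpair V (single k 1) (single (V - I, m) 1)"
    by (cases "J = I") (simp_all add: k etpair_single lookup_single when_def)
qed

lemma etpair_nondegenerate:
  assumes T: "keys T \<subseteq> subs V a \<times> M"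
    and "\<And>I m. I \<in> subs V a \<Longrightarrow> m \<in> M \<Longrightarrow> etpair V T (single (V - I, m) 1) = 0"
  shows "T = 0"
proof (rule poly_mapping_eqI, rule ccontr)
  fix k assume "lookup T k \<noteq> lookup 0 k"
  then have "k \<in> keys T" by (simp add: in_keys_iff)
  then obtain I m where k: "k = (I, m)" "I \<in> subs V a" "m \<in> M" using T by blast
  have "keys T \<subseteq> Pow V \<times> UNIV" using T by (auto simp: subs_def)
  then have "lookup T k = 0"
    using lookup_eq_etpair[of T V I m] k assms(2) by (simp add: subs_def)
  then show False using \<open>k \<in> keys T\<close> by (simp add: in_keys_iff)
qed

text \<open>In complementary degrees, \<open>\<theta> \<and> \<rho>\<close> has no coefficients but the one at \<open>x\<^sub>V\<close>.\<close>

lemma wedge_complementary: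
  assumes "finite V" "keys \<theta> \<subseteq> subs V a" "keys \<rho> \<subseteq> subs V (card V - a)"
  shows "wedge \<theta> \<rho> = single V (epair V \<theta> \<rho>)"
proof -
  have *: "(\<Sum>J\<in>keys \<rho>. if I \<inter> J = {}
      then single (I \<union> J) ((- 1) ^ card {(i, j). i \<in> I \<and> j \<in> J \<and> j < i} * lookup \<theta> I * lookup \<rho> J) else 0)
    = single V (lookup \<theta> I * (csgn V I * lookup \<rho> (V - I)))" if "I \<in> keys \<theta>" for I
  proof -
    have I: "I \<subseteq> V" "card I = a" using that assms(2) by (auto simp: subs_def)
    have "(\<Sum>J\<in>keys \<rho>. if I \<inter> J = {}
        then single (I \<union> J) ((- 1) ^ card {(i, j). i \<in> I \<and> j \<in> J \<and> j < i} * lookup \<theta> I * lookup \<rho> J) else 0)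
      = (\<Sum>J\<in>keys \<rho>. if J = V - I then single V (lookup \<theta> I * (csgn V I * lookup \<rho> (V - I))) else 0)"
    proof (intro sum.cong refl)
      fix J assume "J \<in> keys \<rho>"
      then have J: "J \<subseteq> V" "card J = card V - a" using assms(3) by (auto simp: subs_def)
      have "I \<inter> J = {} \<longleftrightarrow> J = V - I"
      proof
        assume "I \<inter> J = {}"
        then have "J \<subseteq> V - I" using J by blast
        moreover have "card (V - I) = card J"
          using assms(1) I J by (simp add: card_Diff_subset finite_subset)
        ultimately show "J = V - I"
          using assms(1) by (intro card_subset_eq) auto
      qed auto
      moreover have "I \<union> (V - I) = V" using I by blast
      ultimately show "(if I \<inter> J = {}
          then single (I \<union> J) ((- 1) ^ card {(i, j). i \<in> I \<and> j \<in> J \<and> j < i} * lookup \<theta> I * lookup \<rho> J) else 0)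
        = (if J = V - I then single V (lookup \<theta> I * (csgn V I * lookup \<rho> (V - I))) else 0)"
        by (simp add: csgn_def inversions_def ac_simps)
    qed
    also have "\<dots> = single V (lookup \<theta> I * (csgn V I * lookup \<rho> (V - I)))"
      by (auto simp: in_keys_iff)
    finally show ?thesis .
  qed
  have "wedge \<theta> \<rho> = (\<Sum>I\<in>keys \<theta>. single V (lookup \<theta> I * (csgn V I * lookup \<rho> (V - I))))"
    unfolding wedge_def by (intro sum.cong refl) (rule *)
  then show ?thesis
    by (intro poly_mapping_eqI) (simp add: epair_def lookup_sum lookup_single when_def)
qed

subsection \<open>Supports\<close>

lemma keys_iprod_single:
  assumes "finite V" "I \<in> subs V a"
  shows "keys (iprod i (single I 1)) \<subseteq> subs V (a - 1)"
proof (cases "i \<in> I")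
  case True
  then have "I - {i} \<in> subs V (a - 1)" using assms finite_subset[of I V] by (auto simp: subs_def)
  then show ?thesis using order_trans[OF keys_single_subset] by (simp add: iprod_single)
qed (simp add: iprod_single)

lemma keys_lprod_single:
  assumes "finite V" "I \<in> subs V a"
  shows "keys (lprod X c (single I 1)) \<subseteq> subs V (a - 1)"
  unfolding lprod_def
  by (intro keys_sum_subset order_trans[OF keys_scl] keys_iprod_single assms)

lemma keys_kosz:
  assumes "finite V" "keys T \<subseteq> subs V a \<times> mons V s"
  shows "keys (kosz V T) \<subseteq> subs V (a - 1) \<times> mons V (s + 1)"
  unfolding kosz_eq
proof (rule keys_sum_subset)
  fix i assume "i \<in> V"
  then show "keys (tmap (iprod i) ((*) (single {#i#} 1)) T) \<subseteq> subs V (a - 1) \<times> mons V (s + 1)"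
    by (intro keys_tmap[OF assms(2)] keys_iprod_single assms(1))
      (auto simp: mult_single mons_def)
qed

lemma keys_dkosz:
  assumes "finite V" "keys T \<subseteq> subs V a \<times> mons W s"
  shows "keys (dkosz X T) \<subseteq> subs V (a - 1) \<times> mons W (s - 1)"
  unfolding dkosz_eq
  by (intro keys_sum_subset keys_tmap[OF assms(2)] keys_iprod_single assms(1))
    (auto simp: contr_single mons_def size_Diff_submset dest: in_diffD)

lemma keys_khtpy:
  assumes "finite V" "keys T \<subseteq> subs V a \<times> mons V s" "s \<ge> 1"
  shows "keys (khtpy T) \<subseteq> subs V (a + 1) \<times> mons V (s - 1)"
  unfolding khtpy_def
proof (rule keys_lext)
  fix k assume "k \<in> keys T"
  then obtain I m where k: "k = (I, m)" and I: "I \<subseteq> V" "card I = a"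
    and m: "set_mset m \<subseteq> V" "size m = s"
    using assms(2) by (cases k) (auto simp: subs_def mons_def)
  define i where "i = Min (I \<union> set_mset m)"
  have fin: "finite I" using I(1) assms(1) finite_subset by blast
  have "m \<noteq> {#}" using m(2) assms(3) by auto
  then have "i \<in> I \<union> set_mset m" unfolding i_def using fin by (intro Min_in) auto
  then have "i \<in> I \<or> i \<in># m" by blast
  then have "(insert i I, m - {#i#}) \<in> subs V (a + 1) \<times> mons V (s - 1)" if "i \<notin> I"
    using that I m fin by (auto simp: subs_def mons_def size_Diff_singleton dest: in_diffD)
  then have "keys (if i \<in> I then 0 else single (insert i I, m - {#i#}) (1::'a)) \<subseteq> subs V (a + 1) \<times> mons V (s - 1)"
    using order_trans[OF keys_single_subset] by simp
  then show "keys (case k of (I, m) \<Rightarrow> let i = Min (I \<union> set_mset m) in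
      if i \<in> I then 0 else single (insert i I, m - {#i#}) (1::'a)) \<subseteq> subs V (a + 1) \<times> mons V (s - 1)"
    unfolding k i_def Let_def prod.case .
qed

lemma keys_dkhtpy:
  assumes "finite V" "keys T \<subseteq> subs V a \<times> mons V s" "s \<ge> 1"
  shows "keys (dkhtpy V T) \<subseteq> subs V (a + 1) \<times> mons V (s + 1)"
  unfolding dkhtpy_def
proof (rule keys_lext)
  fix k assume "k \<in> keys T"
  then obtain I m where k: "k = (I, m)" and I: "I \<subseteq> V" "card I = a"
    and m: "set_mset m \<subseteq> V" "size m = s"
    using assms(2) by (cases k) (auto simp: subs_def mons_def)
  define i where "i = Min ((V - I) \<union> set_mset m)"
  have fin: "finite I" using I(1) assms(1) finite_subset by blast
  have "m \<noteq> {#}" using m(2) assms(3) by auto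
  then have "i \<in> (V - I) \<union> set_mset m" unfolding i_def using assms(1) by (intro Min_in) auto
  then have "i \<in> V" using m by blast
  then have "(insert i I, add_mset i m) \<in> subs V (a + 1) \<times> mons V (s + 1)" if "i \<notin> I"
    using that I m fin by (simp add: subs_def mons_def)
  then have "keys (if i \<in> I then 0 else single (insert i I, add_mset i m) (isgn i I :: 'a)) \<subseteq> subs V (a + 1) \<times> mons V (s + 1)"
    by (cases "i \<in> I") (simp_all add: order_trans[OF keys_single_subset])
  then show "keys (case k of (I, m) \<Rightarrow> let i = Min ((V - I) \<union> set_mset m) in
      if i \<in> I then 0 else single (insert i I, add_mset i m) (isgn i I :: 'a)) \<subseteq> subs V (a + 1) \<times> mons V (s + 1)"
    unfolding k i_def Let_def prod.case .
qed

section \<open>The coordinates of the complex\<close>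

lemma lookup_bc: "lookup (bc f) k = of_int (lookup f k)"
  by (simp add: bc_def Poly_Mapping.map.rep_eq when_def)

lemma bc_diff: "bc (f - g) = bc f - bc g"
  by (rule poly_mapping_eqI) (simp add: lookup_bc lookup_minus)

lemma bc_zero [simp]: "bc 0 = 0"
  by (rule poly_mapping_eqI) (simp add: lookup_bc)

lemma bc_sum: "bc (\<Sum>i\<in>A. f i) = (\<Sum>i\<in>A. bc (f i))"
  by (rule poly_mapping_eqI) (simp add: lookup_bc lookup_sum)

lemma bc_scl: "bc (scl c f) = scl (of_int c) (bc f)"
  by (rule poly_mapping_eqI) (simp add: lookup_bc lookup_scl)

lemma bc_single: "bc (single k c) = single k (of_int c)"
  by (rule poly_mapping_eqI) (simp add: lookup_bc lookup_single when_def)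

lemma keys_bc: "keys (bc f) \<subseteq> keys f"
  by (auto simp: in_keys_iff lookup_bc)

lemma bc_lext:
  assumes "\<And>k. k \<in> keys T \<Longrightarrow> bc (G k) = G' k"
  shows "bc (lext G T) = lext G' (bc T)"
proof -
  have "lext G' (bc T) = (\<Sum>k\<in>keys T. scl (lookup (bc T) k) (G' k))"
    by (rule lext_superset) (simp_all add: keys_bc)
  then show ?thesis by (simp add: lext_def bc_sum bc_scl lookup_bc assms)
qed

lemma bc_tens: "bc (tens \<theta> \<mu>) = tens (bc \<theta>) (bc \<mu>)"
proof (rule poly_mapping_eqI)
  fix k show "lookup (bc (tens \<theta> \<mu>)) k = lookup (tens (bc \<theta>) (bc \<mu>)) k"
    by (cases k) (simp add: lookup_bc lookup_tens)
qed

lemma bc_tmap: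
  assumes "\<And>I m. (I, m) \<in> keys T \<Longrightarrow> bc (f (single I 1)) = f' (single I 1)"
    and "\<And>I m. (I, m) \<in> keys T \<Longrightarrow> bc (g (single m 1)) = g' (single m 1)"
  shows "bc (tmap f g T) = tmap f' g' (bc T)"
  unfolding tmap_def by (rule bc_lext) (auto simp: bc_tens assms)

lemma bc_isgn [simp]: "(of_int (isgn i I) :: rr) = isgn i I"
  by (simp add: isgn_def)

lemma bc_csgn [simp]: "(of_int (csgn V I) :: rr) = csgn V I"
  by (simp add: csgn_def)

lemma bc_iprod: "bc (iprod i \<theta>) = iprod i (bc \<theta>)"
  unfolding iprod_def by (rule bc_lext) (simp add: bc_single)

lemma bc_kosz: "bc (kosz X T) = kosz X (bc T)"
  unfolding kosz_eq bc_sum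
  by (intro sum.cong refl bc_tmap) (simp_all add: bc_iprod bc_single mult_single)

lemma bc_dkosz: "bc (dkosz X T) = dkosz X (bc T)"
  unfolding dkosz_eq bc_sum
  by (intro sum.cong refl bc_tmap) (simp_all add: bc_iprod bc_single contr_single)

context pointed_free_module
begin

text \<open>The indices of the basis of \<open>U\<^sub>0\<close>.\<close>

abbreviation V :: "nat set" where "V \<equiv> {2..d}"

lemma card_V: "card V = d - 1" by simp

subsection \<open>The basis and its dual basis\<close>

lemma inj_x1: "x1 \<notin> x ` V"
proof
  interpret U: Modules.module scale by (rule module_U)
  assume "x1 \<in> x ` V"
  then have "x1 \<in> U.span (x ` V)" by (rule U.span_base)
  then show False using x1s_x1 by (simp add: span_U0)
qed

lemma x1s_x: "i \<in> V \<Longrightarrow> x1s (x i) = 0"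
proof -
  interpret U: Modules.module scale by (rule module_U)
  assume "i \<in> V"
  then have "x i \<in> U.span (x ` V)" by (intro U.span_base imageI)
  then show ?thesis by (simp add: span_U0)
qed

lemma indices: "{1..d} = insert 1 V"
  using d_ge_3 by auto

lemma x_Suc_0: "x (Suc 0) = x1"
  using x_1 by simp

lemma inj_x_all: "inj_on x {1..d}"
  using inj_x inj_x1 unfolding indices by (simp add: x_Suc_0)

lemma independent_x: "\<not> Modules.module.dependent scale (x ` {1..d})"
proof
  interpret U: Modules.module scale by (rule module_U)
  interpret h: Modules.module_hom scale "(*)" x1s by (rule x1s_hom)
  assume "U.dependent (x ` {1..d})"
  then obtain u where u: "\<exists>v\<in>x ` {1..d}. u v \<noteq> 0" "(\<Sum>v\<in>x ` {1..d}. scale (u v) v) = 0"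
    by (auto simp: U.dependent_finite)
  have split: "scale (u x1) x1 + (\<Sum>v\<in>x ` V. scale (u v) v) = 0"
    using u(2) inj_x1 unfolding indices by (simp add: x_Suc_0)
  have "x1s (\<Sum>v\<in>x ` V. scale (u v) v) = 0"
    by (auto simp: h.sum h.scale x1s_x intro!: sum.neutral)
  then have "u x1 = 0"
    using arg_cong[OF split, of x1s] by (simp add: h.add h.scale x1s_x1)
  moreover have "u v = 0" if "v \<in> x ` V" for v
    using split that \<open>u x1 = 0\<close> indep_U0 by (auto simp: U.dependent_finite)
  ultimately show False using u(1) unfolding indices by (auto simp: x_Suc_0)
qed

lemma xs_x: "i \<in> {1..d} \<Longrightarrow> j \<in> {1..d} \<Longrightarrow> xs i (x j) = (if i = j then 1 else 0)"
proof -
  interpret U: Modules.module scale by (rule module_U)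
  assume "i \<in> {1..d}" "j \<in> {1..d}"
  then show ?thesis
    unfolding xs_def using U.representation_basis[OF independent_x, of "x j"] inj_x_all
    by (auto simp: inj_on_eq_iff)
qed

lemma inSym_x: "i \<in> {1..d} \<Longrightarrow> inSym (x i) = single {#i#} 1"
proof -
  assume "i \<in> {1..d}"
  then have "inSym (x i) = (\<Sum>j\<in>{1..d}. if j = i then single {#i#} (1::'a::comm_ring_1) else 0)"
    unfolding inSym_def by (intro sum.cong refl) (auto simp: xs_x)
  then show ?thesis using \<open>i \<in> {1..d}\<close> by simp
qed

lemma inSym_zero: "inSym 0 = 0"
proof -
  interpret U: Modules.module scale by (rule module_U)
  show ?thesis by (simp add: inSym_def xs_def U.representation_zero)
qed

lemma act_eq:
  fixes \<theta> :: "'a::comm_ring_1 ext"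
  assumes "keys \<theta> \<subseteq> Pow V"
  shows "act us \<theta> = (\<Sum>i\<in>V. scl (of_int (us (x i))) (iprod i \<theta>))"
proof -
  have "act us = (lext (\<lambda>I. \<Sum>i\<in>I. single (I - {i}) (isgn i I * of_int (us (x i)))) :: 'a ext \<Rightarrow> 'a ext)"
    by (rule ext) (simp add: act_def lext_def scl_sum isgn_def mult.commute)
  then have hom: "hom (act us :: 'a ext \<Rightarrow> 'a ext)" by (simp only: hom_lext)
  have act: "act us (single I 1) = (\<Sum>i\<in>I. single (I - {i}) (isgn i I * of_int (us (x i)) :: 'a))" for I
    by (simp add: act_def isgn_def)
  show ?thesis
  proof (rule hom_eqI[OF hom hom_sumI[OF hom_sclI[OF hom_iprod]]])
    fix I assume "I \<in> keys \<theta>"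
    then have I: "I \<subseteq> V" "finite I" using assms finite_subset[of I V] by auto
    have "(\<Sum>i\<in>V. scl (of_int (us (x i))) (iprod i (single I (1::'a)))) =
        (\<Sum>i\<in>V. if i \<in> I then single (I - {i}) (isgn i I * of_int (us (x i))) else 0)"
      using I(2) by (intro sum.cong refl) (simp add: iprod_single mult.commute)
    also have "\<dots> = (\<Sum>i\<in>I. single (I - {i}) (isgn i I * of_int (us (x i))))"
    proof -
      have "{i \<in> V. i \<in> I} = I" using I by blast
      then show ?thesis by (simp only: sum.inter_filter[OF finite_atLeastAtMost, symmetric])
    qed
    finally show "act us (single I 1) = (\<Sum>i\<in>V. scl (of_int (us (x i))) (iprod i (single I (1::'a))))"
      by (simp only: act)
  qed
qed

lemma act_xs: "i \<in> {1..d} \<Longrightarrow> keys \<theta> \<subseteq> Pow V \<Longrightarrow> act (xs i) \<theta> = (if i \<in> V then iprod i \<theta> else 0)"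
proof -
  assume "i \<in> {1..d}" "keys \<theta> \<subseteq> Pow V"
  then have "act (xs i) \<theta> = (\<Sum>j\<in>V. if j = i then iprod i \<theta> else 0)"
    unfolding act_eq[OF \<open>keys \<theta> \<subseteq> Pow V\<close>] by (intro sum.cong refl) (auto simp: xs_x)
  then show ?thesis by simp
qed

lemma sum_act_xs:
  assumes "keys \<theta> \<subseteq> Pow V" "\<And>i. F i 0 = 0"
  shows "(\<Sum>i=1..d. F i (act (xs i) \<theta>)) = (\<Sum>i\<in>V. F i (iprod i \<theta>))"
  using assms(2) by (simp add: indices act_xs assms(1) del: One_nat_def)

text \<open>The interior product with \<open>x\<^sub>1\<^sup>*\<close> vanishes on \<open>\<And>U\<^sub>0\<close>, so only the indices in \<open>V\<close> contribute to \<kappa> and \<eta>.\<close>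

lemma kappa_eq: "keys T \<subseteq> Pow V \<times> UNIV \<Longrightarrow> kappa T = kosz V T"
  unfolding kappa_def
proof (rule hom_eqI[OF hom_lin_ext hom_kosz])
  fix k assume T: "keys T \<subseteq> Pow V \<times> UNIV" "k \<in> keys T"
  then obtain I m where k: "k = (I, m)" "I \<subseteq> V" by blast
  have "(\<Sum>i=1..d. tens (act (xs i) (single I 1)) (inSym (x i) * single m 1)) =
      (\<Sum>i\<in>V. tens (iprod i (single I 1)) (inSym (x i) * single m (1::'a)))"
    using k by (intro sum_act_xs hom_zero[OF hom_tens_left]) (auto dest!: subsetD[OF keys_single_subset])
  also have "\<dots> = kosz V (single (I, m) 1)"
    unfolding kosz_eq by (intro sum.cong refl) (simp add: tmap_single inSym_x)
  finally show "lin_ext (\<lambda>\<theta> \<mu>. \<Sum>i=1..d. tens (act (xs i) \<theta>) (inSym (x i) * \<mu>)) (single k 1) =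
      kosz V (single k (1::'a))"
    by (simp add: k lin_ext_single)
qed

lemma eta_eq: "keys T \<subseteq> Pow V \<times> UNIV \<Longrightarrow> eta T = dkosz V T"
  unfolding eta_def
proof (rule hom_eqI[OF hom_lin_ext hom_dkosz])
  fix k assume T: "keys T \<subseteq> Pow V \<times> UNIV" "k \<in> keys T"
  then obtain I m where k: "k = (I, m)" "I \<subseteq> V" by blast
  have "(\<Sum>i=1..d. tens (act (xs i) (single I 1)) (contr (inSym (x i)) (single m 1))) =
      (\<Sum>i\<in>V. tens (iprod i (single I 1)) (contr (inSym (x i)) (single m (1::'a))))"
    using k by (intro sum_act_xs hom_zero[OF hom_tens_left]) (auto dest!: subsetD[OF keys_single_subset])
  also have "\<dots> = dkosz V (single (I, m) 1)"
    unfolding dkosz_eq by (intro sum.cong refl) (simp add: tmap_single inSym_x)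
  finally show "lin_ext (\<lambda>\<theta> \<nu>. \<Sum>i=1..d. tens (act (xs i) \<theta>) (contr (inSym (x i)) \<nu>)) (single k 1) =
      dkosz V (single k (1::'a))"
    by (simp add: k lin_ext_single)
qed

lemma hom_kappa: "hom kappa"
  unfolding kappa_def by (rule hom_lin_ext)

lemma hom_eta: "hom eta"
  unfolding eta_def by (rule hom_lin_ext)

subsection \<open>The ring \<open>\<RR>\<close> and modules over it\<close>

lemma RR_zero: "0 \<in> \<RR>" by (simp add: RR_def)

lemma RR_one: "1 \<in> \<RR>" by (simp add: RR_def)

lemma RR_add: "f \<in> \<RR> \<Longrightarrow> g \<in> \<RR> \<Longrightarrow> f + g \<in> \<RR>"
  unfolding RR_def using keys_add[of f g] by blast

lemma RR_uminus: "f \<in> \<RR> \<Longrightarrow> - f \<in> \<RR>"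
  by (simp add: RR_def)

lemma RR_diff: "f \<in> \<RR> \<Longrightarrow> g \<in> \<RR> \<Longrightarrow> f - g \<in> \<RR>"
  using RR_add[of f "- g"] RR_uminus[of g] by simp

lemma RR_mult:
  assumes "f \<in> \<RR>" "g \<in> \<RR>"
  shows "f * g \<in> \<RR>"
  unfolding RR_def
proof (clarify)
  fix k v assume "k \<in> keys (f * g)" "v \<in># k" "v \<notin> Inr ` mons {1..d} (2 * n - 2)"
  then obtain a c where "k = a + c" "a \<in> keys f" "c \<in> keys g" using keys_mult[of f g] by blast
  then show "v \<in> Inl ` {1..d}"
    using assms \<open>v \<in># k\<close> \<open>v \<notin> Inr ` mons {1..d} (2 * n - 2)\<close> unfolding RR_def by auto
qed

lemma RR_sum: "(\<And>i. i \<in> A \<Longrightarrow> f i \<in> \<RR>) \<Longrightarrow> (\<Sum>i\<in>A. f i) \<in> \<RR>"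
  by (induction A rule: infinite_finite_induct) (auto intro: RR_zero RR_add)

lemma RR_prod: "(\<And>i. i \<in> A \<Longrightarrow> f i \<in> \<RR>) \<Longrightarrow> (\<Prod>i\<in>A. f i) \<in> \<RR>"
  by (induction A rule: infinite_finite_induct) (auto intro: RR_one RR_mult)

lemma RR_prod_mset: "(\<And>i. i \<in># M \<Longrightarrow> f i \<in> \<RR>) \<Longrightarrow> (\<Prod>i\<in>#M. f i) \<in> \<RR>"
  by (induction M) (auto intro: RR_one RR_mult)

lemma RR_neg_one_power: "(- 1) ^ k \<in> \<RR>"
  by (cases "even k") (auto intro: RR_one RR_uminus)

lemma RR_isgn: "isgn i I \<in> \<RR>"
  unfolding isgn_def by (rule RR_neg_one_power)

lemma RR_csgn: "csgn W I \<in> \<RR>"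
  unfolding csgn_def by (rule RR_neg_one_power)

lemma RR_of_int: "of_int c \<in> \<RR>"
proof -
  have "of_nat k \<in> \<RR>" for k by (induction k) (auto intro: RR_zero RR_one RR_add)
  then show ?thesis by (cases c) (auto intro: RR_uminus simp del: of_nat_Suc)
qed

text \<open>The elements with all coefficients in \<open>\<RR>\<close>.\<close>

definition coeffs_in_RR :: "('k \<Rightarrow>\<^sub>0 rr) \<Rightarrow> bool"
  where "coeffs_in_RR T \<longleftrightarrow> (\<forall>k. lookup T k \<in> \<RR>)"

lemma crr_lookup: "coeffs_in_RR T \<Longrightarrow> lookup T k \<in> \<RR>"
  by (simp add: coeffs_in_RR_def)

lemma crr_zero: "coeffs_in_RR 0"
  by (simp add: coeffs_in_RR_def RR_zero)

lemma crr_add: "coeffs_in_RR S \<Longrightarrow> coeffs_in_RR T \<Longrightarrow> coeffs_in_RR (S + T)"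
  by (simp add: coeffs_in_RR_def lookup_add RR_add)

lemma crr_neg: "coeffs_in_RR T \<Longrightarrow> coeffs_in_RR (- T)"
  by (simp add: coeffs_in_RR_def RR_uminus)

lemma crr_scl: "c \<in> \<RR> \<Longrightarrow> coeffs_in_RR T \<Longrightarrow> coeffs_in_RR (scl c T)"
  by (simp add: coeffs_in_RR_def lookup_scl RR_mult)

lemma crr_sum: "(\<And>i. i \<in> A \<Longrightarrow> coeffs_in_RR (f i)) \<Longrightarrow> coeffs_in_RR (\<Sum>i\<in>A. f i)"
  by (auto simp: coeffs_in_RR_def lookup_sum intro: RR_sum)

lemma crr_single: "c \<in> \<RR> \<Longrightarrow> coeffs_in_RR (single k c)"
  by (auto simp: coeffs_in_RR_def lookup_single when_def RR_zero)

lemma crr_bc: "coeffs_in_RR (bc f)"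
  by (simp add: coeffs_in_RR_def lookup_bc RR_of_int)

lemma crr_lext:
  assumes "coeffs_in_RR T" "\<And>k. k \<in> keys T \<Longrightarrow> coeffs_in_RR (G k)"
  shows "coeffs_in_RR (lext G T)"
  unfolding lext_def by (intro crr_sum crr_scl crr_lookup assms)

lemma crr_tens: "coeffs_in_RR \<theta> \<Longrightarrow> coeffs_in_RR \<mu> \<Longrightarrow> coeffs_in_RR (tens \<theta> \<mu>)"
  by (simp add: coeffs_in_RR_def lookup_tens RR_mult split_paired_all)

lemma crr_tmap:
  assumes "coeffs_in_RR T" "\<And>I m. (I, m) \<in> keys T \<Longrightarrow> coeffs_in_RR (f (single I 1))"
    and "\<And>I m. (I, m) \<in> keys T \<Longrightarrow> coeffs_in_RR (g (single m 1))"
  shows "coeffs_in_RR (tmap f g T)"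
  unfolding tmap_def using assms(2,3) by (intro crr_lext assms(1)) (auto intro: crr_tens)

lemma crr_contr: "coeffs_in_RR \<mu> \<Longrightarrow> coeffs_in_RR \<nu> \<Longrightarrow> coeffs_in_RR (contr \<mu> \<nu>)"
  by (auto simp: coeffs_in_RR_def lookup_contr intro!: RR_sum RR_mult)

lemma crr_times_single: "coeffs_in_RR (single k 1 * single m 1)"
  by (simp add: mult_single crr_single RR_one)

lemma crr_iprod: "coeffs_in_RR \<theta> \<Longrightarrow> coeffs_in_RR (iprod i \<theta>)"
  unfolding iprod_def by (rule crr_lext) (auto intro: crr_single RR_isgn crr_zero)

lemma crr_kosz: "coeffs_in_RR T \<Longrightarrow> coeffs_in_RR (kosz X T)"
  unfolding kosz_eq
  by (intro crr_sum crr_tmap crr_iprod crr_single RR_one crr_times_single)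

lemma crr_dkosz: "coeffs_in_RR T \<Longrightarrow> coeffs_in_RR (dkosz X T)"
  unfolding dkosz_eq
  by (intro crr_sum crr_tmap crr_iprod crr_contr crr_single RR_one)

lemma crr_khtpy: "coeffs_in_RR T \<Longrightarrow> coeffs_in_RR (khtpy T)"
  unfolding khtpy_def by (rule crr_lext) (auto simp: Let_def intro!: crr_single RR_one crr_zero)

lemma crr_dkhtpy: "coeffs_in_RR T \<Longrightarrow> coeffs_in_RR (dkhtpy X T)"
  unfolding dkhtpy_def by (rule crr_lext) (auto simp: Let_def intro!: crr_single RR_isgn crr_zero)

lemma RR_etpair: "coeffs_in_RR T \<Longrightarrow> coeffs_in_RR S \<Longrightarrow> etpair W T S \<in> \<RR>"
  unfolding etpair_def by (intro RR_sum RR_mult crr_lookup RR_csgn)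

text \<open>The elements with coefficients in \<open>\<RR>\<close> are the \<open>\<RR>\<close>-combinations of basis elements.\<close>

lemma coeffs_induct:
  assumes T: "keys T \<subseteq> X" "coeffs_in_RR T" and zero: "Q 0"
    and add: "\<And>S T. Q S \<Longrightarrow> Q T \<Longrightarrow> Q (S + T)" and scl: "\<And>c T. c \<in> \<RR> \<Longrightarrow> Q T \<Longrightarrow> Q (scl c T)"
    and single: "\<And>j. j \<in> X \<Longrightarrow> Q (single j 1)"
  shows "Q T"
proof -
  have "Q (\<Sum>j\<in>A. scl (lookup T j) (single j 1))" if "finite A" "A \<subseteq> X" for A
    using that
  proof (induction A rule: finite_induct)
    case (insert j A)
    then have "Q (scl (lookup T j) (single j 1))" by (intro scl single crr_lookup T(2)) simp
    with insert show ?case by (simp only: sum.insert add insert_subset simp_thms)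
  qed (simp add: zero)
  from this[OF finite_keys T(1)] show ?thesis using basis_expansion[of T] by simp
qed

text \<open>The \<open>\<RR>\<close>-span of a set of integral elements is a submodule.\<close>

lemma tensR_base: "z \<in> M \<Longrightarrow> bc z \<in> tensR M"
  unfolding tensR_def by (intro CollectI exI[of _ "{z}"] exI[of _ "\<lambda>_. 1"]) (simp add: RR_one)

lemma tensR_zero: "0 \<in> tensR M"
  unfolding tensR_def by (intro CollectI exI[of _ "{}"]) simp

lemma tensR_scl: "c \<in> \<RR> \<Longrightarrow> T \<in> tensR M \<Longrightarrow> scl c T \<in> tensR M"
proof -
  assume c: "c \<in> \<RR>" and "T \<in> tensR M"
  then obtain Z e where Z: "finite Z" "Z \<subseteq> M" "e ` Z \<subseteq> \<RR>" "T = (\<Sum>z\<in>Z. scl (e z) (bc z))"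
    unfolding tensR_def by blast
  have "scl c T = (\<Sum>z\<in>Z. scl (c * e z) (bc z))" by (simp add: Z scl_sum)
  moreover have "(\<lambda>z. c * e z) ` Z \<subseteq> \<RR>" using Z c by (auto intro: RR_mult)
  ultimately show ?thesis
    unfolding tensR_def using Z(1,2) by (intro CollectI exI[of _ Z] exI[of _ "\<lambda>z. c * e z"]) simp
qed

lemma tensR_add: "S \<in> tensR M \<Longrightarrow> T \<in> tensR M \<Longrightarrow> S + T \<in> tensR M"
proof -
  assume "S \<in> tensR M" "T \<in> tensR M"
  then obtain Y Z e f where Y: "finite Y" "Y \<subseteq> M" "e ` Y \<subseteq> \<RR>" "S = (\<Sum>z\<in>Y. scl (e z) (bc z))"
    and Z: "finite Z" "Z \<subseteq> M" "f ` Z \<subseteq> \<RR>" "T = (\<Sum>z\<in>Z. scl (f z) (bc z))"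
    unfolding tensR_def by blast
  define g where "g z = (if z \<in> Y then e z else 0) + (if z \<in> Z then f z else 0)" for z
  have "S = (\<Sum>z\<in>Y \<union> Z. scl (if z \<in> Y then e z else 0) (bc z))"
    unfolding Y(4) using Y Z by (intro sum.mono_neutral_cong_left) auto
  moreover have "T = (\<Sum>z\<in>Y \<union> Z. scl (if z \<in> Z then f z else 0) (bc z))"
    unfolding Z(4) using Y Z by (intro sum.mono_neutral_cong_left) auto
  ultimately have "S + T = (\<Sum>z\<in>Y \<union> Z. scl (g z) (bc z))"
    by (simp add: g_def scl_add_left sum.distrib)
  moreover have "g ` (Y \<union> Z) \<subseteq> \<RR>"
    using Y(3) Z(3) by (force simp: g_def intro!: RR_add RR_zero)
  ultimately show ?thesis
    unfolding tensR_def using Y(1,2) Z(1,2)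
    by (intro CollectI exI[of _ "Y \<union> Z"] exI[of _ g]) simp
qed

lemma tensR_least:
  assumes "T \<in> tensR M" "P 0" "\<And>S T. P S \<Longrightarrow> P T \<Longrightarrow> P (S + T)"
    and "\<And>c T. c \<in> \<RR> \<Longrightarrow> P T \<Longrightarrow> P (scl c T)" "\<And>z. z \<in> M \<Longrightarrow> P (bc z)"
  shows "P T"
proof -
  obtain Z e where Z: "finite Z" "Z \<subseteq> M" "e ` Z \<subseteq> \<RR>" "T = (\<Sum>z\<in>Z. scl (e z) (bc z))"
    using assms(1) unfolding tensR_def by blast
  have "P (\<Sum>z\<in>Z'. scl (e z) (bc z))" if "finite Z'" "Z' \<subseteq> Z" for Z'
    using that
  proof (induction Z' rule: finite_induct)
    case (insert z Z')
    then have "P (scl (e z) (bc z))" using Z(2,3) by (intro assms(4,5)) auto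
    with insert show ?case by (simp add: assms(3))
  qed (simp add: assms(2))
  then show ?thesis using Z by blast
qed

lemma tensR_basis: "tensR {f. keys f \<subseteq> A} = {T. keys T \<subseteq> A \<and> coeffs_in_RR T}"
proof (intro equalityI subsetI)
  fix T :: "'a \<Rightarrow>\<^sub>0 rr" assume T: "T \<in> tensR {f. keys f \<subseteq> A}"
  have "keys T \<subseteq> A"
  proof (rule tensR_least[OF T])
    show "keys (S + T) \<subseteq> A" if "keys S \<subseteq> A" "keys T \<subseteq> A" for S T :: "'a \<Rightarrow>\<^sub>0 rr"
      using that keys_add[of S T] by blast
    show "keys (scl c T) \<subseteq> A" if "keys T \<subseteq> A" for c and T :: "'a \<Rightarrow>\<^sub>0 rr"
      using that keys_scl[of c T] by blast
    show "keys (bc z) \<subseteq> A" if "z \<in> {f. keys f \<subseteq> A}" for z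
      using that keys_bc[of z] by blast
  qed simp
  moreover have "coeffs_in_RR T"
    by (rule tensR_least[OF T]) (auto intro: crr_zero crr_add crr_scl crr_bc)
  ultimately show "T \<in> {T. keys T \<subseteq> A \<and> coeffs_in_RR T}" by blast
next
  fix T :: "'a \<Rightarrow>\<^sub>0 rr" assume "T \<in> {T. keys T \<subseteq> A \<and> coeffs_in_RR T}"
  then have T: "keys T \<subseteq> A" "coeffs_in_RR T" by auto
  show "T \<in> tensR {f. keys f \<subseteq> A}"
  proof (rule coeffs_induct[OF T tensR_zero tensR_add tensR_scl])
    fix j assume "j \<in> A"
    then have "bc (single j 1) \<in> tensR {f. keys f \<subseteq> A}"
      by (intro tensR_base CollectI order_trans[OF keys_single_subset]) simp
    then show "single j 1 \<in> tensR {f. keys f \<subseteq> A}" by (simp add: bc_single)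
  qed
qed

text \<open>The base changes of the kernels of \<kappa> and \<eta> are the kernels of their base changes, because the
  homotopies express a cycle as a combination of integral boundaries.\<close>

lemma kosz_khtpy_cycle:
  assumes "keys T \<subseteq> subs V a \<times> mons V s" "s \<ge> 1" "kosz V T = 0"
  shows "kosz V (khtpy T) = T"
proof -
  have "kosz V (khtpy T) + khtpy (kosz V T) = T"
    using assms(1,2) by (intro kosz_khtpy) (fastforce simp: subs_def mons_def)+
  then show ?thesis by (simp add: assms(3) hom_zero[OF hom_khtpy])
qed

lemma dkosz_dkhtpy_cycle:
  assumes "keys T \<subseteq> subs V a \<times> mons V s" "s \<ge> 1" "dkosz V T = 0"
  shows "dkosz V (dkhtpy V T) = T"
proof -
  have "dkosz V (dkhtpy V T) + dkhtpy V (dkosz V T) = T"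
    using assms(1,2) by (intro dkosz_dkhtpy) (fastforce simp: subs_def mons_def)+
  then show ?thesis by (simp add: assms(3) hom_zero[OF hom_dkhtpy])
qed

lemma keys_subs_Pow: "keys T \<subseteq> subs V a \<times> M \<Longrightarrow> keys T \<subseteq> Pow V \<times> UNIV"
  by (auto simp: subs_def)

lemma K0_iff: "T \<in> K0 a s \<longleftrightarrow> keys T \<subseteq> subs V a \<times> mons V s \<and> dkosz V T = 0"
proof -
  have "(\<forall>(I, m)\<in>keys T. I \<subseteq> V \<and> card I = a \<and> m \<in> mons V s) \<longleftrightarrow> keys T \<subseteq> subs V a \<times> mons V s"
    by (auto simp: subs_def)
  then show ?thesis using eta_eq[OF keys_subs_Pow[of T a "mons V s"]] by (auto simp: K0_def)
qed

lemma L0_iff: "T \<in> L0 a s \<longleftrightarrow> keys T \<subseteq> subs V a \<times> mons V s \<and> kosz V T = 0"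
proof -
  have "(\<forall>(I, m)\<in>keys T. I \<subseteq> V \<and> card I = a \<and> m \<in> mons V s) \<longleftrightarrow> keys T \<subseteq> subs V a \<times> mons V s"
    by (auto simp: subs_def)
  then show ?thesis using kappa_eq[OF keys_subs_Pow[of T a "mons V s"]] by (auto simp: L0_def)
qed

lemma subs_mons_single: "I \<in> subs V a \<Longrightarrow> m \<in> M \<Longrightarrow> keys (single (I, m) c) \<subseteq> subs V a \<times> M"
  using keys_single_subset[of "(I, m)" c] by auto

lemma tensR_kernel:
  fixes f :: "('k \<Rightarrow>\<^sub>0 rr) \<Rightarrow> ('l \<Rightarrow>\<^sub>0 rr)" and g :: "('k \<Rightarrow>\<^sub>0 int) \<Rightarrow> ('l \<Rightarrow>\<^sub>0 int)"
  assumes f: "hom f" and fg: "\<And>z. f (bc z) = bc (g z)"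
    and span: "\<And>T. keys T \<subseteq> X \<Longrightarrow> coeffs_in_RR T \<Longrightarrow> f T = 0 \<Longrightarrow> T \<in> tensR {z. keys z \<subseteq> X \<and> g z = 0}"
  shows "tensR {z. keys z \<subseteq> X \<and> g z = 0} = {T. keys T \<subseteq> X \<and> coeffs_in_RR T \<and> f T = 0}"
proof (intro equalityI subsetI)
  fix T assume T: "T \<in> tensR {z. keys z \<subseteq> X \<and> g z = 0}"
  then have "T \<in> tensR {z. keys z \<subseteq> X}" unfolding tensR_def by blast
  moreover have "f T = 0"
    by (rule tensR_least[OF T]) (simp_all add: hom_zero[OF f] hom_add[OF f] hom_scl[OF f] fg)
  ultimately show "T \<in> {T. keys T \<subseteq> X \<and> coeffs_in_RR T \<and> f T = 0}" by (simp add: tensR_basis)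
qed (use span in blast)

lemma tensR_K0:
  assumes "s \<ge> 1"
  shows "tensR (K0 a s) = {T. keys T \<subseteq> subs V a \<times> mons V s \<and> coeffs_in_RR T \<and> dkosz V T = 0}"
proof -
  have K0: "K0 a s = {z. keys z \<subseteq> subs V a \<times> mons V s \<and> dkosz V z = 0}" by (auto simp: K0_iff)
  show ?thesis
    unfolding K0
  proof (rule tensR_kernel[OF hom_dkosz bc_dkosz[symmetric]], fold K0)
    fix T :: "rr ext_dpow"
    assume T: "keys T \<subseteq> subs V a \<times> mons V s" "coeffs_in_RR T" "dkosz V T = 0"
    have "dkosz V (dkhtpy V T) \<in> tensR (K0 a s)"
    proof (rule coeffs_induct[OF keys_dkhtpy[OF _ T(1) assms] crr_dkhtpy[OF T(2)]])
      fix j assume "j \<in> subs V (a + 1) \<times> mons V (s + 1)"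
      then obtain I m where j: "j = (I, m)" "I \<in> subs V (a + 1)" "m \<in> mons V (s + 1)" by blast
      have "keys (dkosz V (single j (1::int))) \<subseteq> subs V (a + 1 - 1) \<times> mons V (s + 1 - 1)"
        unfolding j(1) by (intro keys_dkosz subs_mons_single j) simp
      then have "dkosz V (single j 1) \<in> K0 a s" by (simp add: K0_iff dkosz_dkosz)
      from tensR_base[OF this] show "dkosz V (single j 1) \<in> tensR (K0 a s)"
        by (simp add: bc_dkosz bc_single)
    qed (simp_all add: hom_zero[OF hom_dkosz] hom_add[OF hom_dkosz] hom_scl[OF hom_dkosz]
        tensR_zero tensR_add tensR_scl)
    then show "T \<in> tensR (K0 a s)" by (simp only: dkosz_dkhtpy_cycle[OF T(1) assms T(3)])
  qed
qed

lemma tensR_L0: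
  assumes "s \<ge> 1"
  shows "tensR (L0 a s) = {T. keys T \<subseteq> subs V a \<times> mons V s \<and> coeffs_in_RR T \<and> kosz V T = 0}"
proof -
  have L0: "L0 a s = {z. keys z \<subseteq> subs V a \<times> mons V s \<and> kosz V z = 0}" by (auto simp: L0_iff)
  show ?thesis
    unfolding L0
  proof (rule tensR_kernel[OF hom_kosz bc_kosz[symmetric]], fold L0)
    fix T :: "rr ext_sym"
    assume T: "keys T \<subseteq> subs V a \<times> mons V s" "coeffs_in_RR T" "kosz V T = 0"
    have "kosz V (khtpy T) \<in> tensR (L0 a s)"
    proof (rule coeffs_induct[OF keys_khtpy[OF _ T(1) assms] crr_khtpy[OF T(2)]])
      fix j assume "j \<in> subs V (a + 1) \<times> mons V (s - 1)"
      then obtain I m where j: "j = (I, m)" "I \<in> subs V (a + 1)" "m \<in> mons V (s - 1)" by blast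
      have "keys (kosz V (single j (1::int))) \<subseteq> subs V (a + 1 - 1) \<times> mons V (s - 1 + 1)"
        unfolding j(1) by (intro keys_kosz subs_mons_single j) simp
      then have "kosz V (single j 1) \<in> L0 a s" using assms by (simp add: L0_iff kosz_kosz)
      from tensR_base[OF this] show "kosz V (single j 1) \<in> tensR (L0 a s)"
        by (simp add: bc_kosz bc_single)
    qed (simp_all add: hom_zero[OF hom_kosz] hom_add[OF hom_kosz] hom_scl[OF hom_kosz]
        tensR_zero tensR_add tensR_scl)
    then show "T \<in> tensR (L0 a s)" by (simp only: kosz_khtpy_cycle[OF T(1) assms T(3)])
  qed
qed

lemma tensR_Ext0_top: "tensR (Ext0 (d - 1)) = {single V c | c. c \<in> \<RR>}"
proof -
  have "I \<subseteq> V \<and> card I = d - 1 \<longleftrightarrow> I = V" for I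
    using card_subset_eq[of V I] by auto
  then have "Ext0 (d - 1) = {\<theta>. \<forall>I\<in>keys \<theta>. I = V}" unfolding Ext0_def by (simp only:)
  also have "\<dots> = {\<theta>. keys \<theta> \<subseteq> {V}}" by blast
  finally have "Ext0 (d - 1) = \<dots>" .
  then have "tensR (Ext0 (d - 1)) = {T. keys T \<subseteq> {V} \<and> coeffs_in_RR T}"
    by (simp only: tensR_basis)
  also have "\<dots> = {single V c | c. c \<in> \<RR>}"
  proof (intro equalityI subsetI)
    fix T :: "rr ext" assume "T \<in> {T. keys T \<subseteq> {V} \<and> coeffs_in_RR T}"
    then have T: "keys T \<subseteq> {V}" "coeffs_in_RR T" by auto
    have "lookup T I = 0" if "I \<noteq> V" for I
    proof -
      have "I \<notin> keys T" using that T(1) by blast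
      then show ?thesis by (simp only: in_keys_iff not_not)
    qed
    then have "T = single V (lookup T V)"
      by (intro poly_mapping_eqI) (simp add: lookup_single when_def)
    then show "T \<in> {single V c | c. c \<in> \<RR>}" using crr_lookup[OF T(2)] by blast
  next
    fix T :: "rr ext" assume "T \<in> {single V c | c. c \<in> \<RR>}"
    then obtain c where "T = single V c" "c \<in> \<RR>" by blast
    then show "T \<in> {T. keys T \<subseteq> {V} \<and> coeffs_in_RR T}"
      by (simp only: mem_Collect_eq keys_single_subset crr_single simp_thms)
  qed
  finally show ?thesis .
qed


subsection \<open>The elements \<Phi> and \<open>Phi_tilde\<close>, and the maps \<open>q\<close> and \<open>proj\<close>\<close>

lemma RR_inR: "inR u \<in> \<RR>"
  unfolding inR_def
proof (rule RR_sum)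
  fix i assume "i \<in> {1..d}"
  then show "single {#Inl i#} (xs i u) \<in> \<RR>"
    using keys_single_subset[of "{#Inl i#}" "xs i u"] by (auto simp: RR_def)
qed

lemma form_toR: "form toR"
  unfolding toR_def[abs_def] by (rule form_weighted_sum)

lemma RR_toR: "coeffs_in_RR f \<Longrightarrow> toR f \<in> \<RR>"
  unfolding toR_def by (intro RR_sum RR_mult crr_lookup RR_prod_mset RR_inR)

lemma keys_Phi: "keys Phi \<subseteq> mons {1..d} (2 * n - 2)"
  by (auto simp: in_keys_iff lookup_Phi split: if_splits)

lemma crr_Phi: "coeffs_in_RR Phi"
proof -
  have "single {#Inr m#} 1 \<in> \<RR>" if "m \<in> mons {1..d} (2 * n - 2)" for m
    using that by (simp add: RR_def)
  then show ?thesis by (simp add: coeffs_in_RR_def lookup_Phi RR_zero)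
qed

lemma lookup_contr_single: "lookup (contr (single k 1) \<nu>) j = lookup \<nu> (k + j)"
  by (simp add: lookup_contr)

text \<open>As contraction by \<open>x\<^sub>1\<close> prescribes the coefficients at the monomials divisible by \<open>x\<^sub>1\<close>, and
  contraction by \<open>Sym\<^bsub>2n-1\<^esub> U\<^sub>0\<close> the other ones, \<open>Phi_tilde\<close> exists and is unique.\<close>

lemma Phi_tilde_props:
  shows contr_x1_Phi_tilde: "contr (single {#1#} 1) Phi_tilde = Phi"
    and keys_Phi_tilde: "keys Phi_tilde \<subseteq> mons {1..d} (2 * n - 1)"
    and crr_Phi_tilde: "coeffs_in_RR Phi_tilde"
proof -
  let ?P = "\<lambda>\<Psi>. \<Psi> \<in> tensR {\<nu> :: int dpow. keys \<nu> \<subseteq> mons {1..d} (2 * n - 1)} \<and>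
    contr (inSym x1) \<Psi> = Phi \<and> (\<forall>\<mu>\<in>Sym0 (2 * n - 1). contr (bc \<mu>) \<Psi> = 0)"
  have "1 \<in> {1..d}" using d_ge_3 by simp
  then have inSym_x1: "inSym x1 = (single {#1#} 1 :: rr sym)"
    by (simp only: inSym_x[of 1, unfolded x_1])
  define \<Psi> where "\<Psi> = lext (\<lambda>m. single (add_mset 1 m) 1) Phi"
  have lookup_\<Psi>: "lookup \<Psi> (add_mset 1 m) = lookup Phi m" for m
    unfolding \<Psi>_def
    by (rule hom_eqI[OF form_lookup_compose[OF hom_lext] form_lookup])
      (simp add: lookup_single when_def)
  have lookup_\<Psi>_0: "lookup \<Psi> m = 0" if "1 \<notin># m" for m
    unfolding \<Psi>_def
    by (rule hom_eqI[of "(*)" _ "\<lambda>_. 0", OF form_lookup_compose[OF hom_lext] formI])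
      (use that in \<open>auto simp: lookup_single when_def\<close>)
  have \<Psi>: "?P \<Psi>"
  proof (intro conjI ballI)
    have "add_mset 1 m \<in> mons {1..d} (2 * n - 1)" if "m \<in> keys Phi" for m
    proof -
      have "m \<in> mons {1..d} (2 * n - 2)" using that keys_Phi by blast
      then show ?thesis using n_ge_2 d_ge_3 by (simp add: mons_def)
    qed
    then have "keys \<Psi> \<subseteq> mons {1..d} (2 * n - 1)"
      unfolding \<Psi>_def by (intro keys_lext order_trans[OF keys_single_subset]) simp
    moreover have "coeffs_in_RR \<Psi>"
      unfolding \<Psi>_def by (intro crr_lext crr_Phi crr_single RR_one)
    ultimately show "\<Psi> \<in> tensR {\<nu>. keys \<nu> \<subseteq> mons {1..d} (2 * n - 1)}"
      unfolding tensR_basis by simp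
    show "contr (inSym x1) \<Psi> = Phi"
      unfolding inSym_x1
      by (rule poly_mapping_eqI) (simp add: lookup_contr_single lookup_\<Psi> del: One_nat_def)
    fix \<mu> assume \<mu>: "\<mu> \<in> Sym0 (2 * n - 1)"
    show "contr (bc \<mu>) \<Psi> = 0"
    proof (rule poly_mapping_eqI)
      fix j
      have "lookup \<Psi> (m + j) = 0" if "m \<in> keys (bc \<mu>)" for m
      proof (cases "j = {#}")
        case True
        have "m \<in> mons V (2 * n - 1)" using that keys_bc[of \<mu>] \<mu> by (auto simp: Sym0_def)
        then have "1 \<notin># m" by (auto simp: mons_def)
        then show ?thesis using True lookup_\<Psi>_0 by simp
      next
        case False
        have "size m = 2 * n - 1" using that keys_bc[of \<mu>] \<mu> by (auto simp: Sym0_def mons_def)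
        then have "m + j \<notin> mons {1..d} (2 * n - 1)" using False by (auto simp: mons_def)
        then have "m + j \<notin> keys \<Psi>" using \<open>keys \<Psi> \<subseteq> _\<close> by blast
        then show ?thesis by (simp only: in_keys_iff not_not)
      qed
      then show "lookup (contr (bc \<mu>) \<Psi>) j = lookup 0 j" by (simp add: lookup_contr)
    qed
  qed
  have unique: "\<Psi>' = \<Psi>" if "?P \<Psi>'" for \<Psi>'
  proof (rule poly_mapping_eqI)
    fix m
    have keys: "keys \<Psi>' \<subseteq> mons {1..d} (2 * n - 1)" using that by (simp add: tensR_basis)
    show "lookup \<Psi>' m = lookup \<Psi> m"
    proof (cases "1 \<in># m")
      case True
      then obtain k where "m = add_mset 1 k" by (metis insert_DiffM)
      moreover have "lookup \<Psi>' (add_mset 1 k) = lookup (contr (inSym x1) \<Psi>') k"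
        by (simp add: inSym_x1 lookup_contr_single)
      ultimately show ?thesis using that by (simp add: lookup_\<Psi> del: One_nat_def)
    next
      case False
      show ?thesis
      proof (cases "m \<in> mons {1..d} (2 * n - 1)")
        case True
        then have "m \<in> mons V (2 * n - 1)" using False unfolding mons_def indices by auto
        then have "single m 1 \<in> Sym0 (2 * n - 1)" by (simp add: Sym0_def)
        then have "contr (bc (single m 1)) \<Psi>' = 0" using that by blast
        then have "lookup \<Psi>' (m + {#}) = 0"
          using lookup_contr_single[of m \<Psi>' "{#}"] by (simp add: bc_single)
        then show ?thesis using False by (simp add: lookup_\<Psi>_0)
      next
        case out: False
        then have "m \<notin> keys \<Psi>'" using keys by blast
        then show ?thesis using lookup_\<Psi>_0[OF False] by (simp only: in_keys_iff not_not)
      qed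
    qed
  qed
  have "Phi_tilde = \<Psi>"
    unfolding Phi_tilde_def by (rule the_equality) (rule \<Psi>, rule unique)
  then have "?P Phi_tilde" using \<Psi> by simp
  then show "contr (single {#1#} 1) Phi_tilde = Phi"
    "keys Phi_tilde \<subseteq> mons {1..d} (2 * n - 1)" "coeffs_in_RR Phi_tilde"
    unfolding inSym_x1 tensR_basis by simp_all
qed

lemma keys_contr_Phi_tilde:
  assumes "keys f \<subseteq> mons W s"
  shows "keys (contr f Phi_tilde) \<subseteq> mons {1..d} (2 * n - 1 - s)"
proof
  fix j assume "j \<in> keys (contr f Phi_tilde)"
  then obtain m where "m \<in> keys f" "m + j \<in> keys Phi_tilde" using keys_contr by blast
  then have "m \<in> mons W s" "m + j \<in> mons {1..d} (2 * n - 1)" using assms keys_Phi_tilde by blast+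
  then show "j \<in> mons {1..d} (2 * n - 1 - s)" by (auto simp: mons_def)
qed

lemma RR_det:
  assumes A: "A \<in> carrier_mat k k" and "\<And>i j. i < k \<Longrightarrow> j < k \<Longrightarrow> A $$ (i, j) \<in> \<RR>"
  shows "det A \<in> \<RR>"
  unfolding det_def'[OF A]
proof (intro RR_sum RR_mult RR_prod RR_of_int)
  fix \<sigma> i assume "\<sigma> \<in> {\<sigma>. \<sigma> permutes {0..<k}}" "i \<in> {0..<k}"
  then have "\<sigma> i < k" by (metis atLeastLessThan_iff mem_Collect_eq permutes_in_image)
  then show "A $$ (i, \<sigma> i) \<in> \<RR>" using \<open>i \<in> {0..<k}\<close> by (simp add: assms(2))
qed

lemma p_mat: "p_mat \<in> carrier_mat (length basis_list) (length basis_list)"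
  by (simp add: p_mat_def)

lemma p_mat_index:
  "i < length basis_list \<Longrightarrow> j < length basis_list \<Longrightarrow>
    p_mat $$ (i, j) = lookup Phi (basis_list ! j + basis_list ! i)"
  by (simp add: p_mat_def p_def lookup_contr)

lemma RR_p_mat: "i < length basis_list \<Longrightarrow> j < length basis_list \<Longrightarrow> p_mat $$ (i, j) \<in> \<RR>"
  by (simp add: p_mat_index crr_lookup crr_Phi)

lemma RR_delta: "delta \<in> \<RR>"
  unfolding delta_def by (rule RR_det[OF p_mat RR_p_mat])

lemma RR_adj_p_mat:
  assumes "i < length basis_list" "j < length basis_list"
  shows "adj_mat p_mat $$ (i, j) \<in> \<RR>"
proof -
  have "det (mat_delete p_mat j i) \<in> \<RR>"
  proof (rule RR_det[OF mat_delete_carrier[OF p_mat]])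
    fix i' j' assume "i' < length basis_list - 1" "j' < length basis_list - 1"
    then show "mat_delete p_mat j i $$ (i', j') \<in> \<RR>"
      using p_mat by (auto simp: mat_delete_def intro!: RR_p_mat)
  qed
  then show ?thesis
    using assms p_mat by (simp add: adj_mat_def cofactor_def RR_mult RR_neg_one_power)
qed

text \<open>The entries of the matrix of \<open>p\<close> depend only on the product of the two monomials, as in a Hankel
  matrix. So the matrix and its adjugate are symmetric.\<close>

lemma adj_mat_symmetric:
  fixes A :: "'a::comm_ring_1 mat"
  assumes A: "A \<in> carrier_mat k k" and sym: "\<And>i j. i < k \<Longrightarrow> j < k \<Longrightarrow> A $$ (i, j) = A $$ (j, i)"
    and ij: "i < k" "j < k"
  shows "adj_mat A $$ (i, j) = adj_mat A $$ (j, i)"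
proof -
  have "transpose_mat (mat_delete A i j) = mat_delete A j i"
    using A by (intro eq_matI) (auto simp: mat_delete_def intro!: sym)
  then have "det (mat_delete A j i) = det (mat_delete A i j)"
    using det_transpose[OF mat_delete_carrier[OF A], of i j] by simp
  then show ?thesis
    using A ij by (simp add: adj_mat_def cofactor_def add.commute)
qed

lemma adj_p_mat_symmetric:
  "i < length basis_list \<Longrightarrow> j < length basis_list \<Longrightarrow> adj_mat p_mat $$ (i, j) = adj_mat p_mat $$ (j, i)"
  by (rule adj_mat_symmetric[OF p_mat]) (simp_all add: p_mat_index add.commute)

lemma hom_q: "hom q"
  by (rule homI) (simp_all add: q_def lookup_add lookup_scl distrib_left single_add sum.distrib
    scl_sum mult.left_commute)

text \<open>The map \<open>q\<close> is self-adjoint.\<close>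

lemma q_symmetric: "pair \<nu> (q \<nu>') = pair (q \<nu>) \<nu>'"
proof -
  let ?N = "length basis_list"
  have *: "pair \<nu> (q \<nu>') = (\<Sum>i<?N. \<Sum>j<?N. adj_mat p_mat $$ (i, j) *
      (lookup \<nu> (basis_list ! i) * lookup \<nu>' (basis_list ! j)))" for \<nu> \<nu>'
    by (simp add: q_def pair_sum pair_single ac_simps)
  have "pair \<nu> (q \<nu>') = (\<Sum>j<?N. \<Sum>i<?N. adj_mat p_mat $$ (i, j) *
      (lookup \<nu> (basis_list ! i) * lookup \<nu>' (basis_list ! j)))"
    unfolding * by (rule sum.swap)
  also have "\<dots> = pair \<nu>' (q \<nu>)"
    unfolding * by (intro sum.cong refl) (simp add: adj_p_mat_symmetric mult.commute[of "lookup \<nu> _"])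
  finally show ?thesis by (simp add: pair_commute)
qed

lemma keys_q: "keys (q \<nu>) \<subseteq> mons {1..d} (n - 1)"
  unfolding q_def
proof (intro keys_sum_subset order_trans[OF keys_single_subset])
  fix i assume "i \<in> {..<length basis_list}"
  then show "{basis_list ! i} \<subseteq> mons {1..d} (n - 1)"
    using basis_list(2) nth_mem[of i basis_list] by auto
qed

lemma crr_q: "coeffs_in_RR \<nu> \<Longrightarrow> coeffs_in_RR (q \<nu>)"
  unfolding q_def by (intro crr_sum crr_single RR_mult RR_adj_p_mat crr_lookup) auto

lemma proj_eq_lext: "proj = lext (\<lambda>m. \<Prod>i\<in>#m. inSym (x i - scale (x1s (x i)) x1))"
  by (rule ext) (simp add: proj_def lext_def)

lemma hom_proj: "hom proj"
  unfolding proj_eq_lext by (rule hom_lext)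

lemma proj_single:
  assumes "set_mset m \<subseteq> {1..d}"
  shows "proj (single m 1) = (if 1 \<in># m then 0 else single m 1)"
proof -
  interpret U: Modules.module scale by (rule module_U)
  have "inSym (x i - scale (x1s (x i)) x1) = (if i = 1 then 0 else single {#i#} (1 :: rr))"
    if "i \<in> {1..d}" for i
  proof (cases "i = 1")
    case True
    then show ?thesis using x_1 x1s_x1 by (simp add: inSym_zero del: One_nat_def)
  next
    case False
    then have "i \<in> V" using that by auto
    then show ?thesis using False that by (simp add: x1s_x inSym_x del: One_nat_def)
  qed
  then have "(\<Prod>i\<in>#m. inSym (x i - scale (x1s (x i)) x1)) = (\<Prod>i\<in>#m. if i = 1 then 0 else single {#i#} (1 :: rr))"
    using assms by (intro arg_cong[of _ _ prod_mset] image_mset_cong) auto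
  also have "\<dots> = (if 1 \<in># m then 0 else single m 1)"
  proof (induction m)
    case empty
    show ?case by (simp only: image_mset_empty prod_mset_empty set_mset_empty empty_iff if_False single_one)
  next
    case (add i m)
    then show ?case by (simp add: mult_single)
  qed
  finally show ?thesis by (simp add: proj_eq_lext)
qed

lemma keys_proj:
  assumes "keys f \<subseteq> mons {1..d} s"
  shows "keys (proj f) \<subseteq> mons V s"
proof -
  have "keys (\<Prod>i\<in>#m. inSym (x i - scale (x1s (x i)) x1) :: rr sym) \<subseteq> mons V s" if "m \<in> keys f" for m
  proof -
    have m: "m \<in> mons {1..d} s" using that assms by blast
    then have "proj (single m 1) = (if 1 \<in># m then 0 else single m 1)"
      by (intro proj_single) (simp add: mons_def)
    moreover have "m \<in> mons V s" if "1 \<notin># m"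
      using m that unfolding mons_def indices by auto
    ultimately have "keys (proj (single m 1)) \<subseteq> mons V s" by (cases "1 \<in># m") simp_all
    then show ?thesis by (simp add: proj_eq_lext)
  qed
  then show ?thesis unfolding proj_eq_lext by (rule keys_lext)
qed

lemma pair_proj:
  assumes "keys f \<subseteq> mons {1..d} s" "m \<in> mons V s'"
  shows "pair (proj f) (single m 1) = pair f (single m 1)"
proof (rule hom_eqI[OF form_compose[OF form_pair_left hom_proj] form_pair_left])
  fix k assume "k \<in> keys f"
  then have "proj (single k 1) = (if 1 \<in># k then 0 else single k 1)"
    using assms(1) by (intro proj_single) (auto simp: mons_def)
  moreover have "1 \<notin># m" using assms(2) by (auto simp: mons_def)
  ultimately show "pair (proj (single k 1)) (single m 1) = pair (single k 1) (single m 1)"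
    by (auto simp: pair_single lookup_single when_def)
qed

lemma crr_proj:
  assumes "keys f \<subseteq> mons {1..d} s" "coeffs_in_RR f"
  shows "coeffs_in_RR (proj f)"
  unfolding proj_eq_lext
proof (rule crr_lext[OF assms(2)])
  fix m assume "m \<in> keys f"
  then have "proj (single m 1) = (if 1 \<in># m then 0 else single m 1)"
    using assms(1) by (intro proj_single) (auto simp: mons_def)
  then show "coeffs_in_RR (\<Prod>i\<in>#m. inSym (x i - scale (x1s (x i)) x1))"
    by (simp add: proj_eq_lext crr_zero crr_single RR_one)
qed

subsection \<open>The four maps from which the differentials are built\<close>

text \<open>On \<open>D\<^bsub>n-1\<^esub>(U\<^sub>0\<^sup>*)\<close> these are \<open>\<nu> \<mapsto> proj(q(\<nu>))\<close> and \<open>\<nu> \<mapsto> [q(\<nu>)](Phi_tilde)\<close>; on \<open>Sym\<^sub>n U\<^sub>0\<close> they are the composites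
  of the two with \<open>\<mu> \<mapsto> \<mu>(Phi_tilde)\<close>.\<close>

definition q_proj :: "rr dpow \<Rightarrow> rr sym"
  where "q_proj \<nu> = proj (q \<nu>)"

definition q_lift :: "rr dpow \<Rightarrow> rr dpow"
  where "q_lift \<nu> = contr (q \<nu>) Phi_tilde"

definition tproj :: "rr sym \<Rightarrow> rr sym"
  where "tproj \<mu> = q_proj (contr \<mu> Phi_tilde)"

definition tlift :: "rr sym \<Rightarrow> rr dpow"
  where "tlift \<mu> = q_lift (contr \<mu> Phi_tilde)"

lemma hom_contr_Phi_tilde: "hom (\<lambda>\<mu>. contr \<mu> Phi_tilde)"
  by (rule hom_contr_left)

lemma hom_q_proj: "hom q_proj"
  unfolding q_proj_def[abs_def] by (rule hom_compose[OF hom_proj hom_q])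

lemma hom_q_lift: "hom q_lift"
  unfolding q_lift_def[abs_def] by (rule hom_compose[OF hom_contr_Phi_tilde hom_q])

lemma keys_q_proj: "keys (q_proj \<nu>) \<subseteq> mons V (n - 1)"
  unfolding q_proj_def by (rule keys_proj[OF keys_q])

lemma keys_tproj: "keys (tproj \<mu>) \<subseteq> mons V (n - 1)"
  unfolding tproj_def by (rule keys_q_proj)

lemma keys_q_lift: "keys (q_lift \<nu>) \<subseteq> mons {1..d} n"
proof -
  have "2 * n - 1 - (n - 1) = n" using n_ge_2 by simp
  then show ?thesis unfolding q_lift_def using keys_contr_Phi_tilde[OF keys_q] by metis
qed

lemma keys_tlift: "keys (tlift \<mu>) \<subseteq> mons {1..d} n"
  unfolding tlift_def by (rule keys_q_lift)

lemma crr_q_proj: "coeffs_in_RR \<nu> \<Longrightarrow> coeffs_in_RR (q_proj \<nu>)"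
  unfolding q_proj_def by (intro crr_proj[OF keys_q] crr_q)

lemma crr_q_lift: "coeffs_in_RR \<nu> \<Longrightarrow> coeffs_in_RR (q_lift \<nu>)"
  unfolding q_lift_def by (intro crr_contr crr_q crr_Phi_tilde)

lemma crr_tproj: "coeffs_in_RR \<mu> \<Longrightarrow> coeffs_in_RR (tproj \<mu>)"
  unfolding tproj_def by (intro crr_q_proj crr_contr crr_Phi_tilde)

lemma crr_tlift: "coeffs_in_RR \<mu> \<Longrightarrow> coeffs_in_RR (tlift \<mu>)"
  unfolding tlift_def by (intro crr_q_lift crr_contr crr_Phi_tilde)

lemma pair_q_lift: "pair (q_lift \<nu>) \<mu> = pair \<nu> (q (contr \<mu> Phi_tilde))"
proof -
  have "pair (q_lift \<nu>) \<mu> = pair Phi_tilde (\<mu> * q \<nu>)"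
    unfolding q_lift_def by (simp add: pair_contr mult.commute)
  also have "\<dots> = pair (contr \<mu> Phi_tilde) (q \<nu>)" by (simp add: pair_contr)
  finally show ?thesis by (simp add: q_symmetric pair_commute)
qed

lemma q_proj_selfadjoint:
  assumes "m \<in> mons V (n - 1)" "m' \<in> mons V (n - 1)"
  shows "pair (q_proj (single m 1)) (single m' 1) = pair (single m 1) (q_proj (single m' 1))"
  unfolding q_proj_def pair_commute[of "single m 1"]
    pair_proj[OF keys_q assms(1)] pair_proj[OF keys_q assms(2)]
  by (metis pair_commute q_symmetric)

lemma q_lift_adjoint:
  assumes "m \<in> mons V (n - 1)"
  shows "pair (q_lift (single m 1)) \<mu> = pair (single m 1) (tproj \<mu>)"
  unfolding tproj_def q_proj_def pair_commute[of "single m 1"] pair_proj[OF keys_q assms]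
  by (metis pair_commute pair_q_lift)

lemma tproj_adjoint:
  assumes "m' \<in> mons V (n - 1)"
  shows "pair (tproj \<mu>) (single m' 1) = pair \<mu> (q_lift (single m' 1))"
  using q_lift_adjoint[OF assms, of \<mu>] by (simp add: pair_commute)

lemma tlift_selfadjoint: "pair (tlift \<mu>) \<mu>' = pair \<mu> (tlift \<mu>')"
proof -
  have "pair \<mu> (tlift \<mu>') = pair (tlift \<mu>') \<mu>" by (rule pair_commute)
  also have "\<dots> = pair (contr \<mu>' Phi_tilde) (q (contr \<mu> Phi_tilde))"
    unfolding tlift_def by (rule pair_q_lift)
  also have "\<dots> = pair (contr \<mu> Phi_tilde) (q (contr \<mu>' Phi_tilde))"
    by (simp add: q_symmetric[of "contr \<mu>' Phi_tilde"] pair_commute)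
  also have "\<dots> = pair (tlift \<mu>) \<mu>'"
    unfolding tlift_def by (rule pair_q_lift[symmetric])
  finally show ?thesis by simp
qed

text \<open>The coefficients of \<open>q_lift \<nu>\<close> and \<open>tlift \<mu>\<close> at the monomials divisible by \<open>x\<^sub>1\<close> are known, because
  contraction by \<open>x\<^sub>1\<close> turns \<open>Phi_tilde\<close> into \<Phi>.\<close>

lemma contr_x1_q_lift:
  assumes "keys \<nu> \<subseteq> mons {1..d} (n - 1)"
  shows "contr (single {#1#} 1) (q_lift \<nu>) = scl delta \<nu>"
proof -
  have "contr (single {#1#} 1) (q_lift \<nu>) = contr (q \<nu>) (contr (single {#1#} 1) Phi_tilde)"
    by (simp add: q_lift_def contr_contr mult.commute)
  then show ?thesis by (simp only: contr_x1_Phi_tilde contr_q_Phi[OF assms])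
qed

lemma contr_x1_tlift:
  assumes "keys \<mu> \<subseteq> mons V n"
  shows "contr (single {#1#} 1) (tlift \<mu>) = scl delta (contr \<mu> Phi_tilde)"
proof -
  have "2 * n - 1 - n = n - 1" by simp
  then have "keys (contr \<mu> Phi_tilde) \<subseteq> mons {1..d} (n - 1)"
    using keys_contr_Phi_tilde[OF assms] by simp
  then show ?thesis unfolding tlift_def by (rule contr_x1_q_lift)
qed

end

lemma bc_etpair: "of_int (etpair V T S) = etpair V (bc T) (bc S)"
proof -
  have "etpair V (bc T) (bc S) =
      (\<Sum>k\<in>keys T. lookup (bc T) k * (csgn V (fst k) * lookup (bc S) (V - fst k, snd k)))"
    unfolding etpair_def using keys_bc[of T] by (intro sum.mono_neutral_left) (auto simp: in_keys_iff)
  then show ?thesis by (simp add: etpair_def lookup_bc)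
qed

context pointed_free_module
begin

section \<open>The pairings\<close>

text \<open>The modules \<open>\<RR> \<otimes> K\<^bsub>a,n-1\<^esub> U\<^sub>0\<close> and \<open>\<RR> \<otimes> L\<^bsub>a,n\<^esub> U\<^sub>0\<close>, as cycles with coefficients in \<open>\<RR>\<close>.\<close>

definition KR :: "nat \<Rightarrow> rr ext_dpow set"
  where "KR a = {T. keys T \<subseteq> subs V a \<times> mons V (n - 1) \<and> coeffs_in_RR T \<and> dkosz V T = 0}"

definition LR :: "nat \<Rightarrow> rr ext_sym set"
  where "LR a = {T. keys T \<subseteq> subs V a \<times> mons V n \<and> coeffs_in_RR T \<and> kosz V T = 0}"

lemma B_0: "B 0 = {(\<alpha>, 0, 0, 0) | \<alpha>. \<alpha> \<in> \<RR>}"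
  by (simp add: B_def)

lemma B_mid: "1 \<le> r \<Longrightarrow> r < d \<Longrightarrow> B r = {(0, k, l, 0) | k l. k \<in> KR (r - 1) \<and> l \<in> LR (r - 1)}"
  using n_ge_2 by (simp add: B_def tensR_K0 tensR_L0 KR_def LR_def)

lemma B_d: "B d = {(0, 0, 0, single V c) | c. c \<in> \<RR>}"
  using d_ge_3 tensR_Ext0_top by (auto simp: B_def)

lemma KR_add: "k \<in> KR a \<Longrightarrow> k' \<in> KR a \<Longrightarrow> k + k' \<in> KR a"
  unfolding KR_def using keys_add[of k k'] by (auto simp: crr_add hom_add[OF hom_dkosz])

lemma LR_add: "l \<in> LR a \<Longrightarrow> l' \<in> LR a \<Longrightarrow> l + l' \<in> LR a"
  unfolding LR_def using keys_add[of l l'] by (auto simp: crr_add hom_add[OF hom_kosz])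

lemma KR_scl: "c \<in> \<RR> \<Longrightarrow> k \<in> KR a \<Longrightarrow> scl c k \<in> KR a"
  unfolding KR_def using keys_scl[of c k] by (auto simp: crr_scl hom_scl[OF hom_dkosz])

lemma LR_scl: "c \<in> \<RR> \<Longrightarrow> l \<in> LR a \<Longrightarrow> scl c l \<in> LR a"
  unfolding LR_def using keys_scl[of c l] by (auto simp: crr_scl hom_scl[OF hom_kosz])

lemma KR_zero: "0 \<in> KR a"
  by (simp add: KR_def crr_zero hom_zero[OF hom_dkosz])

lemma LR_zero: "0 \<in> LR a"
  by (simp add: LR_def crr_zero hom_zero[OF hom_kosz])

lemma kosz_in_LR:
  assumes "keys S \<subseteq> subs V a \<times> mons V (n - 1)" "coeffs_in_RR S"
  shows "kosz V S \<in> LR (a - 1)"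
  using keys_kosz[OF _ assms(1)] n_ge_2 by (simp add: LR_def kosz_kosz crr_kosz assms(2))

lemma dkosz_in_KR:
  assumes "keys T \<subseteq> subs V a \<times> mons V n" "coeffs_in_RR T"
  shows "dkosz V T \<in> KR (a - 1)"
  using keys_dkosz[OF _ assms(1)] by (simp add: KR_def dkosz_dkosz crr_dkosz assms(2))

lemma
  assumes "l \<in> LR a"
  shows kosz_khtpy_LR: "kosz V (khtpy l) = l"
    and keys_khtpy_LR: "keys (khtpy l) \<subseteq> subs V (a + 1) \<times> mons V (n - 1)"
    and crr_khtpy_LR: "coeffs_in_RR (khtpy l)"
  using assms n_ge_2 kosz_khtpy_cycle[of l a n] keys_khtpy[of V l a n]
  by (auto simp: LR_def crr_khtpy)

lemma
  assumes "k \<in> KR a"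
  shows dkosz_dkhtpy_KR: "dkosz V (dkhtpy V k) = k"
    and keys_dkhtpy_KR: "keys (dkhtpy V k) \<subseteq> subs V (a + 1) \<times> mons V n"
    and crr_dkhtpy_KR: "coeffs_in_RR (dkhtpy V k)"
proof -
  have "n - 1 \<ge> 1" "n - 1 + 1 = n" using n_ge_2 by auto
  then show "dkosz V (dkhtpy V k) = k" "keys (dkhtpy V k) \<subseteq> subs V (a + 1) \<times> mons V n"
    "coeffs_in_RR (dkhtpy V k)"
    using assms dkosz_dkhtpy_cycle[of k a "n - 1"] keys_dkhtpy[of V k a "n - 1"]
    by (auto simp: KR_def crr_dkhtpy)
qed

lemma neg_one_power_cancel:
  fixes y z :: rr
  assumes "(- 1) ^ a * y = (- 1) ^ a * z"
  shows "y = z"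
  using arg_cong[OF assms, of "(*) ((- 1) ^ a)"]
  unfolding mult.assoc[symmetric] minus_one_mult_self mult_1 .

lemma etpair_khtpy_dkosz:
  assumes "l \<in> LR a" "keys T \<subseteq> Pow V \<times> UNIV"
  shows "etpair V (khtpy l) (dkosz V T) = (- 1) ^ a * etpair V l T"
proof -
  have "keys (khtpy l) \<subseteq> subs V (a + 1) \<times> UNIV"
    using keys_khtpy_LR[OF assms(1)] by auto
  then have "etpair V (kosz V (khtpy l)) T = (- 1) ^ (a + 1 + 1) * etpair V (khtpy l) (dkosz V T)"
    by (intro etpair_kosz assms(2)) simp_all
  then show ?thesis
    by (simp add: kosz_khtpy_LR[OF assms(1)] mult.assoc[symmetric] power_mult_distrib[symmetric])
qed

lemma etpair_dkosz_khtpy: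
  assumes "keys T \<subseteq> subs V a \<times> UNIV" "l \<in> LR c"
  shows "etpair V (dkosz V T) (khtpy l) = (- 1) ^ (a + 1) * etpair V T l"
proof -
  have "keys (khtpy l) \<subseteq> Pow V \<times> UNIV"
    using keys_khtpy_LR[OF assms(2)] by (rule keys_subs_Pow)
  then show ?thesis
    using etpair_dkosz[OF _ assms(1), of "khtpy l" V] by (simp add: kosz_khtpy_LR[OF assms(2)])
qed

text \<open>Paired with a cycle, a chain may be replaced by any chain with the same boundary.\<close>

lemma etpair_khtpy_kosz:
  assumes k: "k \<in> KR c" and S: "keys S \<subseteq> subs V a \<times> mons V (n - 1)" "a \<ge> 1"
  shows "etpair V (khtpy (kosz V S)) k = etpair V S k"
proof -
  have keys: "keys (kosz V S) \<subseteq> subs V (a - 1) \<times> mons V n"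
    using keys_kosz[OF _ S(1)] n_ge_2 by simp
  then have "keys (khtpy (kosz V S)) \<subseteq> subs V a \<times> UNIV"
    using keys_khtpy[OF _ keys] n_ge_2 S(2) by auto
  moreover have "kosz V (khtpy (kosz V S)) = kosz V S"
    using n_ge_2 by (intro kosz_khtpy_cycle[OF keys]) (simp_all add: kosz_kosz)
  moreover have "keys (dkhtpy V k) \<subseteq> Pow V \<times> UNIV"
    using keys_dkhtpy_KR[OF k] by (rule keys_subs_Pow)
  moreover have "keys S \<subseteq> subs V a \<times> UNIV" using S(1) by auto
  ultimately have "(- 1) ^ (a + 1) * etpair V (khtpy (kosz V S)) (dkosz V (dkhtpy V k)) =
      (- 1) ^ (a + 1) * etpair V S (dkosz V (dkhtpy V k))"
    using etpair_kosz[of V _ a "dkhtpy V k" V] by (metis finite_atLeastAtMost)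
  then show ?thesis unfolding dkosz_dkhtpy_KR[OF k] by (rule neg_one_power_cancel)
qed

lemma etpair_cycle_khtpy:
  assumes k: "k \<in> KR c" and S: "keys S \<subseteq> subs V a \<times> mons V (n - 1)" "a \<ge> 1"
  shows "etpair V k (khtpy (kosz V S)) = etpair V k S"
proof -
  have keys: "keys (kosz V S) \<subseteq> subs V (a - 1) \<times> mons V n"
    using keys_kosz[OF _ S(1)] n_ge_2 by simp
  then have "keys (khtpy (kosz V S)) \<subseteq> Pow V \<times> UNIV"
    using keys_khtpy[OF _ keys] n_ge_2 by (intro keys_subs_Pow) auto
  moreover have "kosz V (khtpy (kosz V S)) = kosz V S"
    using n_ge_2 by (intro kosz_khtpy_cycle[OF keys]) (simp_all add: kosz_kosz)
  moreover have "keys (dkhtpy V k) \<subseteq> subs V (c + 1) \<times> UNIV"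
    using keys_dkhtpy_KR[OF k] by auto
  moreover have "keys S \<subseteq> Pow V \<times> UNIV" using S(1) by (rule keys_subs_Pow)
  ultimately have "etpair V (dkosz V (dkhtpy V k)) (khtpy (kosz V S)) = etpair V (dkosz V (dkhtpy V k)) S"
    using etpair_dkosz[of V "dkhtpy V k" "c + 1" _ V] by (metis finite_atLeastAtMost)
  then show ?thesis by (simp add: dkosz_dkhtpy_KR[OF k])
qed

subsection \<open>An explicit formula for the pairings\<close>

text \<open>The coefficient of \<open>x\<^sub>V\<close> in the pairing of \<open>(k, l) \<in> B\<^sub>r\<close> with \<open>(k', l') \<in> B\<^bsub>d - r\<^esub>\<close>. The homotopy
  picks one of the preimages of \<open>l\<close> and \<open>l'\<close> under \<kappa>.\<close>

definition ppc :: "nat \<Rightarrow> rr ext_dpow \<Rightarrow> rr ext_sym \<Rightarrow> rr ext_dpow \<Rightarrow> rr ext_sym \<Rightarrow> rr"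
  where "ppc r k l k' l' = (- 1) ^ (r + 1) * etpair V (khtpy l) k' - etpair V k (khtpy l')"

text \<open>The resulting pairing of \<open>B\<^sub>r\<close> with \<open>B\<^bsub>d - r\<^esub>\<close> for \<open>1 \<le> r < d\<close>.\<close>

definition ppx :: "nat \<Rightarrow> bmod \<Rightarrow> bmod \<Rightarrow> bmod"
  where "ppx r = (\<lambda>(_, k, l, _) (_, k', l', _). (0, 0, 0, single V (ppc r k l k' l')))"

lemma ppx_tuple: "ppx r (\<alpha>, k, l, \<omega>) (\<alpha>', k', l', \<omega>') = (0, 0, 0, single V (ppc r k l k' l'))"
  by (simp add: ppx_def)

lemma ppc_add_left: "ppc r (k1 + k2) (l1 + l2) k' l' = ppc r k1 l1 k' l' + ppc r k2 l2 k' l'"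
  by (simp add: ppc_def hom_add[OF hom_khtpy] hom_add[OF form_etpair_left] algebra_simps)

lemma ppc_add_right: "ppc r k l (k1 + k2) (l1 + l2) = ppc r k l k1 l1 + ppc r k l k2 l2"
  by (simp add: ppc_def hom_add[OF hom_khtpy] hom_add[OF form_etpair_right] algebra_simps)

lemma ppc_scl_left: "ppc r (scl c k) (scl c l) k' l' = c * ppc r k l k' l'"
  by (simp add: ppc_def hom_scl[OF hom_khtpy] hom_scl[OF form_etpair_left] algebra_simps)

lemma ppc_scl_right: "ppc r k l (scl c k') (scl c l') = c * ppc r k l k' l'"
  by (simp add: ppc_def hom_scl[OF hom_khtpy] hom_scl[OF form_etpair_right] algebra_simps)

lemma RR_ppc:
  assumes "k \<in> KR a" "l \<in> LR a" "k' \<in> KR c" "l' \<in> LR c"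
  shows "ppc r k l k' l' \<in> \<RR>"
  using assms unfolding ppc_def KR_def LR_def
  by (intro RR_diff RR_mult RR_neg_one_power RR_etpair crr_khtpy) blast+

lemma bilinear_ppx:
  assumes "1 \<le> r" "r < d"
  shows "bilinear_over \<RR> bscl (B r) (B (d - r)) (B d) (ppx r)"
proof -
  have r: "1 \<le> d - r" "d - r < d" using assms by auto
  show ?thesis
    unfolding bilinear_over_def linear_over_def B_mid[OF assms] B_mid[OF r] B_d
    by (auto simp: ppx_tuple ppc_add_left ppc_add_right ppc_scl_left ppc_scl_right single_add RR_ppc)
qed

lemma Ext0_iff: "\<theta> \<in> Ext0 a \<longleftrightarrow> keys \<theta> \<subseteq> subs V a"
  by (auto simp: Ext0_def subs_def)

lemma functional_x: "i \<in> V \<Longrightarrow> functional \<nu> (x i) = pair \<nu> (single {#i#} 1)"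
  by (simp add: functional_def inSym_x)

lemma wedge_act:
  assumes "1 \<le> r" "r < d" "\<theta> \<in> Ext0 r" "\<rho> \<in> Ext0 (d - r)"
  shows "wedge (act us \<theta>) \<rho> = single V (\<Sum>i\<in>V. us (x i) * epair V (iprod i \<theta>) \<rho>)"
proof -
  have \<theta>: "keys \<theta> \<subseteq> Pow V" using assms(3) by (auto simp: Ext0_iff subs_def)
  have "keys (iprod i \<theta>) \<subseteq> subs V (r - 1)" for i
  proof -
    have "keys (iprod i \<theta>) \<subseteq> (\<Union>I\<in>keys \<theta>. keys (iprod i (single I (1::int))))"
      unfolding hom_expansion[OF hom_iprod, of i \<theta>]
      by (intro keys_sum_subset order_trans[OF keys_scl]) blast
    also have "\<dots> \<subseteq> subs V (r - 1)"
      using assms(3) by (intro UN_least keys_iprod_single) (auto simp: Ext0_iff)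
    finally show ?thesis .
  qed
  then have "keys (act us \<theta>) \<subseteq> subs V (r - 1)"
    unfolding act_eq[OF \<theta>] by (intro keys_sum_subset order_trans[OF keys_scl])
  moreover have "card V - (r - 1) = d - r" using assms by simp
  ultimately have "wedge (act us \<theta>) \<rho> = single V (epair V (act us \<theta>) \<rho>)"
    using assms(4) by (intro wedge_complementary[of V _ "r - 1"]) (simp_all add: Ext0_iff)
  also have "epair V (act us \<theta>) \<rho> = (\<Sum>i\<in>V. us (x i) * epair V (iprod i \<theta>) \<rho>)"
    unfolding act_eq[OF \<theta>] by (simp add: hom_sum[OF form_epair_left] hom_scl[OF form_epair_left])
  finally show ?thesis .
qed

lemma wedge_act_kosz:
  assumes "1 \<le> r" "r < d" "\<theta> \<in> Ext0 r" "\<rho> \<in> Ext0 (d - r)"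
  shows "wedge (act (functional (contr \<mu> \<nu>)) \<theta>) \<rho> =
    single V (etpair V (kosz V (tens \<theta> \<mu>)) (tens \<rho> \<nu>))"
proof -
  have "etpair V (kosz V (tens \<theta> \<mu>)) (tens \<rho> \<nu>) =
      (\<Sum>i\<in>V. epair V (iprod i \<theta>) \<rho> * pair (single {#i#} 1 * \<mu>) \<nu>)"
    by (simp add: kosz_eq hom_sum[OF form_etpair_left] tmap_tens[OF hom_iprod hom_times] etpair_tens)
  also have "\<dots> = (\<Sum>i\<in>V. functional (contr \<mu> \<nu>) (x i) * epair V (iprod i \<theta>) \<rho>)"
    by (intro sum.cong refl) (simp add: functional_x pair_contr pair_commute[of \<nu>] mult.commute)
  finally show ?thesis by (simp add: wedge_act[OF assms])
qed

lemma wedge_act_dkosz: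
  assumes "1 \<le> r" "r < d" "\<theta> \<in> Ext0 r" "\<rho> \<in> Ext0 (d - r)"
  shows "wedge (act (functional (contr \<mu> \<nu>)) \<theta>) \<rho> =
    single V (etpair V (dkosz V (tens \<theta> \<nu>)) (tens \<rho> \<mu>))"
proof -
  have "etpair V (dkosz V (tens \<theta> \<nu>)) (tens \<rho> \<mu>) =
      (\<Sum>i\<in>V. epair V (iprod i \<theta>) \<rho> * pair (contr (single {#i#} 1) \<nu>) \<mu>)"
    by (simp add: dkosz_eq hom_sum[OF form_etpair_left] tmap_tens[OF hom_iprod hom_contr_right] etpair_tens)
  also have "\<dots> = (\<Sum>i\<in>V. functional (contr \<mu> \<nu>) (x i) * epair V (iprod i \<theta>) \<rho>)"
    by (intro sum.cong refl) (simp add: functional_x pair_contr mult.commute)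
  finally show ?thesis by (simp add: wedge_act[OF assms])
qed

lemma keys_tens_Ext0: "\<theta> \<in> Ext0 a \<Longrightarrow> keys \<mu> \<subseteq> M \<Longrightarrow> keys (tens \<theta> \<mu>) \<subseteq> subs V a \<times> M"
  using keys_tens[of \<theta> \<mu>] by (auto simp: Ext0_iff)

lemma is_pp_ppx:
  assumes r: "1 \<le> r" "r < d"
  shows "is_pp r (ppx r)"
  unfolding is_pp_def
proof (intro conjI ballI bilinear_ppx r)
  fix \<theta> \<theta>' \<rho> \<rho>' \<nu> \<nu>' \<mu> \<mu>'
  assume \<theta>: "\<theta> \<in> Ext0 r" "\<theta>' \<in> Ext0 r" and \<rho>: "\<rho> \<in> Ext0 (d - r)" "\<rho>' \<in> Ext0 (d - r)"
    and \<nu>: "\<nu> \<in> D0 n" "\<nu>' \<in> D0 n" and \<mu>: "\<mu> \<in> Sym0 (n - 1)" "\<mu>' \<in> Sym0 (n - 1)"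
  let ?T = "bc (tens \<theta> \<nu>)" and ?S = "bc (tens \<theta>' \<mu>)" and ?T' = "bc (tens \<rho> \<nu>')" and ?S' = "bc (tens \<rho>' \<mu>')"
  note sub = keys_tens_Ext0[OF \<theta>(1), of \<nu> "mons V n"] keys_tens_Ext0[OF \<theta>(2), of \<mu> "mons V (n - 1)"]
    keys_tens_Ext0[OF \<rho>(1), of \<nu>' "mons V n"] keys_tens_Ext0[OF \<rho>(2), of \<mu>' "mons V (n - 1)"]
  have int: "keys (tens \<theta> \<nu>) \<subseteq> subs V r \<times> mons V n" "keys (tens \<theta>' \<mu>) \<subseteq> subs V r \<times> mons V (n - 1)"
    "keys (tens \<rho> \<nu>') \<subseteq> subs V (d - r) \<times> mons V n" "keys (tens \<rho>' \<mu>') \<subseteq> subs V (d - r) \<times> mons V (n - 1)"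
    using sub \<nu> \<mu> by (simp_all add: D0_def Sym0_def)
  have keys: "keys ?T \<subseteq> subs V r \<times> mons V n" "keys ?S \<subseteq> subs V r \<times> mons V (n - 1)"
    "keys ?T' \<subseteq> subs V (d - r) \<times> mons V n" "keys ?S' \<subseteq> subs V (d - r) \<times> mons V (n - 1)"
    by (rule order_trans[OF keys_bc int(1)] order_trans[OF keys_bc int(2)]
        order_trans[OF keys_bc int(3)] order_trans[OF keys_bc int(4)])+
  have "eta (tens \<theta> \<nu>) = dkosz V (tens \<theta> \<nu>)" "eta (tens \<rho> \<nu>') = dkosz V (tens \<rho> \<nu>')"
    "kappa (tens \<theta>' \<mu>) = kosz V (tens \<theta>' \<mu>)" "kappa (tens \<rho>' \<mu>') = kosz V (tens \<rho>' \<mu>')"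
    by (rule eta_eq[OF keys_subs_Pow[OF int(1)]] eta_eq[OF keys_subs_Pow[OF int(3)]]
        kappa_eq[OF keys_subs_Pow[OF int(2)]] kappa_eq[OF keys_subs_Pow[OF int(4)]])+
  then have *: "ppx r (0, bc (eta (tens \<theta> \<nu>)), bc (kappa (tens \<theta>' \<mu>)), 0)
      (0, bc (eta (tens \<rho> \<nu>')), bc (kappa (tens \<rho>' \<mu>')), 0) =
    (0, 0, 0, single V (ppc r (dkosz V ?T) (kosz V ?S) (dkosz V ?T') (kosz V ?S')))"
    by (simp add: ppx_tuple bc_dkosz bc_kosz)
  have "etpair V (khtpy (kosz V ?S)) (dkosz V ?T') = (- 1) ^ (r - 1) * etpair V (kosz V ?S) ?T'"
    by (rule etpair_khtpy_dkosz[OF kosz_in_LR[OF keys(2) crr_bc] keys_subs_Pow[OF keys(3)]])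
  moreover have "(- 1) ^ (r + 1) * ((- 1) ^ (r - 1) * c) = c" for c :: rr
    using r(1) by (simp add: mult.assoc[symmetric] power_add[symmetric])
  ultimately have "(- 1) ^ (r + 1) * etpair V (khtpy (kosz V ?S)) (dkosz V ?T') = etpair V (kosz V ?S) ?T'"
    by simp
  moreover have "etpair V (dkosz V ?T) (khtpy (kosz V ?S')) = etpair V (dkosz V ?T) ?S'"
    using r by (intro etpair_cycle_khtpy[OF dkosz_in_KR[OF keys(1) crr_bc] keys(4)]) simp
  ultimately have "ppc r (dkosz V ?T) (kosz V ?S) (dkosz V ?T') (kosz V ?S') =
      of_int (etpair V (kosz V (tens \<theta>' \<mu>)) (tens \<rho> \<nu>') - etpair V (dkosz V (tens \<theta> \<nu>)) (tens \<rho>' \<mu>'))"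
    by (simp only: ppc_def bc_etpair[symmetric] bc_kosz[symmetric] bc_dkosz[symmetric] of_int_diff)
  then show "ppx r (0, bc (eta (tens \<theta> \<nu>)), bc (kappa (tens \<theta>' \<mu>)), 0)
      (0, bc (eta (tens \<rho> \<nu>')), bc (kappa (tens \<rho>' \<mu>')), 0) =
    (0, 0, 0, bc (wedge (act (functional (contr \<mu> \<nu>')) \<theta>') \<rho>
      - wedge (act (functional (contr \<mu>' \<nu>)) \<theta>) \<rho>'))"
    unfolding * wedge_act_kosz[OF r \<theta>(2) \<rho>(1)] wedge_act_dkosz[OF r \<theta>(1) \<rho>(2)]
    by (simp add: single_diff[symmetric] bc_single)
qed

lemma B_zero: "1 \<le> r \<Longrightarrow> r < d \<Longrightarrow> 0 \<in> B r"
  using KR_zero LR_zero by (simp add: B_mid zero_prod_def)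

lemma B_add:
  assumes r: "1 \<le> r" "r < d" and "v \<in> B r" "w \<in> B r"
  shows "v + w \<in> B r"
proof -
  obtain k l k' l' where "v = (0, k, l, 0)" "k \<in> KR (r - 1)" "l \<in> LR (r - 1)"
    and "w = (0, k', l', 0)" "k' \<in> KR (r - 1)" "l' \<in> LR (r - 1)"
    using assms(3,4) unfolding B_mid[OF r] by blast
  then show ?thesis by (simp add: B_mid[OF r] KR_add LR_add)
qed

lemma B_scl:
  assumes r: "1 \<le> r" "r < d" and "c \<in> \<RR>" "v \<in> B r"
  shows "bscl c v \<in> B r"
proof -
  obtain k l where "v = (0, k, l, 0)" "k \<in> KR (r - 1)" "l \<in> LR (r - 1)"
    using assms(4) unfolding B_mid[OF r] by blast
  then show ?thesis using assms(3) by (simp add: B_mid[OF r] KR_scl LR_scl)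
qed

lemma linear_over_zero: "linear_over R sm M N f \<Longrightarrow> 0 \<in> M \<Longrightarrow> f 0 = 0"
  unfolding linear_over_def by (metis add_cancel_right_right)

text \<open>The boundaries of basis elements generate the modules.\<close>

lemma linear_over_eqI:
  assumes r: "1 \<le> r" "r < d" and f: "linear_over \<RR> bscl (B r) N f" and g: "linear_over \<RR> bscl (B r) N g"
    and eqK: "\<And>I m. I \<in> subs V r \<Longrightarrow> m \<in> mons V n \<Longrightarrow>
      f (0, dkosz V (single (I, m) 1), 0, 0) = g (0, dkosz V (single (I, m) 1), 0, 0)"
    and eqL: "\<And>I m. I \<in> subs V r \<Longrightarrow> m \<in> mons V (n - 1) \<Longrightarrow>
      f (0, 0, kosz V (single (I, m) 1), 0) = g (0, 0, kosz V (single (I, m) 1), 0)"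
    and v: "v \<in> B r"
  shows "f v = g v"
proof -
  define E where "E = {v \<in> B r. f v = g v}"
  have zero: "0 \<in> E"
    using B_zero[OF r] linear_over_zero[OF f] linear_over_zero[OF g] by (simp add: E_def)
  have add: "v + w \<in> E" if "v \<in> E" "w \<in> E" for v w
    using that f g B_add[OF r] by (simp add: E_def linear_over_def)
  have scl: "bscl c v \<in> E" if "c \<in> \<RR>" "v \<in> E" for c v
    using that f g B_scl[OF r] by (simp add: E_def linear_over_def)
  obtain k l where kl: "v = (0, k, l, 0)" "k \<in> KR (r - 1)" "l \<in> LR (r - 1)"
    using v unfolding B_mid[OF r] by blast
  have keys: "keys (dkhtpy V k) \<subseteq> subs V r \<times> mons V n" "keys (khtpy l) \<subseteq> subs V r \<times> mons V (n - 1)"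
    using keys_dkhtpy_KR[OF kl(2)] keys_khtpy_LR[OF kl(3)] r by auto
  have "(0, dkosz V (dkhtpy V k), 0, 0) \<in> E"
  proof (rule coeffs_induct[OF keys(1) crr_dkhtpy_KR[OF kl(2)]])
    show "(0, dkosz V 0, 0, 0) \<in> E" using zero by (simp add: hom_zero[OF hom_dkosz] zero_prod_def)
    show "(0, dkosz V (S + T), 0, 0) \<in> E" if "(0, dkosz V S, 0, 0) \<in> E" "(0, dkosz V T, 0, 0) \<in> E" for S T
      using add[OF that] by (simp add: hom_add[OF hom_dkosz])
    show "(0, dkosz V (scl c T), 0, 0) \<in> E" if "c \<in> \<RR>" "(0, dkosz V T, 0, 0) \<in> E" for c T
      using scl[OF that] by (simp add: hom_scl[OF hom_dkosz])
    fix j assume "j \<in> subs V r \<times> mons V n"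
    then obtain I m where j: "j = (I, m)" "I \<in> subs V r" "m \<in> mons V n" by blast
    have "dkosz V (single j 1) \<in> KR (r - 1)"
      unfolding j(1) by (intro dkosz_in_KR subs_mons_single crr_single RR_one j)
    then show "(0, dkosz V (single j 1), 0, 0) \<in> E"
      using LR_zero eqK[OF j(2,3)] by (simp add: E_def B_mid[OF r] j(1))
  qed
  moreover have "(0, 0, kosz V (khtpy l), 0) \<in> E"
  proof (rule coeffs_induct[OF keys(2) crr_khtpy_LR[OF kl(3)]])
    show "(0, 0, kosz V 0, 0) \<in> E" using zero by (simp add: hom_zero[OF hom_kosz] zero_prod_def)
    show "(0, 0, kosz V (S + T), 0) \<in> E" if "(0, 0, kosz V S, 0) \<in> E" "(0, 0, kosz V T, 0) \<in> E" for S T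
      using add[OF that] by (simp add: hom_add[OF hom_kosz])
    show "(0, 0, kosz V (scl c T), 0) \<in> E" if "c \<in> \<RR>" "(0, 0, kosz V T, 0) \<in> E" for c T
      using scl[OF that] by (simp add: hom_scl[OF hom_kosz])
    fix j assume "j \<in> subs V r \<times> mons V (n - 1)"
    then obtain I m where j: "j = (I, m)" "I \<in> subs V r" "m \<in> mons V (n - 1)" by blast
    have "kosz V (single j 1) \<in> LR (r - 1)"
      unfolding j(1) by (intro kosz_in_LR subs_mons_single crr_single RR_one j)
    then show "(0, 0, kosz V (single j 1), 0) \<in> E"
      using KR_zero eqL[OF j(2,3)] by (simp add: E_def B_mid[OF r] j(1))
  qed
  ultimately have "(0, k, 0, 0) + (0, 0, l, 0) \<in> E"
    using add by (simp only: dkosz_dkhtpy_KR[OF kl(2)] kosz_khtpy_LR[OF kl(3)])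
  then show ?thesis by (simp add: kl(1) E_def)
qed

text \<open>The elements of \<open>B\<^sub>r\<close> on which the pairings are prescribed.\<close>

definition gens :: "nat \<Rightarrow> bmod set"
  where "gens r = {(0, bc (eta (tens \<theta> \<nu>)), bc (kappa (tens \<theta>' \<mu>)), 0) | \<theta> \<theta>' \<nu> \<mu>.
    \<theta> \<in> Ext0 r \<and> \<theta>' \<in> Ext0 r \<and> \<nu> \<in> D0 n \<and> \<mu> \<in> Sym0 (n - 1)}"

lemma
  assumes "I \<in> subs V r"
  shows dkosz_in_gens: "m \<in> mons V n \<Longrightarrow> (0, dkosz V (single (I, m) 1), 0, 0) \<in> gens r"
    and kosz_in_gens: "m \<in> mons V (n - 1) \<Longrightarrow> (0, 0, kosz V (single (I, m) 1), 0) \<in> gens r"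
proof -
  have keys: "keys (single (I, m) (1::int)) \<subseteq> Pow V \<times> UNIV" for m :: mon
    by (rule keys_subs_Pow[OF subs_mons_single[OF assms UNIV_I]])
  have tens0: "tens 0 f = 0" for f :: "mon \<Rightarrow>\<^sub>0 int" by (rule hom_zero[OF hom_tens_left])
  show "(0, dkosz V (single (I, m) 1), 0, 0) \<in> gens r" if "m \<in> mons V n"
    unfolding gens_def
    by (intro CollectI exI[of _ "single I 1"] exI[of _ "single m 1"] exI[of _ 0])
      (use assms that in \<open>simp add: Ext0_iff D0_def Sym0_def tens0 hom_zero[OF hom_kappa] tens_single
        eta_eq[OF keys] bc_dkosz bc_single\<close>)
  show "(0, 0, kosz V (single (I, m) 1), 0) \<in> gens r" if "m \<in> mons V (n - 1)"
    unfolding gens_def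
    by (intro CollectI exI[of _ 0] exI[of _ "single I 1"] exI[of _ "single m 1"])
      (use assms that in \<open>simp add: Ext0_iff D0_def Sym0_def tens0 hom_zero[OF hom_eta] tens_single
        kappa_eq[OF keys] bc_kosz bc_single\<close>)
qed

lemma is_pp_unique:
  assumes r: "1 \<le> r" "r < d" and \<beta>: "is_pp r \<beta>" "is_pp r \<gamma>" and v: "v \<in> B r" and w: "w \<in> B (d - r)"
  shows "\<beta> v w = \<gamma> v w"
proof -
  have r': "1 \<le> d - r" "d - r < d" using r by auto
  have gens: "\<beta> v w = \<gamma> v w" if "v \<in> gens r" "w \<in> gens (d - r)" for v w
  proof -
    from that obtain \<theta> \<theta>' \<nu> \<mu> \<rho> \<rho>' \<nu>' \<mu>' where v: "v = (0, bc (eta (tens \<theta> \<nu>)), bc (kappa (tens \<theta>' \<mu>)), 0)"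
      and w: "w = (0, bc (eta (tens \<rho> \<nu>')), bc (kappa (tens \<rho>' \<mu>')), 0)"
      and \<theta>: "\<theta> \<in> Ext0 r" "\<theta>' \<in> Ext0 r" and \<rho>: "\<rho> \<in> Ext0 (d - r)" "\<rho>' \<in> Ext0 (d - r)"
      and \<nu>: "\<nu> \<in> D0 n" "\<nu>' \<in> D0 n" and \<mu>: "\<mu> \<in> Sym0 (n - 1)" "\<mu>' \<in> Sym0 (n - 1)"
      unfolding gens_def by blast
    have eq: "f v w = (0, 0, 0, bc (wedge (act (functional (contr \<mu> \<nu>')) \<theta>') \<rho>
        - wedge (act (functional (contr \<mu>' \<nu>)) \<theta>) \<rho>'))" if "is_pp r f" for f
      unfolding v w
      by (rule that[unfolded is_pp_def, THEN conjunct2, rule_format, OF \<theta> \<rho> \<nu> \<mu>])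
    show ?thesis unfolding eq[OF \<beta>(1)] eq[OF \<beta>(2)] by (rule refl)
  qed
  have left: "linear_over \<RR> bscl (B r) (B d) (\<lambda>v. \<beta> v w)" "linear_over \<RR> bscl (B r) (B d) (\<lambda>v. \<gamma> v w)"
    if "w \<in> B (d - r)" for w
    using \<beta> that by (simp_all add: is_pp_def bilinear_over_def)
  have right: "linear_over \<RR> bscl (B (d - r)) (B d) (\<beta> v)" "linear_over \<RR> bscl (B (d - r)) (B d) (\<gamma> v)"
    using \<beta> v by (simp_all add: is_pp_def bilinear_over_def)
  have left_eq: "\<beta> v w = \<gamma> v w" if w: "w \<in> B (d - r)" "w \<in> gens (d - r)" for w
    by (rule linear_over_eqI[OF r left[OF w(1)]]) (intro gens dkosz_in_gens kosz_in_gens w(2) v; assumption)+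
  have "(0, dkosz V (single (I, m) 1), 0, 0) \<in> B (d - r)" if "I \<in> subs V (d - r)" "m \<in> mons V n" for I m
    using dkosz_in_KR[OF subs_mons_single[OF that] crr_single[OF RR_one]] LR_zero by (simp add: B_mid[OF r'])
  moreover have "(0, 0, kosz V (single (I, m) 1), 0) \<in> B (d - r)" if "I \<in> subs V (d - r)" "m \<in> mons V (n - 1)" for I m
    using kosz_in_LR[OF subs_mons_single[OF that] crr_single[OF RR_one]] KR_zero by (simp add: B_mid[OF r'])
  ultimately show ?thesis
    by (intro linear_over_eqI[OF r' right _ _ w] left_eq dkosz_in_gens kosz_in_gens)
qed

lemma pp_eq_ppx:
  assumes r: "1 \<le> r" "r < d" and "v \<in> B r" "w \<in> B (d - r)"
  shows "pp r v w = ppx r v w"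
proof -
  have "is_pp r (SOME \<beta>. is_pp r \<beta>)" by (rule someI[of "is_pp r", OF is_pp_ppx[OF r]])
  then have "is_pp r (pp r)" using r by (simp add: pp_def)
  then show ?thesis using is_pp_ppx[OF r] assms by (intro is_pp_unique)
qed

end

lemma single_eq_single_iff: "single k a = single k c \<longleftrightarrow> a = c"
  by (metis lookup_single_eq)

text \<open>A pairing induces a bijection onto the homomorphisms if it is nondegenerate and represents all of them.\<close>

lemma bij_betw_module_HomI:
  assumes add: "\<And>v w. v \<in> N \<Longrightarrow> w \<in> N \<Longrightarrow> v + w \<in> N" and scl: "\<And>c v. c \<in> R \<Longrightarrow> v \<in> N \<Longrightarrow> sm c v \<in> N"
    and lin: "\<And>a. a \<in> M \<Longrightarrow> linear_over R sm N Q (\<beta> a)"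
    and inj: "\<And>a a'. a \<in> M \<Longrightarrow> a' \<in> M \<Longrightarrow> (\<And>v. v \<in> N \<Longrightarrow> \<beta> a v = \<beta> a' v) \<Longrightarrow> a = a'"
    and surj: "\<And>f. linear_over R sm N Q f \<Longrightarrow> \<exists>a\<in>M. \<forall>v\<in>N. \<beta> a v = f v"
  shows "bij_betw (\<lambda>a. restrict (\<beta> a) N) M (module_Hom R sm N Q)"
proof (rule bij_betw_imageI)
  show "inj_on (\<lambda>a. restrict (\<beta> a) N) M"
  proof (rule inj_onI)
    fix a a' assume a: "a \<in> M" "a' \<in> M" and eq: "restrict (\<beta> a) N = restrict (\<beta> a') N"
    show "a = a'"
    proof (rule inj[OF a])
      fix v assume "v \<in> N" then show "\<beta> a v = \<beta> a' v" using fun_cong[OF eq, of v] by simp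
    qed
  qed
  show "(\<lambda>a. restrict (\<beta> a) N) ` M = module_Hom R sm N Q"
  proof (intro equalityI subsetI)
    fix f assume "f \<in> (\<lambda>a. restrict (\<beta> a) N) ` M"
    then obtain a where a: "a \<in> M" "f = restrict (\<beta> a) N" by blast
    have "linear_over R sm N Q f"
      using lin[OF a(1)] add scl by (simp add: a(2) linear_over_def)
    moreover have "f \<in> N \<rightarrow>\<^sub>E Q"
      using lin[OF a(1)] unfolding a(2) linear_over_def by (intro PiE_I) simp_all
    ultimately show "f \<in> module_Hom R sm N Q" by (simp add: module_Hom_def)
  next
    fix f assume f: "f \<in> module_Hom R sm N Q"
    then have "linear_over R sm N Q f" by (simp add: module_Hom_def)
    then obtain a where a: "a \<in> M" "\<forall>v\<in>N. \<beta> a v = f v" using surj by blast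
    have "f = restrict (\<beta> a) N"
    proof
      fix v show "f v = restrict (\<beta> a) N v"
        using f a(2) PiE_arb[of f N "\<lambda>_. Q" v] by (cases "v \<in> N") (simp_all add: module_Hom_def)
    qed
    then show "f \<in> (\<lambda>a. restrict (\<beta> a) N) ` M" using a(1) by blast
  qed
qed

context pointed_free_module
begin

subsection \<open>Graded symmetry\<close>

lemma ppc_swap:
  assumes r: "1 \<le> r" "r < d"
    and kl: "k \<in> KR (r - 1)" "l \<in> LR (r - 1)" "k' \<in> KR (d - r - 1)" "l' \<in> LR (d - r - 1)"
  shows "ppc r k l k' l' = (- 1) ^ (r * (d - r)) * ppc (d - r) k' l' k l"
proof -
  obtain a where "r = Suc a" using r(1) by (cases r) auto
  moreover obtain c where "d - r = Suc c" using r(2) by (cases "d - r") auto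
  ultimately have ac: "r = Suc a" "d - r = Suc c" by blast+
  have "r - 1 = a" "d - r - 1 = c" using ac by arith+
  note kl = kl[unfolded this]
  have deg: "keys k \<subseteq> subs V a \<times> UNIV" "keys (khtpy l) \<subseteq> subs V (Suc a) \<times> UNIV"
    "keys k' \<subseteq> subs V c \<times> UNIV" "keys (khtpy l') \<subseteq> subs V (Suc c) \<times> UNIV"
    using kl keys_khtpy_LR[OF kl(2)] keys_khtpy_LR[OF kl(4)] by (auto simp: KR_def)
  have card: "a + Suc c = card V" "Suc a + c = card V" using ac unfolding card_V by arith+
  have 1: "etpair V (khtpy l') k = (- 1) ^ (a * Suc c) * etpair V k (khtpy l')"
    by (rule etpair_swap[OF _ deg(1,4) card(1)]) simp
  have 2: "etpair V k' (khtpy l) = (- 1) ^ (Suc a * c) * etpair V (khtpy l) k'"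
    by (rule etpair_swap[OF _ deg(2,3) card(2)]) simp
  have sign: "(- 1) ^ (Suc a + 1) * Y - X = (- 1) ^ (Suc a * Suc c) *
      ((- 1) ^ (Suc c + 1) * ((- 1) ^ (a * Suc c) * X) - (- 1) ^ (Suc a * c) * Y)" for X Y :: rr
    by (cases "even a"; cases "even c") (simp_all add: minus_one_power_iff)
  show ?thesis
    unfolding ppc_def 1 2 ac(2) unfolding ac(1) by (rule sign)
qed

lemma bscl_top: "bscl c (0, 0, 0, single V e) = (0, 0, 0, single V (c * e))"
  by simp

lemma pp_0: "pp 0 (\<alpha>, 0, 0, 0) (0, 0, 0, single V c) = (0, 0, 0, single V (\<alpha> * c))"
  by (simp add: pp_def)

lemma pp_d: "pp d w v = pp 0 v w"
  using d_ge_3 by (cases v; cases w) (simp add: pp_def)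

lemma pp_symmetric:
  assumes "r \<le> d" and v: "v \<in> B r" and w: "w \<in> B (d - r)"
  shows "pp r v w = bscl ((- 1) ^ (r * (d - r))) (pp (d - r) w v)"
proof -
  consider "r = 0" | "r = d" | "1 \<le> r" "r < d" using assms(1) by linarith
  then show ?thesis
  proof cases
    case 1
    then show ?thesis using pp_d[of w v] by (cases "pp 0 v w") simp
  next
    case 2
    then show ?thesis using pp_d[of v w] by (cases "pp 0 w v") simp
  next
    case 3
    then have 4: "1 \<le> d - r" "d - r < d" "d - (d - r) = r" by auto
    obtain k l where kl: "v = (0, k, l, 0)" "k \<in> KR (r - 1)" "l \<in> LR (r - 1)"
      using v unfolding B_mid[OF 3] by blast
    obtain k' l' where kl': "w = (0, k', l', 0)" "k' \<in> KR (d - r - 1)" "l' \<in> LR (d - r - 1)"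
      using w unfolding B_mid[OF 4(1,2)] by blast
    have "pp r v w = ppx r v w" using 3 v w by (intro pp_eq_ppx)
    moreover have "pp (d - r) w v = ppx (d - r) w v"
      using 4 v w by (intro pp_eq_ppx) simp_all
    ultimately show ?thesis
      using ppc_swap[OF 3 kl(2,3) kl'(2,3)] by (simp only: kl(1) kl'(1) ppx_tuple bscl_top)
  qed
qed

subsection \<open>Perfectness\<close>

lemma ppc_nondegenerate:
  assumes r: "1 \<le> r" "r < d" and kl: "k \<in> KR (r - 1)" "l \<in> LR (r - 1)"
    and zero: "\<And>k' l'. k' \<in> KR (d - r - 1) \<Longrightarrow> l' \<in> LR (d - r - 1) \<Longrightarrow> ppc r k l k' l' = 0"
  shows "k = 0" "l = 0"
proof -
  have compl: "V - I \<in> subs V (d - r)" if "I \<in> subs V (r - 1)" for I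
    using that r finite_subset[of I V] by (auto simp: subs_def card_Diff_subset)
  have "etpair V k (single (V - I, m) 1) = 0" if "I \<in> subs V (r - 1)" "m \<in> mons V (n - 1)" for I m
  proof -
    let ?S = "single (V - I, m) (1 :: rr)"
    have S: "keys ?S \<subseteq> subs V (d - r) \<times> mons V (n - 1)"
      using compl[OF that(1)] that(2) by (rule subs_mons_single)
    have "ppc r k l 0 (kosz V ?S) = 0"
      by (intro zero KR_zero kosz_in_LR S crr_single RR_one)
    then show ?thesis
      using etpair_cycle_khtpy[OF kl(1) S] r by (simp add: ppc_def hom_zero[OF form_etpair_right])
  qed
  note zero_k = this
  have "keys k \<subseteq> subs V (r - 1) \<times> mons V (n - 1)" using kl(1) by (simp add: KR_def)
  then show "k = 0" using zero_k by (rule etpair_nondegenerate)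
  have "etpair V l (single (V - I, m) 1) = 0" if "I \<in> subs V (r - 1)" "m \<in> mons V n" for I m
  proof -
    let ?T = "single (V - I, m) (1 :: rr)"
    have T: "keys ?T \<subseteq> subs V (d - r) \<times> mons V n"
      using compl[OF that(1)] that(2) by (rule subs_mons_single)
    have "ppc r k l (dkosz V ?T) 0 = 0"
      by (intro zero LR_zero dkosz_in_KR T crr_single RR_one)
    then have "(- 1) ^ (r + 1) * ((- 1) ^ (r - 1) * etpair V l ?T) = 0"
      using etpair_khtpy_dkosz[OF kl(2) keys_subs_Pow[OF T]]
      by (simp add: ppc_def hom_zero[OF form_etpair_right] hom_zero[OF hom_khtpy])
    then have "(- 1) ^ (r + 1) * ((- 1) ^ (r - 1) * etpair V l ?T) =
        (- 1) ^ (r + 1) * ((- 1) ^ (r - 1) * 0)" by simp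
    then show ?thesis by (rule neg_one_power_cancel[OF neg_one_power_cancel])
  qed
  note zero_l = this
  have "keys l \<subseteq> subs V (r - 1) \<times> mons V n" using kl(2) by (simp add: LR_def)
  then show "l = 0" using zero_l by (rule etpair_nondegenerate)
qed

text \<open>In exterior degree \<open>0\<close> there is nothing to contract, and the truncated difference \<open>a - 1\<close> is not the
  degree of a boundary.\<close>

lemma dkosz_degree_0: "keys T \<subseteq> subs V 0 \<times> M \<Longrightarrow> dkosz V T = 0"
proof -
  assume T: "keys T \<subseteq> subs V 0 \<times> M"
  show ?thesis
  proof (rule hom_eqI[of scl _ "\<lambda>_. 0", OF hom_dkosz homI])
    fix k assume "k \<in> keys T"
    then obtain m where "k = ({}, m)" using T finite_subset[of _ V] by (auto simp: subs_def)
    then show "dkosz V (single k 1) = 0" by (simp add: dkosz_single)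
  qed simp_all
qed

lemma kosz_degree_0: "keys T \<subseteq> subs V 0 \<times> M \<Longrightarrow> kosz V T = 0"
proof -
  assume T: "keys T \<subseteq> subs V 0 \<times> M"
  show ?thesis
  proof (rule hom_eqI[of scl _ "\<lambda>_. 0", OF hom_kosz homI])
    fix k assume "k \<in> keys T"
    then obtain m where "k = ({}, m)" using T finite_subset[of _ V] by (auto simp: subs_def)
    then show "kosz V (single k 1) = 0" by (simp add: kosz_single)
  qed simp_all
qed

text \<open>Every family of elements of \<open>\<RR>\<close> is the family of pairings of a chain with the basis elements.\<close>

lemma etpair_representing:
  fixes w :: "nat set \<times> mon \<Rightarrow> rr"
  assumes "\<And>J m. J \<in> subs V (card V - a) \<Longrightarrow> m \<in> mons V s \<Longrightarrow> w (J, m) \<in> \<RR>"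
  obtains T where "keys T \<subseteq> subs V a \<times> mons V s" "coeffs_in_RR T"
    and "\<And>J m. a \<le> card V \<Longrightarrow> J \<in> subs V (card V - a) \<Longrightarrow> m \<in> mons V s \<Longrightarrow> etpair V T (single (J, m) 1) = w (J, m)"
proof
  let ?A = "subs V a \<times> mons V s"
  define T where "T = (\<Sum>k\<in>?A. single k (csgn V (fst k) * w (V - fst k, snd k)))"
  have "finite (subs V a)" by (rule finite_subset[of _ "Pow V"]) (auto simp: subs_def)
  then have fin: "finite ?A" by (simp add: finite_mons)
  have compl: "V - I \<in> subs V (card V - a)" if "I \<in> subs V a" for I
    using that finite_subset[of I V] by (auto simp: subs_def card_Diff_subset)
  show keys: "keys T \<subseteq> ?A"
    unfolding T_def by (intro keys_sum_subset order_trans[OF keys_single_subset]) blast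
  show "coeffs_in_RR T"
    unfolding T_def
  proof (intro crr_sum crr_single RR_mult RR_csgn)
    fix k assume "k \<in> ?A"
    then obtain I m where k: "k = (I, m)" "I \<in> subs V a" "m \<in> mons V s" by blast
    show "w (V - fst k, snd k) \<in> \<RR>" unfolding k(1) fst_conv snd_conv using compl[OF k(2)] k(3) by (rule assms)
  qed
  fix J m assume J: "a \<le> card V" "J \<in> subs V (card V - a)" "m \<in> mons V s"
  then have VJ: "V - J \<in> subs V a" "V - (V - J) = J"
    using finite_subset[of J V] by (auto simp: subs_def card_Diff_subset)
  have "lookup T (V - J, m) = (\<Sum>k\<in>?A. if k = (V - J, m) then csgn V (V - J) * w (J, m) else 0)"
    unfolding T_def lookup_sum using VJ(2) by (intro sum.cong refl) (auto simp: lookup_single)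
  also have "\<dots> = csgn V (V - J) * w (J, m)" using fin VJ J by simp
  finally have "csgn V (V - J) * etpair V T (single (J, m) 1) = csgn V (V - J) * w (J, m)"
    using lookup_eq_etpair[OF keys_subs_Pow[OF keys], of "V - J" m] VJ(2) by simp
  then show "etpair V T (single (J, m) 1) = w (J, m)"
    unfolding csgn_def by (rule neg_one_power_cancel)
qed

text \<open>A homomorphism \<open>f\<close> on \<open>B\<^bsub>d - r\<^esub>\<close> with values in \<open>B\<^sub>d\<close> is the pairing with an element of \<open>B\<^sub>r\<close>. With
  \<open>g\<close> for the coefficient of \<open>f\<close>, the forms \<open>S \<mapsto> - g(0, \<kappa> S)\<close> and \<open>T \<mapsto> g(\<eta> T, 0)\<close> on chains are
  represented by chains \<open>k\<close> and \<open>l\<close>, and \<open>(k, l)\<close> is the element sought.\<close>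

lemma ppx_surjective:
  assumes r: "1 \<le> r" "r < d" and f: "linear_over \<RR> bscl (B (d - r)) (B d) f"
  obtains v where "v \<in> B r" "\<And>w. w \<in> B (d - r) \<Longrightarrow> ppx r v w = f w"
proof -
  have r': "1 \<le> d - r" "d - r < d" "card V - (r - 1) = d - r" "r - 1 \<le> card V" using r by auto
  define g where "g w = lookup (snd (snd (snd (f w)))) V" for w
  have f_g: "f w = (0, 0, 0, single V (g w))" and g_RR: "g w \<in> \<RR>" if "w \<in> B (d - r)" for w
  proof -
    have "f w \<in> B d" using f that unfolding linear_over_def by blast
    then show "f w = (0, 0, 0, single V (g w))" "g w \<in> \<RR>" by (auto simp: B_d g_def)
  qed
  have g_zero: "g 0 = 0" using linear_over_zero[OF f B_zero[OF r'(1,2)]] by (simp add: g_def)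
  have g_add: "g (v + w) = g v + g w" if "v \<in> B (d - r)" "w \<in> B (d - r)" for v w
    using f that by (simp add: g_def linear_over_def lookup_add)
  have g_scl: "g (bscl c v) = c * g v" if "c \<in> \<RR>" "v \<in> B (d - r)" for c v
    using f that by (simp add: linear_over_def f_g g_def[of "bscl c v"])
  have singleK: "(0, dkosz V (single (J, m) 1), 0, 0) \<in> B (d - r)"
    if "J \<in> subs V (d - r)" "m \<in> mons V n" for J m
    using dkosz_in_KR[OF subs_mons_single[OF that] crr_single[OF RR_one]] LR_zero
    by (simp add: B_mid[OF r'(1,2)])
  have singleL: "(0, 0, kosz V (single (J, m) 1), 0) \<in> B (d - r)"
    if "J \<in> subs V (d - r)" "m \<in> mons V (n - 1)" for J m
    using kosz_in_LR[OF subs_mons_single[OF that] crr_single[OF RR_one]] KR_zero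
    by (simp add: B_mid[OF r'(1,2)])
  obtain k where k: "keys k \<subseteq> subs V (r - 1) \<times> mons V (n - 1)" "coeffs_in_RR k"
    and k_single: "\<And>J m. J \<in> subs V (d - r) \<Longrightarrow> m \<in> mons V (n - 1) \<Longrightarrow>
      etpair V k (single (J, m) 1) = - g (0, 0, kosz V (single (J, m) 1), 0)"
    using etpair_representing[of "r - 1" "n - 1" "\<lambda>j. - g (0, 0, kosz V (single j 1), 0)"]
      g_RR singleL RR_uminus r' by metis
  have k_pair: "etpair V k S = - g (0, 0, kosz V S, 0)"
    if S: "keys S \<subseteq> subs V (d - r) \<times> mons V (n - 1)" "coeffs_in_RR S" for S
  proof -
    have "(0, 0, kosz V S, 0) \<in> B (d - r) \<and> etpair V k S = - g (0, 0, kosz V S, 0)"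
      (is "?v S \<in> _ \<and> _")
    proof (rule coeffs_induct[OF S])
      show "?v 0 \<in> B (d - r) \<and> etpair V k 0 = - g (?v 0)"
        using B_zero[OF r'(1,2)] g_zero
        by (simp add: hom_zero[OF hom_kosz] hom_zero[OF form_etpair_right] zero_prod_def)
      show "?v (S + T) \<in> B (d - r) \<and> etpair V k (S + T) = - g (?v (S + T))"
        if "?v S \<in> B (d - r) \<and> etpair V k S = - g (?v S)"
          "?v T \<in> B (d - r) \<and> etpair V k T = - g (?v T)" for S T
        using that B_add[OF r'(1,2), of "?v S" "?v T"] g_add[of "?v S" "?v T"]
        by (simp add: hom_add[OF hom_kosz] hom_add[OF form_etpair_right])
      show "?v (scl c T) \<in> B (d - r) \<and> etpair V k (scl c T) = - g (?v (scl c T))"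
        if "c \<in> \<RR>" "?v T \<in> B (d - r) \<and> etpair V k T = - g (?v T)" for c T
        using that B_scl[OF r'(1,2), of c "?v T"] g_scl[of c "?v T"]
        by (simp add: hom_scl[OF hom_kosz] hom_scl[OF form_etpair_right])
    qed (use singleL k_single in auto)
    then show ?thesis by blast
  qed
  obtain l where l: "keys l \<subseteq> subs V (r - 1) \<times> mons V n" "coeffs_in_RR l"
    and l_single: "\<And>J m. J \<in> subs V (d - r) \<Longrightarrow> m \<in> mons V n \<Longrightarrow>
      etpair V l (single (J, m) 1) = g (0, dkosz V (single (J, m) 1), 0, 0)"
    using etpair_representing[of "r - 1" n "\<lambda>j. g (0, dkosz V (single j 1), 0, 0)"]
      g_RR singleK r' by metis
  have l_pair: "etpair V l T = g (0, dkosz V T, 0, 0)"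
    if T: "keys T \<subseteq> subs V (d - r) \<times> mons V n" "coeffs_in_RR T" for T
  proof -
    have "(0, dkosz V T, 0, 0) \<in> B (d - r) \<and> etpair V l T = g (0, dkosz V T, 0, 0)"
      (is "?v T \<in> _ \<and> _")
    proof (rule coeffs_induct[OF T])
      show "?v 0 \<in> B (d - r) \<and> etpair V l 0 = g (?v 0)"
        using B_zero[OF r'(1,2)] g_zero
        by (simp add: hom_zero[OF hom_dkosz] hom_zero[OF form_etpair_right] zero_prod_def)
      show "?v (S + T) \<in> B (d - r) \<and> etpair V l (S + T) = g (?v (S + T))"
        if "?v S \<in> B (d - r) \<and> etpair V l S = g (?v S)"
          "?v T \<in> B (d - r) \<and> etpair V l T = g (?v T)" for S T
        using that B_add[OF r'(1,2), of "?v S" "?v T"] g_add[of "?v S" "?v T"]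
        by (simp add: hom_add[OF hom_dkosz] hom_add[OF form_etpair_right])
      show "?v (scl c T) \<in> B (d - r) \<and> etpair V l (scl c T) = g (?v (scl c T))"
        if "c \<in> \<RR>" "?v T \<in> B (d - r) \<and> etpair V l T = g (?v T)" for c T
        using that B_scl[OF r'(1,2), of c "?v T"] g_scl[of c "?v T"]
        by (simp add: hom_scl[OF hom_dkosz] hom_scl[OF form_etpair_right])
    qed (use singleK l_single in auto)
    then show ?thesis by blast
  qed
  have compl: "V - I \<in> subs V (d - r + 1)" if "I \<in> subs V (r - 1 - 1)" "r \<noteq> 1" for I
    using that r finite_subset[of I V] by (auto simp: subs_def card_Diff_subset)
  \<comment> \<open>Both chains are cycles: their boundaries are orthogonal to every basis element, since \<kappa> and \<eta>
    have square zero.\<close>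
  have "dkosz V k = 0"
  proof (cases "r = 1")
    case True
    then show ?thesis using k(1) by (intro dkosz_degree_0) simp
  next
    case False
    show ?thesis
    proof (rule etpair_nondegenerate[OF keys_dkosz[OF _ k(1)]])
      fix I m assume Im: "I \<in> subs V (r - 1 - 1)" "m \<in> mons V (n - 1 - 1)"
      let ?S = "single (V - I, m) (1 :: rr)"
      have S: "keys ?S \<subseteq> subs V (d - r + 1) \<times> mons V (n - 1 - 1)"
        using compl[OF Im(1) False] Im(2) by (rule subs_mons_single)
      have "n - 1 - 1 + 1 = n - 1" using n_ge_2 by simp
      then have "keys (kosz V ?S) \<subseteq> subs V (d - r) \<times> mons V (n - 1)"
        using keys_kosz[OF _ S] by simp
      then have "etpair V k (kosz V ?S) = 0"
        by (subst k_pair) (simp_all add: kosz_kosz crr_kosz crr_single RR_one zero_prod_def[symmetric] g_zero)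
      then show "etpair V (dkosz V k) ?S = 0"
        using k(1) by (subst etpair_dkosz[of V k "r - 1"]) (auto simp: subs_def)
    qed simp
  qed
  then have k_KR: "k \<in> KR (r - 1)" using k by (simp add: KR_def)
  have "kosz V l = 0"
  proof (cases "r = 1")
    case True
    then show ?thesis using l(1) by (intro kosz_degree_0) simp
  next
    case False
    show ?thesis
    proof (rule etpair_nondegenerate[OF keys_kosz[OF _ l(1)]])
      fix I m assume Im: "I \<in> subs V (r - 1 - 1)" "m \<in> mons V (n + 1)"
      let ?T = "single (V - I, m) (1 :: rr)"
      have T: "keys ?T \<subseteq> subs V (d - r + 1) \<times> mons V (n + 1)"
        using compl[OF Im(1) False] Im(2) by (rule subs_mons_single)
      have "keys (dkosz V ?T) \<subseteq> subs V (d - r) \<times> mons V n"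
        using keys_dkosz[OF _ T] by simp
      then have "etpair V l (dkosz V ?T) = 0"
        by (subst l_pair) (simp_all add: dkosz_dkosz crr_dkosz crr_single RR_one zero_prod_def[symmetric] g_zero)
      then show "etpair V (kosz V l) ?T = 0"
        using l(1) by (subst etpair_kosz[of V l "r - 1"]) (auto simp: subs_def)
    qed simp
  qed
  then have l_LR: "l \<in> LR (r - 1)" using l by (simp add: LR_def)
  show ?thesis
  proof
    show "(0, k, l, 0) \<in> B r" using k_KR l_LR by (simp add: B_mid[OF r])
    fix w assume w: "w \<in> B (d - r)"
    then obtain k' l' where kl': "w = (0, k', l', 0)" "k' \<in> KR (d - r - 1)" "l' \<in> LR (d - r - 1)"
      unfolding B_mid[OF r'(1,2)] by blast
    let ?T = "dkhtpy V k'" and ?S = "khtpy l'"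
    have d: "d - r - 1 + 1 = d - r" using r by simp
    note T = dkosz_dkhtpy_KR[OF kl'(2)] keys_dkhtpy_KR[OF kl'(2), unfolded d] crr_dkhtpy_KR[OF kl'(2)]
    note S = kosz_khtpy_LR[OF kl'(3)] keys_khtpy_LR[OF kl'(3), unfolded d] crr_khtpy_LR[OF kl'(3)]
    have "(- 1) ^ (r + 1) * etpair V (khtpy l) k' = (- 1) ^ (r + 1) * ((- 1) ^ (r - 1) * etpair V l ?T)"
      using etpair_khtpy_dkosz[OF l_LR keys_subs_Pow[OF T(2)]] by (simp only: T(1))
    also have "\<dots> = etpair V l ?T"
      using r(1) by (cases "even r") (simp_all add: minus_one_power_iff)
    also have "\<dots> = g (0, k', 0, 0)" using l_pair[OF T(2,3)] by (simp only: T(1))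
    finally have "ppc r k l k' l' = g (0, k', 0, 0) + g (0, 0, l', 0)"
      using k_pair[OF S(2,3)] by (simp add: ppc_def S(1))
    moreover have w': "(0, k', 0, 0) \<in> B (d - r)" "(0, 0, l', 0) \<in> B (d - r)"
      using kl' KR_zero LR_zero by (auto simp: B_mid[OF r'(1,2)])
    then have "f ((0, k', 0, 0) + (0, 0, l', 0)) = f (0, k', 0, 0) + f (0, 0, l', 0)"
      using f unfolding linear_over_def by blast
    then have "f w = f (0, k', 0, 0) + f (0, 0, l', 0)" by (simp add: kl'(1))
    ultimately show "ppx r (0, k, l, 0) w = f w"
      unfolding kl'(1) ppx_tuple by (simp add: f_g[OF w'(1)] f_g[OF w'(2)] single_add)
  qed
qed

lemma bij_ppx:
  assumes r: "1 \<le> r" "r < d"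
  shows "bij_betw (\<lambda>v. restrict (ppx r v) (B (d - r))) (B r) (module_Hom \<RR> bscl (B (d - r)) (B d))"
proof -
  have r': "1 \<le> d - r" "d - r < d" using r by auto
  have lin: "linear_over \<RR> bscl (B (d - r)) (B d) (ppx r v)" if "v \<in> B r" for v
    using bilinear_ppx[OF r] that by (simp add: bilinear_over_def)
  show ?thesis
  proof (rule bij_betw_module_HomI[OF B_add[OF r'] B_scl[OF r'] lin])
    fix v w assume v: "v \<in> B r" and w: "w \<in> B r"
      and eq: "\<And>u. u \<in> B (d - r) \<Longrightarrow> ppx r v u = ppx r w u"
    obtain k l where kl: "v = (0, k, l, 0)" "k \<in> KR (r - 1)" "l \<in> LR (r - 1)"
      using v unfolding B_mid[OF r] by blast
    obtain k2 l2 where kl2: "w = (0, k2, l2, 0)" "k2 \<in> KR (r - 1)" "l2 \<in> LR (r - 1)"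
      using w unfolding B_mid[OF r] by blast
    let ?k = "k + scl (- 1) k2" and ?l = "l + scl (- 1) l2"
    have mem: "?k \<in> KR (r - 1)" "?l \<in> LR (r - 1)"
      using kl kl2 by (simp_all add: KR_add LR_add KR_scl LR_scl RR_uminus RR_one)
    have zero: "ppc r ?k ?l k' l' = 0" if "k' \<in> KR (d - r - 1)" "l' \<in> LR (d - r - 1)" for k' l'
    proof -
      have "(0, k', l', 0) \<in> B (d - r)" unfolding B_mid[OF r'] using that by blast
      then have "ppc r k l k' l' = ppc r k2 l2 k' l'"
        using eq unfolding kl(1) kl2(1) by (force simp: ppx_tuple single_eq_single_iff)
      then show ?thesis by (simp only: ppc_add_left ppc_scl_left) simp
    qed
    have "?k = 0" "?l = 0" using ppc_nondegenerate[OF r mem zero] by blast+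
    then show "v = w" by (simp add: kl(1) kl2(1) scl_uminus)
  next
    fix f assume "linear_over \<RR> bscl (B (d - r)) (B d) f"
    then show "\<exists>v\<in>B r. \<forall>w\<in>B (d - r). ppx r v w = f w" by (metis ppx_surjective[OF r])
  qed
qed

lemma perfect_pp_mid:
  assumes r: "1 \<le> r" "r < d"
  shows "perfect_pairing \<RR> bscl (B r) (B (d - r)) (B d) (pp r)"
  unfolding perfect_pairing_def
proof (intro conjI)
  have r': "1 \<le> d - r" "d - r < d" "d - (d - r) = r" using r by auto
  have "is_pp r (pp r)"
    using r someI[of "is_pp r", OF is_pp_ppx[OF r]] by (simp add: pp_def)
  then show lin: "bilinear_over \<RR> bscl (B r) (B (d - r)) (B d) (pp r)" by (simp add: is_pp_def)
  have "restrict (pp r v) (B (d - r)) = restrict (ppx r v) (B (d - r))" if "v \<in> B r" for v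
    using that by (intro restrict_ext pp_eq_ppx r)
  then show "bij_betw (\<lambda>v. restrict (pp r v) (B (d - r))) (B r) (module_Hom \<RR> bscl (B (d - r)) (B d))"
    using bij_ppx[OF r] by (simp cong: bij_betw_cong)
  \<comment> \<open>By the graded symmetry, pairing with \<open>w\<close> on the right is pairing with \<open>\<plusminus> w\<close> on the left.\<close>
  let ?s = "(- 1) ^ (r * (d - r)) :: rr"
  have s: "bscl ?s (bscl ?s w) = w" for w
    by (cases w) (simp add: mult.assoc[symmetric])
  have sB: "bscl ?s w \<in> B (d - r)" if "w \<in> B (d - r)" for w
    using that by (intro B_scl r' RR_neg_one_power)
  have "bij_betw (bscl ?s) (B (d - r)) (B (d - r))"
    by (rule bij_betw_byWitness[where f' = "bscl ?s"]) (use s sB in auto)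
  then have "bij_betw ((\<lambda>w. restrict (ppx (d - r) w) (B r)) \<circ> bscl ?s) (B (d - r)) (module_Hom \<RR> bscl (B r) (B d))"
    using bij_ppx[OF r'(1,2)] unfolding r'(3) by (rule bij_betw_trans)
  moreover have "restrict (\<lambda>v. pp r v w) (B r) = ((\<lambda>w. restrict (ppx (d - r) w) (B r)) \<circ> bscl ?s) w"
    if w: "w \<in> B (d - r)" for w
  proof -
    have "pp r v w = ppx (d - r) (bscl ?s w) v" if v: "v \<in> B r" for v
    proof -
      have "pp r v w = bscl ?s (pp (d - r) w v)" using r v w by (intro pp_symmetric) auto
      also have "pp (d - r) w v = ppx (d - r) w v" using r' v w by (intro pp_eq_ppx) simp_all
      also have "bscl ?s (ppx (d - r) w v) = ppx (d - r) (bscl ?s w) v"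
        using bilinear_ppx[OF r'(1,2)] v w RR_neg_one_power[of "r * (d - r)"]
        unfolding r'(3) bilinear_over_def linear_over_def by simp
      finally show ?thesis .
    qed
    then show ?thesis by (auto intro: restrict_ext)
  qed
  ultimately show "bij_betw (\<lambda>w. restrict (\<lambda>v. pp r v w) (B r)) (B (d - r)) (module_Hom \<RR> bscl (B r) (B d))"
    by (simp cong: bij_betw_cong)
qed

lemma B_0_closed: "v \<in> B 0 \<Longrightarrow> w \<in> B 0 \<Longrightarrow> v + w \<in> B 0" "c \<in> \<RR> \<Longrightarrow> v \<in> B 0 \<Longrightarrow> bscl c v \<in> B 0"
  by (auto simp: B_0 RR_add RR_mult)

lemma B_d_closed: "v \<in> B d \<Longrightarrow> w \<in> B d \<Longrightarrow> v + w \<in> B d" "c \<in> \<RR> \<Longrightarrow> v \<in> B d \<Longrightarrow> bscl c v \<in> B d"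
  by (auto simp: B_d single_eq_single_iff RR_add RR_mult single_add[symmetric])

lemma perfect_pp_0: "perfect_pairing \<RR> bscl (B 0) (B d) (B d) (pp 0)"
  unfolding perfect_pairing_def
proof (intro conjI)
  have left: "linear_over \<RR> bscl (B d) (B d) (pp 0 v)" if "v \<in> B 0" for v
    using that unfolding linear_over_def B_0 B_d
    by (auto simp: pp_0 single_eq_single_iff single_add[symmetric] algebra_simps RR_mult)
  have right: "linear_over \<RR> bscl (B 0) (B d) (\<lambda>v. pp 0 v w)" if "w \<in> B d" for w
    using that unfolding linear_over_def B_0 B_d
    by (auto simp: pp_0 single_eq_single_iff single_add[symmetric] algebra_simps RR_mult)
  show "bilinear_over \<RR> bscl (B 0) (B d) (B d) (pp 0)"
    using left right by (simp add: bilinear_over_def)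
  let ?e = "(0, 0, 0, single V 1) :: bmod" and ?i = "(1, 0, 0, 0) :: bmod"
  have e: "?e \<in> B d" "?i \<in> B 0" using RR_one by (auto simp: B_0 B_d)
  show "bij_betw (\<lambda>v. restrict (pp 0 v) (B d)) (B 0) (module_Hom \<RR> bscl (B d) (B d))"
  proof (rule bij_betw_module_HomI[OF B_d_closed left])
    fix v w assume v: "v \<in> B 0" "w \<in> B 0" and "\<And>u. u \<in> B d \<Longrightarrow> pp 0 v u = pp 0 w u"
    then have "pp 0 v ?e = pp 0 w ?e" using e(1) by blast
    then show "v = w" using v by (auto simp: B_0 pp_0 single_eq_single_iff)
  next
    fix f assume f: "linear_over \<RR> bscl (B d) (B d) f"
    then have "f ?e \<in> B d" using e(1) unfolding linear_over_def by blast
    then obtain \<alpha> where \<alpha>: "f ?e = (0, 0, 0, single V \<alpha>)" "\<alpha> \<in> \<RR>" by (auto simp: B_d)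
    have "pp 0 (\<alpha>, 0, 0, 0) w = f w" if w: "w \<in> B d" for w
    proof -
      obtain c where "w = (0, 0, 0, single V c)" "c \<in> \<RR>" using w unfolding B_d by blast
      then have c: "w = bscl c ?e" "c \<in> \<RR>" by simp_all
      have "f w = bscl c (f ?e)" unfolding c(1) using f c(2) e(1) unfolding linear_over_def by blast
      then show ?thesis by (simp add: c(1) \<alpha>(1) pp_0 mult.commute)
    qed
    then show "\<exists>v\<in>B 0. \<forall>w\<in>B d. pp 0 v w = f w" using \<alpha>(2) by (auto simp: B_0)
  qed
  show "bij_betw (\<lambda>w. restrict (\<lambda>v. pp 0 v w) (B 0)) (B d) (module_Hom \<RR> bscl (B 0) (B d))"
  proof (rule bij_betw_module_HomI[OF B_0_closed right])
    fix v w assume v: "v \<in> B d" "w \<in> B d" and "\<And>u. u \<in> B 0 \<Longrightarrow> pp 0 u v = pp 0 u w"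
    then have "pp 0 ?i v = pp 0 ?i w" using e(2) by blast
    then show "v = w" using v by (auto simp: B_d pp_0 single_eq_single_iff)
  next
    fix f assume f: "linear_over \<RR> bscl (B 0) (B d) f"
    then have "f ?i \<in> B d" using e(2) unfolding linear_over_def by blast
    then obtain c where c: "f ?i = (0, 0, 0, single V c)" "c \<in> \<RR>" by (auto simp: B_d)
    have "pp 0 v (0, 0, 0, single V c) = f v" if v: "v \<in> B 0" for v
    proof -
      obtain \<alpha> where "v = (\<alpha>, 0, 0, 0)" "\<alpha> \<in> \<RR>" using v unfolding B_0 by blast
      then have \<alpha>: "v = bscl \<alpha> ?i" "\<alpha> \<in> \<RR>" by simp_all
      have "f v = bscl \<alpha> (f ?i)" unfolding \<alpha>(1) using f \<alpha>(2) e(2) unfolding linear_over_def by blast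
      then show ?thesis by (simp add: \<alpha>(1) c(1) pp_0)
    qed
    then show "\<exists>w\<in>B d. \<forall>v\<in>B 0. pp 0 v w = f v" using c(2) unfolding B_d by blast
  qed
qed

lemma perfect_pairing_flip:
  "perfect_pairing R sm M N Q \<beta> \<Longrightarrow> perfect_pairing R sm N M Q (\<lambda>w v. \<beta> v w)"
  by (auto simp: perfect_pairing_def bilinear_over_def)

lemma perfect_pp: "r \<le> d \<Longrightarrow> perfect_pairing \<RR> bscl (B r) (B (d - r)) (B d) (pp r)"
proof -
  assume "r \<le> d"
  then consider "r = 0" | "r = d" | "1 \<le> r" "r < d" by linarith
  then show ?thesis
  proof cases
    case 2
    have "pp d = (\<lambda>w v. pp 0 v w)" by (intro ext pp_d)
    then show ?thesis using perfect_pairing_flip[OF perfect_pp_0] 2 by simp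
  qed (use perfect_pp_0 perfect_pp_mid in simp_all)
qed

end

text \<open>Contraction by \<open>x\<^sub>i\<close> reads off the coefficients at the monomials divisible by \<open>x\<^sub>i\<close>.\<close>

lemma lookup_tmap_contr:
  fixes T :: "(nat set \<times> mon) \<Rightarrow>\<^sub>0 'a::comm_ring_1"
  shows "lookup (tmap (\<lambda>\<theta>. \<theta>) (contr (single {#i#} 1)) T) (J, m) = lookup T (J, add_mset i m)"
proof (rule hom_eqI[OF form_lookup_compose[OF hom_tmap] form_lookup])
  fix k assume "k \<in> keys T"
  obtain I k' where k: "k = (I, k')" by (cases k)
  have "i \<in># k' \<and> k' - {#i#} = m \<longleftrightarrow> k' = add_mset i m" by auto
  then show "lookup (tmap (\<lambda>\<theta>. \<theta>) (contr (single {#i#} 1)) (single k (1::'a))) (J, m) =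
      lookup (single k 1) (J, add_mset i m)"
    by (cases "i \<in># k'") (auto simp: k tmap_single contr_single tens_single lookup_single when_def
      hom_zero[OF hom_tens_right])
qed

lemma tmap_contr_dkosz:
  "tmap (\<lambda>\<theta>. \<theta>) (contr y) (dkosz X T) = dkosz X (tmap (\<lambda>\<theta>. \<theta>) (contr y) T)"
  by (simp add: dkosz_eq hom_sum[OF hom_tmap] tmap_tmap[OF hom_ident hom_contr_right]
    tmap_tmap[OF hom_iprod hom_contr_right] contr_contr mult.commute)

lemma dkosz_tmap_contr:
  "dkosz X (tmap (\<lambda>\<theta>. \<theta>) (\<lambda>\<mu>. contr \<mu> \<nu>) T) = tmap (\<lambda>\<theta>. \<theta>) (\<lambda>\<mu>. contr \<mu> \<nu>) (kosz X T)"
  by (simp add: dkosz_eq kosz_eq hom_sum[OF hom_tmap] tmap_tmap[OF hom_ident hom_contr_left]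
    tmap_tmap[OF hom_iprod hom_contr_right] contr_contr)

lemma etpair_tmap_adjoint:
  assumes "keys T \<subseteq> A \<times> M" "keys S \<subseteq> A' \<times> M'"
    and "\<And>m m'. m \<in> M \<Longrightarrow> m' \<in> M' \<Longrightarrow>
      pair (g (single m 1)) (single m' 1) = pair (single m 1) (g' (single m' 1))"
  shows "etpair V (tmap (\<lambda>\<theta>. \<theta>) g T) S = etpair V T (tmap (\<lambda>\<theta>. \<theta>) g' S)"
  using etpair_adjoint[OF assms(1,2) _ assms(3), of V "\<lambda>\<theta>. \<theta>" 1 "\<lambda>\<theta>. \<theta>"] by simp

context pointed_free_module
begin

section \<open>The differentials\<close>

text \<open>The tensor product of \<open>Kos\<close> with the identity, on elements with exterior factor in \<open>\<And>U\<^sub>0\<close>.\<close>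

definition kos1 :: "((nat set \<times> mon) \<Rightarrow>\<^sub>0 rr) \<Rightarrow> ((nat set \<times> mon) \<Rightarrow>\<^sub>0 rr)"
  where "kos1 = tmap (lprod V (\<lambda>i. inR (x i))) (\<lambda>\<mu>. \<mu>)"

lemma hom_kos1: "hom kos1"
  unfolding kos1_def by (rule hom_tmap)

lemma Kos_eq: "keys \<theta> \<subseteq> Pow V \<Longrightarrow> Kos \<theta> = lprod V (\<lambda>i. inR (x i)) \<theta>"
  unfolding Kos_def lprod_def by (rule sum_act_xs) simp_all

lemma keys_single_tens: "I \<subseteq> V \<Longrightarrow> keys (tens (single I 1) f) \<subseteq> Pow V \<times> UNIV"
  using keys_tens[of "single I 1" f] keys_single_subset[of I] by blast

lemma b_components:
  assumes "keys T \<subseteq> Pow V \<times> UNIV"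
  shows b_KK_eq: "b_KK T = - scl (inR x1) (dkosz V (tmap (\<lambda>\<theta>. \<theta>) q_lift T)) + scl delta (kos1 T)"
    and b_KL_eq: "b_KL T = - scl (inR x1) (kosz V (tmap (\<lambda>\<theta>. \<theta>) q_proj T))"
    and b_LK_eq: "b_LK T = scl (inR x1) (dkosz V (tmap (\<lambda>\<theta>. \<theta>) tlift T))"
    and b_LL_eq: "b_LL T = scl (inR x1) (kosz V (tmap (\<lambda>\<theta>. \<theta>) tproj T)) + scl delta (kos1 T)"
proof -
  have k: "\<exists>I m. k = (I, m) \<and> I \<subseteq> V" if "k \<in> keys T" for k using assms that by blast
  have eta: "eta (tens (single I 1) f) = dkosz V (tens (single I 1) f)"
    and kappa: "kappa (tens (single I 1) f) = kosz V (tens (single I 1) f)"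
    and Kos: "Kos (single I 1) = lprod V (\<lambda>i. inR (x i)) (single I 1)" if "I \<subseteq> V" for I and f :: "mon \<Rightarrow>\<^sub>0 rr"
    using that eta_eq[OF keys_single_tens[OF that]] kappa_eq[OF keys_single_tens[OF that]]
    by (auto intro!: Kos_eq)
  note simps = lin_ext_single tmap_single kos1_def q_lift_def q_proj_def tlift_def tproj_def eta kappa Kos
  show "b_KK T = - scl (inR x1) (dkosz V (tmap (\<lambda>\<theta>. \<theta>) q_lift T)) + scl delta (kos1 T)"
    unfolding b_KK_def
    by (rule hom_eqI[OF hom_lin_ext hom_addI[OF hom_negI[OF hom_sclI[OF hom_compose[OF hom_dkosz hom_tmap]]]
        hom_sclI[OF hom_kos1]]]) (auto dest!: k simp: simps)
  show "b_KL T = - scl (inR x1) (kosz V (tmap (\<lambda>\<theta>. \<theta>) q_proj T))"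
    unfolding b_KL_def
    by (rule hom_eqI[OF hom_lin_ext hom_negI[OF hom_sclI[OF hom_compose[OF hom_kosz hom_tmap]]]])
      (auto dest!: k simp: simps)
  show "b_LK T = scl (inR x1) (dkosz V (tmap (\<lambda>\<theta>. \<theta>) tlift T))"
    unfolding b_LK_def
    by (rule hom_eqI[OF hom_lin_ext hom_sclI[OF hom_compose[OF hom_dkosz hom_tmap]]])
      (auto dest!: k simp: simps)
  show "b_LL T = scl (inR x1) (kosz V (tmap (\<lambda>\<theta>. \<theta>) tproj T)) + scl delta (kos1 T)"
    unfolding b_LL_def
    by (rule hom_eqI[OF hom_lin_ext hom_addI[OF hom_sclI[OF hom_compose[OF hom_kosz hom_tmap]]
        hom_sclI[OF hom_kos1]]]) (auto dest!: k simp: simps)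
qed

text \<open>Up to the term \<open>delta Kos\<close>, the differential of \<open>(k, l)\<close> consists of the boundaries of the
  following two chains.\<close>

definition chainK :: "rr ext_dpow \<Rightarrow> rr ext_sym \<Rightarrow> rr ext_dpow"
  where "chainK k l = scl (inR x1) (tmap (\<lambda>\<theta>. \<theta>) tlift l - tmap (\<lambda>\<theta>. \<theta>) q_lift k)"

definition chainL :: "rr ext_dpow \<Rightarrow> rr ext_sym \<Rightarrow> rr ext_sym"
  where "chainL k l = scl (inR x1) (tmap (\<lambda>\<theta>. \<theta>) tproj l - tmap (\<lambda>\<theta>. \<theta>) q_proj k)"

text \<open>The two components of the differential of \<open>(k, l)\<close>.\<close>

definition bK :: "rr ext_dpow \<Rightarrow> rr ext_sym \<Rightarrow> rr ext_dpow"
  where "bK k l = dkosz V (chainK k l) + scl delta (kos1 k)"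

definition bL :: "rr ext_dpow \<Rightarrow> rr ext_sym \<Rightarrow> rr ext_sym"
  where "bL k l = kosz V (chainL k l) + scl delta (kos1 l)"

lemma scl_diff: "scl c (f - g) = scl c f - (scl c g :: 'k \<Rightarrow>\<^sub>0 'a::comm_ring_1)"
  by (rule poly_mapping_eqI) (simp add: lookup_scl lookup_minus algebra_simps)

lemma b_mid:
  assumes r: "2 \<le> r" "r < d" and k: "k \<in> KR a" and l: "l \<in> LR a"
  shows "b r (0, k, l, 0) = (0, bK k l, bL k l, 0)"
proof -
  have keys: "keys k \<subseteq> Pow V \<times> UNIV" "keys l \<subseteq> Pow V \<times> UNIV"
    using k l by (auto simp: KR_def LR_def subs_def)
  have "b_KK k + b_LK l = bK k l" "b_KL k + b_LL l = bL k l"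
    unfolding b_KK_eq[OF keys(1)] b_KL_eq[OF keys(1)] b_LK_eq[OF keys(2)] b_LL_eq[OF keys(2)]
      bK_def bL_def chainK_def chainL_def
    by (simp_all add: hom_scl[OF hom_dkosz] hom_scl[OF hom_kosz] hom_diff[OF hom_dkosz]
        hom_diff[OF hom_kosz] scl_diff)
  then show ?thesis using r by (simp add: b_def)
qed

lemma keys_diff_subset: "keys f \<subseteq> A \<Longrightarrow> keys g \<subseteq> A \<Longrightarrow> keys (f - g) \<subseteq> A"
  using keys_diff[of f g] by blast

lemma crr_diff: "coeffs_in_RR f \<Longrightarrow> coeffs_in_RR g \<Longrightarrow> coeffs_in_RR (f - g)"
  using crr_add[of f "- g"] crr_neg[of g] by simp

lemma crr_single_1: "coeffs_in_RR (single k 1)"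
  by (simp add: crr_single RR_one)

lemma
  assumes k: "k \<in> KR a" and l: "l \<in> LR a"
  shows keys_chainK: "keys (chainK k l) \<subseteq> subs V a \<times> mons {1..d} n"
    and keys_chainL: "keys (chainL k l) \<subseteq> subs V a \<times> mons V (n - 1)"
    and crr_chainK: "coeffs_in_RR (chainK k l)"
    and crr_chainL: "coeffs_in_RR (chainL k l)"
proof -
  have k': "keys k \<subseteq> subs V a \<times> mons V (n - 1)" "coeffs_in_RR k"
    and l': "keys l \<subseteq> subs V a \<times> mons V n" "coeffs_in_RR l"
    using k l by (simp_all add: KR_def LR_def)
  have ident: "keys (single I (1::rr)) \<subseteq> subs V a" if "I \<in> subs V a" for I
    using that order_trans[OF keys_single_subset] by simp
  show "keys (chainK k l) \<subseteq> subs V a \<times> mons {1..d} n"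
    unfolding chainK_def
    by (intro order_trans[OF keys_scl] keys_diff_subset keys_tmap[OF k'(1)] keys_tmap[OF l'(1)]
        ident keys_q_lift keys_tlift)
  show "keys (chainL k l) \<subseteq> subs V a \<times> mons V (n - 1)"
    unfolding chainL_def
    by (intro order_trans[OF keys_scl] keys_diff_subset keys_tmap[OF k'(1)] keys_tmap[OF l'(1)]
        ident keys_q_proj keys_tproj)
  show "coeffs_in_RR (chainK k l)"
    unfolding chainK_def
    by (intro crr_scl crr_diff crr_tmap k' l' RR_inR crr_q_lift crr_tlift crr_single_1)
  show "coeffs_in_RR (chainL k l)"
    unfolding chainL_def
    by (intro crr_scl crr_diff crr_tmap k' l' RR_inR crr_q_proj crr_tproj crr_single_1)
qed

lemma keys_kos1: "keys T \<subseteq> subs V a \<times> M \<Longrightarrow> keys (kos1 T) \<subseteq> subs V (a - 1) \<times> M"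
proof -
  assume T: "keys T \<subseteq> subs V a \<times> M"
  have "keys (single m (1::rr)) \<subseteq> M" if "m \<in> M" for m
    using that order_trans[OF keys_single_subset] by simp
  then show ?thesis
    unfolding kos1_def by (intro keys_tmap[OF T] keys_lprod_single) auto
qed

lemma crr_kos1: "coeffs_in_RR T \<Longrightarrow> coeffs_in_RR (kos1 T)"
  unfolding kos1_def
  by (intro crr_tmap) (auto simp: lprod_def intro!: crr_sum crr_scl RR_inR crr_iprod crr_single_1)

lemma kos1_KR: "k \<in> KR a \<Longrightarrow> kos1 k \<in> KR (a - 1)"
  using keys_kos1[of k a "mons V (n - 1)"] dkosz_lprod[of V V "\<lambda>i. inR (x i)" k]
  by (simp add: KR_def crr_kos1 kos1_def[symmetric] hom_zero[OF hom_kos1])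

lemma kos1_LR: "l \<in> LR a \<Longrightarrow> kos1 l \<in> LR (a - 1)"
  using keys_kos1[of l a "mons V n"] kosz_lprod[of V V "\<lambda>i. inR (x i)" l]
  by (simp add: LR_def crr_kos1 kos1_def[symmetric] hom_zero[OF hom_kos1])

text \<open>The chain \<open>chainK k l\<close> involves divided powers of \<open>x\<^sub>1\<^sup>*\<close>, but its boundary does not, as \<open>k\<close> and \<open>l\<close>
  are cycles.\<close>

lemma dkosz_chainK_in_KR:
  assumes k: "k \<in> KR a" and l: "l \<in> LR a"
  shows "dkosz V (chainK k l) \<in> KR (a - 1)"
proof -
  let ?c = "contr (single {#1#} 1) :: rr dpow \<Rightarrow> rr dpow" and ?D = "dkosz V (chainK k l)"
  have kk: "keys k \<subseteq> subs V a \<times> mons V (n - 1)" "dkosz V k = 0"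
    and ll: "keys l \<subseteq> subs V a \<times> mons V n" "kosz V l = 0"
    using k l by (simp_all add: KR_def LR_def)
  have "tmap (\<lambda>\<theta>. \<theta>) (\<lambda>\<nu>. ?c (q_lift \<nu>)) k = tmap (\<lambda>\<theta>. \<theta>) (\<lambda>\<nu>. scl delta \<nu>) k"
  proof (rule tmap_cong[OF refl])
    fix I m assume "(I, m) \<in> keys k"
    then have "m \<in> mons V (n - 1)" using kk(1) by blast
    then have "m \<in> mons {1..d} (n - 1)" by (auto simp: mons_def)
    then show "?c (q_lift (single m 1)) = scl delta (single m 1)"
      by (intro contr_x1_q_lift order_trans[OF keys_single_subset]) simp
  qed
  also have "\<dots> = scl delta k" by (simp only: tmap_scl_right tmap_ident)
  finally have ck: "tmap (\<lambda>\<theta>. \<theta>) ?c (tmap (\<lambda>\<theta>. \<theta>) q_lift k) = scl delta k"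
    by (simp only: tmap_tmap[OF hom_ident hom_contr_right])
  have "tmap (\<lambda>\<theta>. \<theta>) (\<lambda>\<mu>. ?c (tlift \<mu>)) l = tmap (\<lambda>\<theta>. \<theta>) (\<lambda>\<mu>. scl delta (contr \<mu> Phi_tilde)) l"
  proof (rule tmap_cong[OF refl])
    fix I m assume "(I, m) \<in> keys l"
    then have "m \<in> mons V n" using ll(1) by blast
    then show "?c (tlift (single m 1)) = scl delta (contr (single m 1) Phi_tilde)"
      by (intro contr_x1_tlift order_trans[OF keys_single_subset]) simp
  qed
  then have cl: "tmap (\<lambda>\<theta>. \<theta>) ?c (tmap (\<lambda>\<theta>. \<theta>) tlift l) = scl delta (tmap (\<lambda>\<theta>. \<theta>) (\<lambda>\<mu>. contr \<mu> Phi_tilde) l)"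
    by (simp only: tmap_tmap[OF hom_ident hom_contr_right] tmap_scl_right)
  have "tmap (\<lambda>\<theta>. \<theta>) ?c ?D = 0"
    unfolding tmap_contr_dkosz chainK_def hom_scl[OF hom_tmap] hom_diff[OF hom_tmap] ck cl
    by (simp add: hom_scl[OF hom_dkosz] hom_diff[OF hom_dkosz] dkosz_tmap_contr kk(2) ll(2)
        hom_zero[OF hom_tmap])
  then have x1_free: "lookup ?D (J, add_mset 1 m) = 0" for J m
    using lookup_tmap_contr[of 1 ?D J m] by simp
  have keys: "keys ?D \<subseteq> subs V (a - 1) \<times> mons {1..d} (n - 1)"
    by (rule keys_dkosz[OF _ keys_chainK[OF k l]]) simp
  have "keys ?D \<subseteq> subs V (a - 1) \<times> mons V (n - 1)"
  proof
    fix j assume j: "j \<in> keys ?D"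
    then obtain J m where J: "j = (J, m)" "J \<in> subs V (a - 1)" "m \<in> mons {1..d} (n - 1)" using keys by blast
    have "1 \<notin># m"
    proof
      assume "1 \<in># m"
      then have "lookup ?D j = 0" using x1_free[of J "m - {#1#}"] J(1) by simp
      then show False using j by (simp add: in_keys_iff)
    qed
    then show "j \<in> subs V (a - 1) \<times> mons V (n - 1)" using J unfolding mons_def indices by auto
  qed
  then show ?thesis
    using crr_dkosz[OF crr_chainK[OF k l]] by (simp add: KR_def dkosz_dkosz)
qed

lemma bK_in_KR: "k \<in> KR a \<Longrightarrow> l \<in> LR a \<Longrightarrow> bK k l \<in> KR (a - 1)"
  unfolding bK_def by (intro KR_add KR_scl RR_delta kos1_KR dkosz_chainK_in_KR)

lemma bL_in_LR:
  assumes k: "k \<in> KR a" and l: "l \<in> LR a"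
  shows "bL k l \<in> LR (a - 1)"
  unfolding bL_def
  by (intro LR_add LR_scl RR_delta kos1_LR[OF l] kosz_in_LR keys_chainL[OF k l] crr_chainL[OF k l])

subsection \<open>The Leibniz rule in the middle degrees\<close>

lemma etpair_kos1:
  assumes "keys T \<subseteq> subs V a \<times> UNIV" "keys S \<subseteq> Pow V \<times> UNIV"
  shows "etpair V (kos1 T) S = (- 1) ^ (a + 1) * etpair V T (kos1 S)"
  unfolding kos1_def by (rule etpair_lprod[OF _ assms]) simp

text \<open>On the cycle \<open>l\<close>, \<open>Kos l\<close> is minus the boundary of \<open>Kos\<close> of the chain that the homotopy assigns to \<open>l\<close>.\<close>

lemma khtpy_bL:
  "l \<in> LR a \<Longrightarrow> khtpy (bL k l) = khtpy (kosz V (chainL k l)) - scl delta (khtpy (kosz V (kos1 (khtpy l))))"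
proof -
  assume l: "l \<in> LR a"
  have "kosz V (kos1 (khtpy l)) = - kos1 l"
    using kosz_lprod[of V V "\<lambda>i. inR (x i)" "khtpy l"] by (simp add: kos1_def kosz_khtpy_LR[OF l])
  then show ?thesis
    by (simp add: bL_def hom_add[OF hom_khtpy] hom_scl[OF hom_khtpy] hom_neg[OF hom_khtpy] scl_minus)
qed

text \<open>The terms of the Leibniz rule without \<open>delta\<close>.\<close>

lemma etpair_chains:
  assumes k: "k \<in> KR a" and l: "l \<in> LR a" and k': "k' \<in> KR c" and l': "l' \<in> LR c"
  shows "etpair V (chainL k l) k' - etpair V (chainK k l) l' + etpair V l (chainK k' l') =
    etpair V k (chainL k' l')"
proof -
  have keys: "keys k \<subseteq> subs V a \<times> mons V (n - 1)" "keys l \<subseteq> subs V a \<times> mons V n"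
    "keys k' \<subseteq> subs V c \<times> mons V (n - 1)" "keys l' \<subseteq> subs V c \<times> mons V n"
    using k l k' l' by (simp_all add: KR_def LR_def)
  have "etpair V (tmap (\<lambda>\<theta>. \<theta>) tproj l) k' = etpair V l (tmap (\<lambda>\<theta>. \<theta>) q_lift k')"
    by (rule etpair_tmap_adjoint[OF keys(2,3)]) (rule tproj_adjoint)
  moreover have "etpair V (tmap (\<lambda>\<theta>. \<theta>) q_proj k) k' = etpair V k (tmap (\<lambda>\<theta>. \<theta>) q_proj k')"
    by (rule etpair_tmap_adjoint[OF keys(1,3)]) (rule q_proj_selfadjoint)
  moreover have "etpair V (tmap (\<lambda>\<theta>. \<theta>) tlift l) l' = etpair V l (tmap (\<lambda>\<theta>. \<theta>) tlift l')"
    by (rule etpair_tmap_adjoint[OF keys(2,4)]) (rule tlift_selfadjoint)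
  moreover have "etpair V (tmap (\<lambda>\<theta>. \<theta>) q_lift k) l' = etpair V k (tmap (\<lambda>\<theta>. \<theta>) tproj l')"
    by (rule etpair_tmap_adjoint[OF keys(1,4)]) (rule q_lift_adjoint)
  ultimately show ?thesis
    by (simp add: chainK_def chainL_def hom_scl[OF form_etpair_left] hom_scl[OF form_etpair_right]
        hom_diff[OF form_etpair_left] hom_diff[OF form_etpair_right] algebra_simps)
qed

text \<open>In the proof, \<open>E1\<close> and \<open>E2\<close> are the terms with factor \<open>delta\<close>; each of them occurs twice, with opposite
  signs.\<close>

lemma ppc_Leibniz:
  assumes r: "1 \<le> r" "r + 1 < d"
    and k: "k \<in> KR r" and l: "l \<in> LR r" and k': "k' \<in> KR (d - r - 1)" and l': "l' \<in> LR (d - r - 1)"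
  shows "ppc r (bK k l) (bL k l) k' l' + (- 1) ^ (r + 1) * ppc (r + 1) k l (bK k' l') (bL k' l') = 0"
proof -
  define c where "c = d - r - 1"
  have c: "1 \<le> c" using r by (simp add: c_def)
  note k' = k'[folded c_def] and l' = l'[folded c_def]
  define E1 where "E1 = etpair V (khtpy l) (kos1 k')"
  define E2 where "E2 = etpair V k (kos1 (khtpy l'))"
  let ?s = "(- 1) ^ r :: rr"
  have Pow: "keys k' \<subseteq> Pow V \<times> UNIV" "keys (khtpy l') \<subseteq> Pow V \<times> UNIV"
    using k' keys_subs_Pow[OF keys_khtpy_LR[OF l']] by (auto simp: KR_def subs_def)
  have sub: "keys (khtpy l) \<subseteq> subs V (r + 1) \<times> UNIV" "keys k \<subseteq> subs V r \<times> UNIV"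
    "keys (chainK k l) \<subseteq> subs V r \<times> UNIV" "keys (chainK k' l') \<subseteq> Pow V \<times> UNIV"
    using keys_khtpy_LR[OF l] k keys_chainK[OF k l] keys_subs_Pow[OF keys_chainK[OF k' l']]
    by (auto simp: KR_def)
  have Y: "keys (kos1 (khtpy l)) \<subseteq> subs V r \<times> mons V (n - 1)"
    using keys_kos1[OF keys_khtpy_LR[OF l]] by simp
  have Y': "keys (kos1 (khtpy l')) \<subseteq> subs V c \<times> mons V (n - 1)"
    using keys_kos1[OF keys_khtpy_LR[OF l']] by simp
  have "etpair V (khtpy (bL k l)) k' = etpair V (chainL k l) k' - delta * etpair V (kos1 (khtpy l)) k'"
    unfolding khtpy_bL[OF l] hom_diff[OF form_etpair_left] hom_scl[OF form_etpair_left]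
      etpair_khtpy_kosz[OF k' keys_chainL[OF k l] r(1)] etpair_khtpy_kosz[OF k' Y r(1)] ..
  also have "etpair V (kos1 (khtpy l)) k' = (- 1) ^ (r + 1 + 1) * E1"
    unfolding E1_def by (rule etpair_kos1[OF sub(1) Pow(1)])
  finally have 1: "etpair V (khtpy (bL k l)) k' = etpair V (chainL k l) k' - delta * (?s * E1)"
    by simp
  have "etpair V (bK k l) (khtpy l') = (- 1) ^ (r + 1) * etpair V (chainK k l) l' + delta * etpair V (kos1 k) (khtpy l')"
    unfolding bK_def hom_add[OF form_etpair_left] hom_scl[OF form_etpair_left]
      etpair_dkosz_khtpy[OF sub(3) l'] ..
  also have "etpair V (kos1 k) (khtpy l') = (- 1) ^ (r + 1) * E2"
    unfolding E2_def by (rule etpair_kos1[OF sub(2) Pow(2)])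
  finally have 2: "etpair V (bK k l) (khtpy l') = - ?s * etpair V (chainK k l) l' - delta * (?s * E2)"
    by simp
  have 3: "etpair V (khtpy l) (bK k' l') = ?s * etpair V l (chainK k' l') + delta * E1"
    unfolding bK_def hom_add[OF form_etpair_right] hom_scl[OF form_etpair_right]
      etpair_khtpy_dkosz[OF l sub(4)] E1_def ..
  have 4: "etpair V k (khtpy (bL k' l')) = etpair V k (chainL k' l') - delta * E2"
    unfolding khtpy_bL[OF l'] hom_diff[OF form_etpair_right] hom_scl[OF form_etpair_right]
      etpair_cycle_khtpy[OF k keys_chainL[OF k' l'] c] etpair_cycle_khtpy[OF k Y' c] E2_def ..
  show ?thesis
    unfolding ppc_def 1 2 3 4 etpair_chains[OF k l k' l', symmetric]
    by (cases "even r") (simp_all add: minus_one_power_iff algebra_simps)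
qed

lemma pp_Leibniz_mid:
  assumes r: "1 \<le> r" "r + 1 < d" and v: "v \<in> B (r + 1)" and w: "w \<in> B (d - r)"
  shows "pp r (b (r + 1) v) w + bscl ((- 1) ^ (r + 1)) (pp (r + 1) v (b (d - r) w)) = 0"
proof -
  have r1: "1 \<le> r" "r < d" and r2: "1 \<le> r + 1" "r + 1 < d" and r3: "1 \<le> d - r" "d - r < d" "2 \<le> d - r"
    and r4: "1 \<le> d - (r + 1)" "d - (r + 1) < d"
    using r by auto
  obtain k l where kl: "v = (0, k, l, 0)" "k \<in> KR r" "l \<in> LR r"
    using v unfolding B_mid[OF r2] by auto
  obtain k' l' where kl': "w = (0, k', l', 0)" "k' \<in> KR (d - r - 1)" "l' \<in> LR (d - r - 1)"
    using w unfolding B_mid[OF r3(1,2)] by auto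
  have bv: "b (r + 1) v = (0, bK k l, bL k l, 0)"
    unfolding kl(1) using r by (intro b_mid[OF _ _ kl(2,3)]) auto
  have bw: "b (d - r) w = (0, bK k' l', bL k' l', 0)"
    unfolding kl'(1) by (rule b_mid[OF r3(3,2) kl'(2,3)])
  have "b (r + 1) v \<in> B r"
    unfolding bv B_mid[OF r1] using bK_in_KR[OF kl(2,3)] bL_in_LR[OF kl(2,3)] by blast
  then have 1: "pp r (b (r + 1) v) w = ppx r (b (r + 1) v) w" using w by (rule pp_eq_ppx[OF r1])
  have "d - (r + 1) - 1 = d - r - 1 - 1" by simp
  then have "b (d - r) w \<in> B (d - (r + 1))"
    unfolding bw B_mid[OF r4] using bK_in_KR[OF kl'(2,3)] bL_in_LR[OF kl'(2,3)] by auto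
  with v have 2: "pp (r + 1) v (b (d - r) w) = ppx (r + 1) v (b (d - r) w)" by (rule pp_eq_ppx[OF r2])
  show ?thesis
    unfolding 1 2 unfolding bv bw unfolding kl(1) kl'(1) ppx_tuple bscl_top
    using ppc_Leibniz[OF r kl(2,3) kl'(2,3)] by (simp add: single_add[symmetric] zero_prod_def)
qed

subsection \<open>The Leibniz rule at the ends\<close>

text \<open>The coefficients in \<open>b\<^sub>d\<close>, which are also the values of \<open>b\<^sub>1\<close> on basis elements, and the two
  chains of which the components of \<open>b\<^sub>d(c x\<^sub>V)\<close> are the boundaries.\<close>

definition coefK :: "mon \<Rightarrow> rr"
  where "coefK m = delta * toR (single m 1) - inR x1 * toR (q (contr (single m 1) Phi_tilde))"

definition coefL :: "mon \<Rightarrow> rr"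
  where "coefL m = inR x1 * toR (q (single m 1))"

definition topK :: "rr \<Rightarrow> rr ext_dpow"
  where "topK c = (\<Sum>m\<in>mons V n. scl (coefK m) (single (V, m) c))"

definition topL :: "rr \<Rightarrow> rr ext_sym"
  where "topL c = - (\<Sum>m\<in>mons V (n - 1). scl (coefL m) (single (V, m) c))"

lemma RR_coefK: "coefK m \<in> \<RR>"
  unfolding coefK_def
  by (intro RR_diff RR_mult RR_delta RR_inR RR_toR crr_q crr_contr crr_Phi_tilde crr_single_1)

lemma RR_coefL: "coefL m \<in> \<RR>"
  unfolding coefL_def by (intro RR_mult RR_inR RR_toR crr_q crr_single_1)

lemma V_subs: "V \<in> subs V (d - 1)"
  by (simp add: subs_def)

lemma
  assumes "c \<in> \<RR>"
  shows keys_topK: "keys (topK c) \<subseteq> subs V (d - 1) \<times> mons V n"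
    and crr_topK: "coeffs_in_RR (topK c)"
    and keys_topL: "keys (topL c) \<subseteq> subs V (d - 1) \<times> mons V (n - 1)"
    and crr_topL: "coeffs_in_RR (topL c)"
proof -
  show "keys (topK c) \<subseteq> subs V (d - 1) \<times> mons V n"
    unfolding topK_def by (intro keys_sum_subset order_trans[OF keys_scl] subs_mons_single V_subs)
  show "coeffs_in_RR (topK c)"
    unfolding topK_def by (intro crr_sum crr_scl RR_coefK crr_single assms)
  show "keys (topL c) \<subseteq> subs V (d - 1) \<times> mons V (n - 1)"
    unfolding topL_def keys_minus
    by (intro keys_sum_subset order_trans[OF keys_scl] subs_mons_single V_subs)
  show "coeffs_in_RR (topL c)"
    unfolding topL_def by (intro crr_neg crr_sum crr_scl RR_coefL crr_single assms)
qed

lemma b_d: "b d (0, 0, 0, single V c) = (0, dkosz V (topK c), kosz V (topL c), 0)"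
proof -
  have keys: "keys (single (V, m) c) \<subseteq> Pow V \<times> UNIV" for m :: mon
    using keys_single_subset[of "(V, m)" c] by auto
  have "bd_K (single V c) = dkosz V (topK c)"
    unfolding bd_K_def topK_def coefK_def
    by (simp only: hom_sum[OF hom_dkosz] hom_scl[OF hom_dkosz] tens_single mult_1_right eta_eq[OF keys])
  moreover have "bd_L (single V c) = kosz V (topL c)"
    unfolding bd_L_def topL_def coefL_def
    by (simp only: hom_sum[OF hom_kosz] hom_scl[OF hom_kosz] hom_neg[OF hom_kosz] tens_single
        mult_1_right kappa_eq[OF keys])
  ultimately show ?thesis using d_ge_3 by (simp add: b_def)
qed

lemma
  assumes "keys T \<subseteq> subs V 0 \<times> M"
  shows lookup_ext0_part: "lookup (ext0_part T) m = lookup T ({}, m)"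
    and keys_ext0_part: "keys (ext0_part T) \<subseteq> M"
proof -
  have "I = {}" if "(I, m) \<in> keys T" for I m
    using that assms finite_subset[of I V] by (auto simp: subs_def)
  then have *: "ext0_part T = (\<Sum>k\<in>keys T. single (snd k) (lookup T k))"
    unfolding ext0_part_def by (intro sum.cong refl) auto
  have fst: "fst k = {}" if "k \<in> keys T" for k
    using that \<open>\<And>m I. (I, m) \<in> keys T \<Longrightarrow> I = {}\<close> by (cases k) auto
  have "lookup (ext0_part T) m = (\<Sum>k\<in>keys T. if k = ({}, m) then lookup T k else 0)"
    unfolding * lookup_sum using fst
    by (intro sum.cong refl) (auto simp: lookup_single when_def prod_eq_iff)
  then show "lookup (ext0_part T) m = lookup T ({}, m)" by (auto simp: in_keys_iff)
  show "keys (ext0_part T) \<subseteq> M"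
    unfolding * using assms by (intro keys_sum_subset order_trans[OF keys_single_subset]) auto
qed

lemma etpair_top:
  assumes "keys T \<subseteq> subs V 0 \<times> M"
  shows "etpair V T (single (V, m) c) = c * lookup (ext0_part T) m"
proof -
  have "etpair V T (single (V, m) c) = etpair V T (scl c (single (V, m) 1))" by simp
  also have "\<dots> = c * etpair V T (single (V - {}, m) 1)"
    by (simp only: hom_scl[OF form_etpair_right] Diff_empty)
  also have "etpair V T (single (V - {}, m) 1) = lookup T ({}, m)"
    using lookup_eq_etpair[OF keys_subs_Pow[OF assms], of "{}" m] by simp
  finally show ?thesis by (simp only: lookup_ext0_part[OF assms])
qed

lemma form_superset:
  assumes "form f" "finite A" "keys T \<subseteq> A"
  shows "f T = (\<Sum>k\<in>A. lookup T k * f (single k 1))"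
  unfolding hom_expansion[OF assms(1), of T]
  using assms by (intro sum.mono_neutral_left) (auto simp: in_keys_iff)

lemma form_diffI: "form f \<Longrightarrow> form g \<Longrightarrow> form (\<lambda>T. f T - g T)"
  by (rule formI) (simp_all add: hom_add hom_scl algebra_simps)

lemma b1_K_eq: "keys \<nu> \<subseteq> mons V (n - 1) \<Longrightarrow> b1_K \<nu> = (\<Sum>m\<in>mons V (n - 1). lookup \<nu> m * coefL m)"
proof -
  assume "keys \<nu> \<subseteq> mons V (n - 1)"
  moreover have "form b1_K"
    unfolding b1_K_def[abs_def] by (intro form_multI form_compose[OF form_toR hom_q])
  ultimately show ?thesis
    using form_superset[of b1_K "mons V (n - 1)" \<nu>] by (simp add: finite_mons b1_K_def coefL_def)
qed

lemma b1_L_eq: "keys \<mu> \<subseteq> mons V n \<Longrightarrow> b1_L \<mu> = (\<Sum>m\<in>mons V n. lookup \<mu> m * coefK m)"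
proof -
  assume "keys \<mu> \<subseteq> mons V n"
  moreover have "form b1_L"
  proof -
    have "form (\<lambda>\<mu>. delta * toR \<mu>)" "form (\<lambda>\<mu>. inR x1 * toR (q (contr \<mu> Phi_tilde)))"
      by (intro form_multI form_toR form_compose[OF form_toR hom_compose[OF hom_q hom_contr_Phi_tilde]])+
    then show ?thesis unfolding b1_L_def[abs_def] by (rule form_diffI)
  qed
  ultimately show ?thesis
    using form_superset[of b1_L "mons V n" \<mu>] by (simp add: finite_mons b1_L_def coefK_def)
qed

lemma pp_Leibniz_0:
  assumes v: "v \<in> B 1" and w: "w \<in> B d"
  shows "pp 0 (b 1 v) w = pp 1 v (b d w)"
proof -
  have r: "1 \<le> (1::nat)" "1 < d" "1 \<le> d - 1" "d - 1 < d" using d_ge_3 by auto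
  obtain k l where kl: "v = (0, k, l, 0)" "k \<in> KR 0" "l \<in> LR 0"
    using v unfolding B_mid[OF r(1,2)] by auto
  obtain c where c: "w = (0, 0, 0, single V c)" "c \<in> \<RR>" using w unfolding B_d by blast
  have k: "keys k \<subseteq> subs V 0 \<times> mons V (n - 1)" and l: "keys l \<subseteq> subs V 0 \<times> mons V n"
    using kl by (simp_all add: KR_def LR_def)
  have "b d w \<in> B (d - 1)"
    unfolding c(1) b_d B_mid[OF r(3,4)]
    using dkosz_in_KR[OF keys_topK[OF c(2)] crr_topK[OF c(2)]]
      kosz_in_LR[OF keys_topL[OF c(2)] crr_topL[OF c(2)]] by blast
  with v have "pp 1 v (b d w) = ppx 1 v (b d w)" by (rule pp_eq_ppx[OF r(1,2)])
  also have "\<dots> = (0, 0, 0, single V (ppc 1 k l (dkosz V (topK c)) (kosz V (topL c))))"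
    unfolding kl(1) c(1) b_d by (rule ppx_tuple)
  also have "ppc 1 k l (dkosz V (topK c)) (kosz V (topL c)) = etpair V l (topK c) - etpair V k (topL c)"
    using etpair_khtpy_dkosz[OF kl(3) keys_subs_Pow[OF keys_topK[OF c(2)]]]
      etpair_cycle_khtpy[OF kl(2) keys_topL[OF c(2)] r(3)]
    by (simp add: ppc_def)
  also have "etpair V l (topK c) = c * b1_L (ext0_part l)"
    unfolding topK_def hom_sum[OF form_etpair_right] hom_scl[OF form_etpair_right] etpair_top[OF l]
      b1_L_eq[OF keys_ext0_part[OF l]] sum_distrib_left
    by (intro sum.cong refl) (simp add: ac_simps)
  also have "etpair V k (topL c) = - (c * b1_K (ext0_part k))"
    unfolding topL_def hom_neg[OF form_etpair_right] hom_sum[OF form_etpair_right]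
      hom_scl[OF form_etpair_right] etpair_top[OF k] b1_K_eq[OF keys_ext0_part[OF k]] sum_distrib_left
    by (intro arg_cong[of _ _ uminus] sum.cong refl) (simp add: ac_simps)
  finally have "pp 1 v (b d w) =
      (0, 0, 0, single V ((b1_K (ext0_part k) + b1_L (ext0_part l)) * c))"
    by (simp add: algebra_simps)
  moreover have "b 1 v = (b1_K (ext0_part k) + b1_L (ext0_part l), 0, 0, 0)"
    by (simp add: kl(1) b_def)
  ultimately show ?thesis by (simp only: c(1) pp_0)
qed

lemma pp_Leibniz:
  assumes "r \<le> d - 1" and v: "v \<in> B (r + 1)" and w: "w \<in> B (d - r)"
  shows "pp r (b (r + 1) v) w + bscl ((- 1) ^ (r + 1)) (pp (r + 1) v (b (d - r) w)) = 0"
proof -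
  have neg: "u + bscl (- 1) u = 0" for u by (cases u) (simp add: scl_uminus zero_prod_def)
  consider "r = 0" | "r = d - 1" | "1 \<le> r" "r + 1 < d" using assms(1) by linarith
  then show ?thesis
  proof cases
    case 1
    have "pp 0 (b 1 v) w = pp 1 v (b d w)" using v w 1 by (intro pp_Leibniz_0) simp_all
    then show ?thesis using 1 neg by simp
  next
    case 2
    have r: "1 \<le> d - 1" "d - 1 < d" "r + 1 = d" "d - r = 1" "d - (d - 1) = 1" using d_ge_3 2 by auto
    have v: "v \<in> B d" and w: "w \<in> B 1" using v w r by simp_all
    obtain c where c: "v = (0, 0, 0, single V c)" "c \<in> \<RR>" using v unfolding B_d by blast
    have "b d v \<in> B (d - 1)"
      unfolding c(1) b_d B_mid[OF r(1,2)]
      using dkosz_in_KR[OF keys_topK[OF c(2)] crr_topK[OF c(2)]]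
        kosz_in_LR[OF keys_topL[OF c(2)] crr_topL[OF c(2)]] by blast
    then have "pp (d - 1) (b d v) w = bscl ((- 1) ^ ((d - 1) * 1)) (pp 1 w (b d v))"
      using pp_symmetric[of "d - 1" "b d v" w] w unfolding r(5) by simp
    also have "pp 1 w (b d v) = pp d v (b 1 w)"
      using pp_Leibniz_0[OF w v] by (simp only: pp_d)
    finally have eq: "pp (d - 1) (b d v) w = bscl ((- 1) ^ (d - 1)) (pp d v (b 1 w))" by simp
    have "(- 1 :: rr) ^ d = - 1 * (- 1) ^ (d - 1)" using d_ge_3 by (cases d) simp_all
    then have "bscl ((- 1) ^ d) u = bscl (- 1) (bscl ((- 1) ^ (d - 1)) u)" for u
      by (cases u) (simp add: scl_uminus)
    then show ?thesis unfolding r(3,4) unfolding 2 eq by (simp only: neg)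
  next
    case 3
    then show ?thesis using v w by (rule pp_Leibniz_mid)
  qed
qed

end

theorem proposition7p10:
  fixes d n :: nat
    and scale :: "int \<Rightarrow> 'u::ab_group_add \<Rightarrow> 'u"
    and x1 :: 'u and x1s :: "'u \<Rightarrow> int" and x :: "nat \<Rightarrow> 'u"
  assumes "pointed_free_module d n scale x1 x1s x"
  shows "(\<forall>r\<le>d.
      perfect_pairing (pointed_free_module.RR d n) bscl
        (pointed_free_module.B d n scale x r)
        (pointed_free_module.B d n scale x (d - r))
        (pointed_free_module.B d n scale x d)
        (pointed_free_module.pp d n scale x r)) \<and>
    (\<forall>r\<le>d.
      \<forall>\<Theta>\<in>pointed_free_module.B d n scale x r.
      \<forall>\<Psi>\<in>pointed_free_module.B d n scale x (d - r).
        pointed_free_module.pp d n scale x r \<Theta> \<Psi> =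
        bscl ((- 1) ^ (r * (d - r))) (pointed_free_module.pp d n scale x (d - r) \<Psi> \<Theta>)) \<and>
    (\<forall>r\<le>d - 1.
      \<forall>\<Theta>\<in>pointed_free_module.B d n scale x (r + 1).
      \<forall>\<Psi>\<in>pointed_free_module.B d n scale x (d - r).
        pointed_free_module.pp d n scale x r (pointed_free_module.b d n scale x1 x1s x (r + 1) \<Theta>) \<Psi> +
        bscl ((- 1) ^ (r + 1))
          (pointed_free_module.pp d n scale x (r + 1) \<Theta> (pointed_free_module.b d n scale x1 x1s x (d - r) \<Psi>)) = 0)"
proof -
  interpret pointed_free_module d n scale x1 x1s x by (rule assms)
  show ?thesis using perfect_pp pp_symmetric pp_Leibniz by blast
qed

end
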